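(* Let $n$ be a positive integer with $\gcd(n,3)=1$. For generic $x,y\in\mathbb{C}^*$, \[ f_{n,n+3,n}(x,y,q)=g_{n,n+3,n}(x,y,q,y^n/x^n,x^n/y^n)-\Theta_{n,3}(x,y,q), \] where, writing $Q=q^{3(2n+3)}$, \begin{align*} \Theta_{n,3}(x,y,q):=&\frac{q^{n\binom{n+1}{2}}(-x)(-y)^nJ_{3n}J_{3(2n+3)}\,j(y/x;Q)\,j(q^{n^2+n}x;q^{2n+3})\,j(q^{n^2+n}y;q^{2n+3})}{J_{2n+3}^2\,j(y^n/x^n;q^{3n(2n+3)})\,j(q^{3n^2+3n}x^3;Q)\,j(q^{3n^2+3n}y^3;Q)}\\ &\cdot\Big\{j(q^{3n^2+5n+3}x^2y;Q)\,j(q^{3n^2+5n+3}xy^2;Q)-q^{2n^2+2n}xy\,j(q^{3n^2+7n+6}x^2y;Q)\,j(q^{3n^2+7n+6}xy^2;Q)\Big\}. \end{align*}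
   Context: Let $q\in\mathbb{C}$ with $0<|q|<1$. $j(x;q):=(x;q)_\infty(q/x;q)_\infty(q;q)_\infty=\sum_{n\in\mathbb{Z}}(-1)^nq^{\binom n2}x^n$; $J_m:=j(q^m;q^{3m})=\prod_{i\ge1}(1-q^{mi})$. $m(x,q,z):=\frac{1}{j(z;q)}\sum_{r\in\mathbb{Z}}\frac{(-1)^rq^{\binom r2}z^r}{1-q^{r-1}xz}$. With $\mathrm{sg}(r)=1$ for $r\ge0$, $-1$ for $r<0$: $f_{a,b,c}(x,y,q):=\sum_{\mathrm{sg}(r)=\mathrm{sg}(s)}\mathrm{sg}(r)(-1)^{r+s}x^ry^sq^{a\binom r2+brs+c\binom s2}$ and \begin{align*} g_{a,b,c}(x,y,q,z_1,z_0):=&\sum_{t=0}^{a-1}(-y)^tq^{c\binom t2}j(q^{bt}x;q^a)\,m\Big(-q^{a\binom{b+1}{2}-c\binom{a+1}{2}-t(b^2-ac)}\frac{(-y)^a}{(-x)^b},q^{a(b^2-ac)},z_0\Big)\\ &+\sum_{t=0}^{c-1}(-x)^tq^{a\binom t2}j(q^{bt}y;q^c)\,m\Big(-q^{c\binom{b+1}{2}-a\binom{c+1}{2}-t(b^2-ac)}\frac{(-x)^c}{(-y)^b},q^{c(b^2-ac)},z_1\Big). \end{align*} "Generic" means no poles occur in the Appell–Lerch sums or theta quotients. *)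

theory Defs
  imports "HOL-Analysis.Analysis"
begin

definition qpoch_inf :: "complex \<Rightarrow> complex \<Rightarrow> complex" where
  "qpoch_inf x q = (\<Prod>k. 1 - x * q ^ k)"

definition jtheta :: "complex \<Rightarrow> complex \<Rightarrow> complex" where
  "jtheta x q = qpoch_inf x q * qpoch_inf (q / x) q * qpoch_inf q q"

definition Jtheta :: "nat \<Rightarrow> complex \<Rightarrow> complex" where
  "Jtheta m q = jtheta (q ^ m) (q ^ (3 * m))"

definition binom2 :: "int \<Rightarrow> int" where
  "binom2 r = r * (r - 1) div 2"

text \<open>The unordered sums below converge absolutely for \<open>0 < norm q < 1\<close> if,
  for the Appell--Lerch sum, no denominator vanishes and, for the double sum, \<open>a\<close> and \<open>c\<close> are positive.\<close>

definition appell_lerch :: "complex \<Rightarrow> complex \<Rightarrow> complex \<Rightarrow> complex" where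
  "appell_lerch x q z =
     1 / jtheta z q *
     (\<Sum>\<^sub>\<infinity>r::int. (-1) powi r * q powi (binom2 r) * z powi r / (1 - q powi (r - 1) * x * z))"

definition appell_lerch_generic :: "complex \<Rightarrow> complex \<Rightarrow> complex \<Rightarrow> bool" where
  "appell_lerch_generic x q z \<longleftrightarrow>
     jtheta z q \<noteq> 0 \<and> (\<forall>r::int. 1 - q powi (r - 1) * x * z \<noteq> 0)"

text \<open>Unlike \<open>sgn\<close>, this takes the value 1 at 0.\<close>

definition sg :: "int \<Rightarrow> int" where
  "sg r = (if r \<ge> 0 then 1 else -1)"

definition hecke_f :: "nat \<Rightarrow> nat \<Rightarrow> nat \<Rightarrow> complex \<Rightarrow> complex \<Rightarrow> complex \<Rightarrow> complex" where
  "hecke_f a b c x y q =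
     (\<Sum>\<^sub>\<infinity>(r, s)\<in>{(r, s). sg r = sg s}.
        of_int (sg r) * (-1) powi (r + s) * x powi r * y powi s *
        q powi (int a * binom2 r + int b * r * s + int c * binom2 s))"

text \<open>First argument of the Appell--Lerch sums in the first half of \<open>hecke_g\<close>; those in the second
  half arise by interchanging \<open>a\<close> with \<open>c\<close> and \<open>x\<close> with \<open>y\<close>.\<close>

definition hecke_g_arg ::
  "nat \<Rightarrow> nat \<Rightarrow> nat \<Rightarrow> complex \<Rightarrow> complex \<Rightarrow> complex \<Rightarrow> nat \<Rightarrow> complex" where
  "hecke_g_arg a b c x y q t =
     - (q powi (int a * int ((b + 1) choose 2) - int c * int ((a + 1) choose 2)
                - int t * ((int b)\<^sup>2 - int a * int c)))
     * ((- y) ^ a / (- x) ^ b)"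

definition hecke_g ::
  "nat \<Rightarrow> nat \<Rightarrow> nat \<Rightarrow> complex \<Rightarrow> complex \<Rightarrow> complex \<Rightarrow> complex \<Rightarrow> complex \<Rightarrow> complex" where
  "hecke_g a b c x y q z1 z0 =
     (\<Sum>t<a. (- y) ^ t * q ^ (c * (t choose 2)) * jtheta (q ^ (b * t) * x) (q ^ a) *
        appell_lerch (hecke_g_arg a b c x y q t) (q powi (int a * ((int b)\<^sup>2 - int a * int c))) z0) +
     (\<Sum>t<c. (- x) ^ t * q ^ (a * (t choose 2)) * jtheta (q ^ (b * t) * y) (q ^ c) *
        appell_lerch (hecke_g_arg c b a y x q t) (q powi (int c * ((int b)\<^sup>2 - int a * int c))) z1)"

definition hecke_g_generic ::
  "nat \<Rightarrow> nat \<Rightarrow> nat \<Rightarrow> complex \<Rightarrow> complex \<Rightarrow> complex \<Rightarrow> complex \<Rightarrow> complex \<Rightarrow> bool" where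
  "hecke_g_generic a b c x y q z1 z0 \<longleftrightarrow>
     (\<forall>t<a. appell_lerch_generic (hecke_g_arg a b c x y q t)
              (q powi (int a * ((int b)\<^sup>2 - int a * int c))) z0) \<and>
     (\<forall>t<c. appell_lerch_generic (hecke_g_arg c b a y x q t)
              (q powi (int c * ((int b)\<^sup>2 - int a * int c))) z1)"

definition Theta3_denom :: "nat \<Rightarrow> complex \<Rightarrow> complex \<Rightarrow> complex \<Rightarrow> complex" where
  "Theta3_denom n x y q =
     (let Q = q ^ (3 * (2 * n + 3)) in
       (Jtheta (2 * n + 3) q)\<^sup>2 * jtheta (y ^ n / x ^ n) (q ^ (3 * n * (2 * n + 3))) *
       jtheta (q ^ (3 * n\<^sup>2 + 3 * n) * x ^ 3) Q * jtheta (q ^ (3 * n\<^sup>2 + 3 * n) * y ^ 3) Q)"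

definition Theta3 :: "nat \<Rightarrow> complex \<Rightarrow> complex \<Rightarrow> complex \<Rightarrow> complex" where
  "Theta3 n x y q =
     (let Q = q ^ (3 * (2 * n + 3)) in
       (q ^ (n * ((n + 1) choose 2)) * (- x) * (- y) ^ n *
        Jtheta (3 * n) q * Jtheta (3 * (2 * n + 3)) q * jtheta (y / x) Q *
        jtheta (q ^ (n\<^sup>2 + n) * x) (q ^ (2 * n + 3)) *
        jtheta (q ^ (n\<^sup>2 + n) * y) (q ^ (2 * n + 3)))
       / Theta3_denom n x y q *
       (jtheta (q ^ (3 * n\<^sup>2 + 5 * n + 3) * x\<^sup>2 * y) Q *
        jtheta (q ^ (3 * n\<^sup>2 + 5 * n + 3) * x * y\<^sup>2) Q
        - q ^ (2 * n\<^sup>2 + 2 * n) * x * y *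
          jtheta (q ^ (3 * n\<^sup>2 + 7 * n + 6) * x\<^sup>2 * y) Q *
          jtheta (q ^ (3 * n\<^sup>2 + 7 * n + 6) * x * y\<^sup>2) Q))"

end

theory Submission
  imports Defs "HOL-Complex_Analysis.Complex_Analysis"
begin

text \<open>
  Fix \<open>x\<close> and put \<open>Q = q\<^bsup>3(2n+3)\<^esup>\<close>, \<open>z = y\<^sup>n / x\<^sup>n\<close>. Multiplied by \<open>j(z; Q\<^sup>n)\<close>, the defect
  \<open>f - g + \<Theta>\<close> becomes a function \<open>G(y)\<close> whose only possible singularities in \<open>y \<noteq> 0\<close> are simple
  poles at the zeros of \<open>j(q\<^bsup>3n(n+1)\<^esup> y\<^sup>3; Q)\<close>. The double sum and the Appell--Lerch sums satisfy the
  same inhomogeneous functional equations, so \<open>f - g\<close> satisfies homogeneous ones; together with the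
  quasi-periodicity of \<open>\<Theta>\<close> they give \<open>G(Qy) = c G(y)\<close> with \<open>c = Q\<^sup>n / (q\<^bsup>3n(n+1)\<^esup> x\<^sup>3)\<close>, which is not
  an integral power of \<open>Q\<close>. At each possible pole exactly one term of one Appell--Lerch sum is singular, and
  its residue is cancelled by that of \<open>\<Theta>\<close> because of a quintuple-product-like theta identity. Hence
  \<open>G\<close> is holomorphic on the punctured plane, and quasi-periodicity forces it to vanish.
\<close>

section \<open>Theta functions\<close>

text \<open>With z1 = y^n/x^n and z0 = 1/z1, the Lerch parameters in one half of g depend on x alone
  and in the other half on y alone; this is what confines the poles in y to one family. The obstacle
  is that the natural shifts (x, y) -> (q^n x, q^(n+3) y) and (x, y) -> (q^(n+3) x, q^n y) multiply
  y^n/x^n by q^(3n) and q^(-3n), to which the Lerch sums of modulus M = Q^n do not respond. So z is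
  kept as a third, independent variable, and only combinations under which y^n/x^n changes by a
  power of M are brought back to the diagonal z = y^n/x^n. One shift of each kind gives (p x, p y)
  with p = q^(2n+3). Playing n + 3 shifts of the first kind against n of the second gives y -> Q y,
  because (n+3)^2 - n^2 = 3(2n+3). The possible poles are y = p^k w/\<mu> with w^3 = 1 and \<mu> =
  q^(n^2+n). Moving y by Q alone preserves k modulo 3, so the simultaneous p-shift is needed to
  reach k = 0. There the singular part of g is a multiple of j(w/\<mu>; q^n). It vanishes for w = 1,
  as does the factor j(\<mu> y; p) of \<Theta>; the real cancellation takes place at the two
  primitive cube roots of unity.\<close>

lemma qpoch_convergent:
  assumes "norm q < 1"
  shows "convergent_prod (\<lambda>k. 1 - x * q ^ k :: complex)"
proof (rule abs_convergent_prod_imp_convergent_prod, rule summable_imp_abs_convergent_prod)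
  have "summable (\<lambda>k. norm x * norm q ^ k)"
    using assms by (intro summable_mult summable_geometric) auto
  thus "summable (\<lambda>k. norm ((1 - x * q ^ k) - 1))"
    by (simp add: norm_mult norm_power)
qed

lemma qpoch_LIMSEQ:
  assumes "norm q < 1"
  shows "(\<lambda>N. \<Prod>k<N. 1 - x * q ^ k) \<longlonglongrightarrow> qpoch_inf x q"
proof -
  have "(\<lambda>N. \<Prod>k\<le>N. 1 - x * q ^ k) \<longlonglongrightarrow> qpoch_inf x q"
    unfolding qpoch_inf_def by (rule convergent_prod_LIMSEQ[OF qpoch_convergent[OF assms]])
  hence "(\<lambda>N. \<Prod>k<Suc N. 1 - x * q ^ k) \<longlonglongrightarrow> qpoch_inf x q"
    by (simp only: lessThan_Suc_atMost)
  thus ?thesis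
    by (rule LIMSEQ_imp_Suc)
qed

lemma qpoch_rec:
  assumes "norm q < 1"
  shows "qpoch_inf x q = (1 - x) * qpoch_inf (q * x) q"
proof (rule LIMSEQ_unique)
  show "(\<lambda>N. \<Prod>k<Suc N. 1 - x * q ^ k) \<longlonglongrightarrow> qpoch_inf x q"
    by (rule LIMSEQ_Suc[OF qpoch_LIMSEQ[OF assms]])
  have "(\<lambda>N. (1 - x) * (\<Prod>k<N. 1 - q * x * q ^ k)) \<longlonglongrightarrow> (1 - x) * qpoch_inf (q * x) q"
    by (intro tendsto_intros qpoch_LIMSEQ assms)
  moreover have "(\<Prod>k<Suc N. 1 - x * q ^ k) = (1 - x) * (\<Prod>k<N. 1 - q * x * q ^ k)" for N
    by (subst prod.lessThan_Suc_shift) (simp add: mult_ac)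
  ultimately show "(\<lambda>N. \<Prod>k<Suc N. 1 - x * q ^ k) \<longlonglongrightarrow> (1 - x) * qpoch_inf (q * x) q"
    by simp
qed

lemma qpoch_eq_0_iff:
  assumes "norm q < 1"
  shows "qpoch_inf x q = 0 \<longleftrightarrow> (\<exists>k. x * q ^ k = 1)"
proof -
  have "(\<lambda>k. 1 - x * q ^ k) has_prod qpoch_inf x q"
    unfolding qpoch_inf_def by (rule convergent_prod_has_prod[OF qpoch_convergent[OF assms]])
  from has_prod_eq_0_iff[OF this] show ?thesis
    by (auto simp: image_iff)
qed

lemma qpoch_holomorphic:
  assumes "norm q < 1"
  shows "(\<lambda>x. qpoch_inf x q) holomorphic_on UNIV"
proof (rule holomorphic_uniform_sequence)
  show "(\<lambda>x. \<Prod>k<N. 1 - x * q ^ k) holomorphic_on UNIV" for N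
    by (intro holomorphic_intros)
  fix x0 :: complex
  have "uniformly_convergent_on (cball x0 1) (\<lambda>N x. \<Prod>k<N. 1 - x * q ^ k)"
  proof (rule uniformly_convergent_on_prod')
    show "uniformly_convergent_on (cball x0 1) (\<lambda>N x. \<Sum>n<N. norm (1 - x * q ^ n - 1))"
    proof (rule Weierstrass_m_test')
      show "summable (\<lambda>n. (norm x0 + 1) * norm q ^ n)"
        using assms by (intro summable_mult summable_geometric) auto
      fix n x assume "x \<in> cball x0 1"
      hence "norm x \<le> norm x0 + 1"
        using norm_triangle_ineq2[of x x0] by (simp add: dist_norm norm_minus_commute)
      thus "norm (norm (1 - x * q ^ n - 1)) \<le> (norm x0 + 1) * norm q ^ n"
        by (simp add: norm_mult norm_power mult_right_mono)
    qed
  qed (auto intro!: continuous_intros)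
  then obtain l where l: "uniform_limit (cball x0 1) (\<lambda>N x. \<Prod>k<N. 1 - x * q ^ k) l sequentially"
    by (auto simp: uniformly_convergent_on_def)
  have "l x = qpoch_inf x q" if "x \<in> cball x0 1" for x
    using tendsto_uniform_limitI[OF l that] qpoch_LIMSEQ[OF assms] LIMSEQ_unique by blast
  hence "uniform_limit (cball x0 1) (\<lambda>N x. \<Prod>k<N. 1 - x * q ^ k) (\<lambda>x. qpoch_inf x q) sequentially"
    using l uniform_limit_cong'[of "cball x0 1" "\<lambda>N x. \<Prod>k<N. 1 - x * q ^ k"
      "\<lambda>N x. \<Prod>k<N. 1 - x * q ^ k" l "\<lambda>x. qpoch_inf x q"] by simp
  thus "\<exists>d>0. cball x0 d \<subseteq> UNIV \<and>
      uniform_limit (cball x0 d) (\<lambda>N x. \<Prod>k<N. 1 - x * q ^ k) (\<lambda>x. qpoch_inf x q) sequentially"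
    by (intro exI[of _ 1]) auto
qed auto

lemma qpoch_tendsto:
  assumes "norm q < 1" "(f \<longlongrightarrow> x) F"
  shows "((\<lambda>z. qpoch_inf (f z) q) \<longlongrightarrow> qpoch_inf x q) F"
proof -
  have "isCont (\<lambda>x. qpoch_inf x q) x"
    using holomorphic_on_imp_continuous_on[OF qpoch_holomorphic[OF assms(1)]]
    by (simp add: continuous_on_eq_continuous_at)
  thus ?thesis using assms(2) by (rule isCont_tendsto_compose)
qed

section \<open>Products split modulo 3 and over the cube roots of unity\<close>

lemma qpoch_trisect:
  assumes "norm q < 1"
  shows "qpoch_inf x q = qpoch_inf x (q^3) * qpoch_inf (x * q) (q^3) * qpoch_inf (x * q\<^sup>2) (q^3)"
proof (rule LIMSEQ_unique)
  have q3: "norm (q^3) < 1" using assms by (simp add: norm_power power_less_one_iff)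
  show "(\<lambda>N. \<Prod>k<3 * N. 1 - x * q ^ k) \<longlonglongrightarrow> qpoch_inf x q"
    by (rule LIMSEQ_subseq_LIMSEQ[OF qpoch_LIMSEQ[OF assms], unfolded o_def])
       (auto simp: strict_mono_def)
  have "(\<Prod>k<3 * N. 1 - x * q ^ k) =
      (\<Prod>k<N. 1 - x * (q^3) ^ k) * (\<Prod>k<N. 1 - x * q * (q^3) ^ k) * (\<Prod>k<N. 1 - x * q\<^sup>2 * (q^3) ^ k)" for N
  proof (induction N)
    case (Suc N)
    have *: "3 * Suc N = Suc (Suc (Suc (3 * N)))" by simp
    have e: "(q^3)^N = q ^ (3 * N)" by (simp add: power_mult)
    show ?case
      by (subst *, subst prod.lessThan_Suc, subst prod.lessThan_Suc, subst prod.lessThan_Suc, subst Suc.IH)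
         (simp add: e mult_ac power2_eq_square)
  qed simp
  thus "(\<lambda>N. \<Prod>k<3 * N. 1 - x * q ^ k) \<longlonglongrightarrow>
      qpoch_inf x (q^3) * qpoch_inf (x * q) (q^3) * qpoch_inf (x * q\<^sup>2) (q^3)"
    by (simp only:) (intro tendsto_intros qpoch_LIMSEQ q3)
qed

lemma cube_root_unity_mult:
  assumes "1 + w + w\<^sup>2 = (0::complex)"
  shows "w * w\<^sup>2 = 1"
proof -
  have "w * w\<^sup>2 - 1 = (w - 1) * (1 + w + w\<^sup>2)"
    by (simp add: algebra_simps power2_eq_square)
  thus ?thesis using assms by simp
qed

lemma qpoch_cube:
  assumes "norm q < 1" and w: "1 + w + w\<^sup>2 = 0"
  shows "qpoch_inf (x^3) (q^3) = qpoch_inf x q * qpoch_inf (w * x) q * qpoch_inf (w\<^sup>2 * x) q"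
proof (rule LIMSEQ_unique)
  have q3: "norm (q^3) < 1" using assms by (simp add: norm_power power_less_one_iff)
  show "(\<lambda>N. \<Prod>k<N. 1 - x^3 * (q^3) ^ k) \<longlonglongrightarrow> qpoch_inf (x^3) (q^3)"
    by (rule qpoch_LIMSEQ[OF q3])
  have w1: "w + w\<^sup>2 = -1" using w by (simp add: add_eq_0_iff add.assoc)
  have *: "1 - X^3 = (1 - X) * (1 - w * X) * (1 - w\<^sup>2 * X)" for X
  proof -
    have "(1 - X) * (1 - w * X) * (1 - w\<^sup>2 * X) = (1 - X) * (1 - (w + w\<^sup>2) * X + w * w\<^sup>2 * X\<^sup>2)"
      by (simp add: algebra_simps power2_eq_square)
    also have "\<dots> = 1 - X^3" unfolding w1 cube_root_unity_mult[OF w]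
      by (simp add: algebra_simps power2_eq_square power3_eq_cube)
    finally show ?thesis by simp
  qed
  have "1 - x^3 * (q^3) ^ k = (1 - x * q^k) * (1 - w * x * q^k) * (1 - w\<^sup>2 * x * q^k)" for k
    using *[of "x * q^k"] by (simp add: power_mult_distrib flip: power_mult) (simp add: mult_ac)
  hence "(\<Prod>k<N. 1 - x^3 * (q^3) ^ k) =
     (\<Prod>k<N. 1 - x * q ^ k) * (\<Prod>k<N. 1 - w * x * q ^ k) * (\<Prod>k<N. 1 - w\<^sup>2 * x * q ^ k)" for N
    by (simp add: prod.distrib)
  thus "(\<lambda>N. \<Prod>k<N. 1 - x^3 * (q^3) ^ k) \<longlonglongrightarrow>
      qpoch_inf x q * qpoch_inf (w * x) q * qpoch_inf (w\<^sup>2 * x) q"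
    by (simp only:) (intro tendsto_intros qpoch_LIMSEQ assms)
qed

lemma qpoch_self_nonzero:
  assumes "norm q < 1"
  shows "qpoch_inf q q \<noteq> 0"
proof
  assume "qpoch_inf q q = 0"
  then obtain k where "q ^ Suc k = 1" using qpoch_eq_0_iff[OF assms, of q] by auto
  hence "norm q ^ Suc k = 1" by (metis norm_one norm_power)
  moreover have "norm q ^ Suc k < 1"
    using power_decreasing[of 1 "Suc k" "norm q"] assms by simp
  ultimately show False by simp
qed

section \<open>Quasi-periodicity and zeros of the theta function\<close>

lemma jtheta_q_mult:
  assumes "0 < norm q" "norm q < 1" "x \<noteq> 0"
  shows "jtheta (q * x) q = - jtheta x q / x"
proof -
  have "qpoch_inf (1 / x) q = (1 - 1 / x) * qpoch_inf (q / x) q"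
    using qpoch_rec[OF assms(2), of "1/x"] by simp
  moreover have "qpoch_inf x q = (1 - x) * qpoch_inf (q * x) q"
    by (rule qpoch_rec[OF assms(2)])
  moreover have "q / (q * x) = 1 / x" using assms by auto
  ultimately have "jtheta (q * x) q = qpoch_inf (q * x) q * ((1 - 1 / x) * qpoch_inf (q / x) q) * qpoch_inf q q"
      "jtheta x q = (1 - x) * qpoch_inf (q * x) q * qpoch_inf (q / x) q * qpoch_inf q q"
    by (simp_all add: jtheta_def)
  moreover have "1 - 1 / x = - ((1 - x) / x)" using assms(3) by (simp add: field_simps)
  ultimately show ?thesis by (simp only:) simp
qed

lemma jtheta_flip: 
  assumes "q \<noteq> 0" shows "jtheta (q / x) q = jtheta x q"
  \<comment> \<open>For x = 0 the default q / 0 = 0 makes the two sides identical.\<close>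
  using assms by (cases "x = 0") (auto simp: jtheta_def)

lemma jtheta_inverse:
  assumes "0 < norm q" "norm q < 1" "x \<noteq> 0"
  shows "jtheta (1 / x) q = - jtheta x q / x"
proof -
  have "jtheta (1 / x) q = jtheta (q * x) q"
    using jtheta_flip[of q "q * x"] assms by auto
  thus ?thesis using jtheta_q_mult[OF assms] by simp
qed

lemma jtheta_q_powi_mult:
  assumes "0 < norm q" "norm q < 1" "x \<noteq> 0"
  shows "jtheta (q powi k * x) q = (-1) powi k * q powi (- binom2 k) * x powi (-k) * jtheta x q"
proof -
  have q0: "q \<noteq> 0" using assms by auto
  have b: "binom2 (k + 1) = binom2 k + k" for k :: int
    unfolding binom2_def by (simp add: algebra_simps)
  have step: "jtheta (q powi (k + 1) * x) q = - jtheta (q powi k * x) q / (q powi k * x)" for k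
    using jtheta_q_mult[OF assms(1,2), of "q powi k * x"] q0 assms(3)
    by (simp add: power_int_add mult_ac)
  have e: "(-1 :: complex) powi (i + 1) = - ((-1) powi i)"
      "q powi (- (binom2 i + i)) = q powi (- binom2 i) / q powi i"
      "x powi (- (i + 1)) = x powi (- i) / x" for i
  proof -
    have "- (binom2 i + i) = - binom2 i - i" "- (i + 1) = - i - 1" by simp_all
    thus "q powi (- (binom2 i + i)) = q powi (- binom2 i) / q powi i"
      "x powi (- (i + 1)) = x powi (- i) / x"
      using q0 assms(3) by (simp_all only: power_int_diff power_int_1_right simp_thms)
  qed (simp add: power_int_add)
  show ?thesis
  proof (induction k rule: int_induct[where k = 0])
    case base thus ?case by (simp add: binom2_def)
  next
    case (step1 i)
    show ?case unfolding step step1.IH b e by simp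
  next
    case (step2 i)
    have bb: "binom2 i = binom2 (i - 1) + (i - 1)" using b[of "i - 1"] by simp
    note e' = e[of "i - 1", unfolded diff_add_cancel]
    have "jtheta (q powi (i - 1) * x) q = - jtheta (q powi i * x) q * (q powi (i - 1) * x)"
      using step[of "i - 1"] q0 assms(3) by (simp add: field_simps)
    also have "\<dots> = (- 1) powi (i - 1) * q powi - binom2 (i - 1) * x powi - (i - 1) * jtheta x q"
      unfolding step2.IH bb e' using q0 assms(3) by simp
    finally show ?case .
  qed
qed

lemma jtheta_eq_0_iff:
  assumes "0 < norm q" "norm q < 1" "x \<noteq> 0"
  shows "jtheta x q = 0 \<longleftrightarrow> (\<exists>k::int. x = q powi k)"
proof
  have q0: "q \<noteq> 0" using assms by auto
  assume "jtheta x q = 0"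
  hence "qpoch_inf x q = 0 \<or> qpoch_inf (q / x) q = 0"
    using qpoch_self_nonzero[OF assms(2)] by (auto simp: jtheta_def)
  then obtain k where "x * q ^ k = 1 \<or> q / x * q ^ k = 1"
    using qpoch_eq_0_iff[OF assms(2)] by blast
  hence "x = q powi (- int k) \<or> x = q powi (int (Suc k))"
    using q0 assms(3) unfolding power_int_minus power_int_of_nat by (auto simp: field_simps)
  thus "\<exists>k::int. x = q powi k" by blast
next
  assume "\<exists>k::int. x = q powi k"
  then obtain k :: int where k: "x = q powi k" by blast
  have "jtheta 1 q = 0" using qpoch_rec[OF assms(2), of 1] by (simp add: jtheta_def)
  thus "jtheta x q = 0" using jtheta_q_powi_mult[OF assms(1,2), of 1 k] k by simp
qed

lemma jtheta_one [simp]: "norm q < 1 \<Longrightarrow> jtheta 1 q = 0"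
  using qpoch_rec[of q 1] by (simp add: jtheta_def)

lemma jtheta_holomorphic:
  assumes "norm q < 1" "f holomorphic_on A" "\<And>z. z \<in> A \<Longrightarrow> f z \<noteq> 0"
  shows "(\<lambda>z. jtheta (f z) q) holomorphic_on A"
proof -
  have c: "(\<lambda>z. qpoch_inf (g z) q) holomorphic_on A" if "g holomorphic_on A" for g
    using holomorphic_on_compose[OF that holomorphic_on_subset[OF qpoch_holomorphic[OF assms(1)]]]
    by (simp add: o_def)
  show ?thesis unfolding jtheta_def
    by (intro holomorphic_intros c assms)
qed

lemma jtheta_tendsto:
  assumes "norm q < 1" "x \<noteq> 0" "(f \<longlongrightarrow> x) F"
  shows "((\<lambda>z. jtheta (f z) q) \<longlongrightarrow> jtheta x q) F"
  unfolding jtheta_def by (intro tendsto_intros qpoch_tendsto assms)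

text \<open>The factor \<open>1 - f z\<close> is the only one of the product that vanishes at 1, and
  what remains tends to the cube of (q;q)_inf. Up to sign this is the derivative of the theta
  function at its zero; it normalises the residue of the theta correction.\<close>

lemma jtheta_over_one_minus_tendsto:
  assumes "norm q < 1" "(f \<longlongrightarrow> 1) F" "eventually (\<lambda>z. f z \<noteq> 1) F"
  shows "((\<lambda>z. jtheta (f z) q / (1 - f z)) \<longlongrightarrow> qpoch_inf q q ^ 3) F"
proof (rule Lim_transform_eventually)
  show "((\<lambda>z. qpoch_inf (q * f z) q * qpoch_inf (q / f z) q * qpoch_inf q q)
     \<longlongrightarrow> qpoch_inf q q ^ 3) F"
    by (rule tendsto_eq_intros qpoch_tendsto assms refl)+ (auto simp: power3_eq_cube)
  show "\<forall>\<^sub>F z in F. qpoch_inf (q * f z) q * qpoch_inf (q / f z) q * qpoch_inf q q =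
      jtheta (f z) q / (1 - f z)"
    using assms(3)
  proof eventually_elim
    case (elim z)
    thus ?case unfolding jtheta_def by (subst qpoch_rec[OF assms(1), of "f z"]) auto
  qed
qed

text \<open>Every zero is a power of q, and \<open>jtheta_q_powi_mult\<close> carries it to the zero
  at 1. Only the existence of the limit is recorded, because it will be multiplied by a function
  tending to 0.\<close>

lemma jtheta_simple_zero:
  assumes q: "0 < norm q" "norm q < 1" and "x0 \<noteq> 0" "jtheta x0 q = 0"
  shows "\<exists>l. ((\<lambda>x. (x - x0) / jtheta x q) \<longlongrightarrow> l) (at x0)"
proof -
  obtain k :: int where k: "x0 = q powi k" using assms jtheta_eq_0_iff by blast
  have q0: "q \<noteq> 0" using q by auto
  define C where "C = (\<lambda>x. (-1) powi k * q powi (- binom2 k) * (x / x0) powi (-k))"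
  have J: "jtheta x q = C x * jtheta (x / x0) q" if "x \<noteq> 0" for x
    using jtheta_q_powi_mult[OF q, of "x / x0" k] that assms(3) k by (simp add: C_def)
  have l1: "((\<lambda>x. x / x0) \<longlongrightarrow> 1) (at x0)"
    using assms(3) by (auto intro!: tendsto_eq_intros)
  have ne: "\<forall>\<^sub>F x in at x0. x / x0 \<noteq> 1"
    using assms(3) by (auto simp: eventually_at_filter)
  have C: "(C \<longlongrightarrow> C x0) (at x0)"
    unfolding C_def using assms(3) by (intro tendsto_intros) auto
  have "((\<lambda>x. - x0 / (C x * (jtheta (x / x0) q / (1 - x / x0)))) \<longlongrightarrow> - x0 / (C x0 * qpoch_inf q q ^ 3)) (at x0)"
    by (intro tendsto_intros C jtheta_over_one_minus_tendsto q l1 ne)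
       (use qpoch_self_nonzero[OF q(2)] q0 assms(3) in \<open>auto simp: C_def\<close>)
  moreover have "\<forall>\<^sub>F x in at x0. - x0 / (C x * (jtheta (x / x0) q / (1 - x / x0))) = (x - x0) / jtheta x q"
  proof -
    have "\<forall>\<^sub>F x in at x0. x \<noteq> 0" using assms(3)
      by (intro tendsto_imp_eventually_ne[OF tendsto_ident_at])
    thus ?thesis using ne
    proof eventually_elim
      case (elim x)
      have "x0 * (1 - x / x0) = x0 - x" using assms(3) by (simp add: field_simps)
      hence "- x0 / (C x * (jtheta (x / x0) q / (1 - x / x0))) = - (x0 - x) / (C x * jtheta (x / x0) q)"
        by (metis divide_divide_eq_right minus_mult_left times_divide_eq_right)
      thus ?case unfolding J[OF elim(1)] by simp
    qed
  qed
  ultimately have "((\<lambda>x. (x - x0) / jtheta x q) \<longlongrightarrow> - x0 / (C x0 * qpoch_inf q q ^ 3)) (at x0)"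
    by (rule Lim_transform_eventually)
  thus ?thesis ..
qed

text \<open>The three products of the theta function run through the exponents m, 2m and 3m modulo
  3m, hence together through all positive multiples of m.\<close>

lemma Jtheta_eq_qpoch:
  assumes "0 < norm q" "norm q < 1" "m > 0"
  shows "Jtheta m q = qpoch_inf (q ^ m) (q ^ m)"
proof -
  have "norm (q ^ m) < 1" using assms by (simp add: norm_power power_less_one_iff)
  moreover have "q ^ (3 * m) / q ^ m = q ^ m * q ^ m" "q ^ (3 * m) = (q ^ m) ^ 3"
      "q ^ m * (q ^ m)\<^sup>2 = (q ^ m) ^ 3"
    using assms by (simp_all add: nonzero_divide_eq_eq power3_eq_cube power2_eq_square power_mult power_commutes mult.commute[of 3])
  ultimately show ?thesis
    using qpoch_trisect[of "q ^ m" "q ^ m"] unfolding Jtheta_def jtheta_def by simp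
qed

text \<open>The pieces of q/x pair with those of x in crossed order, since q^3/(x q) = (q/x) q and
  q^3/(x q^2) = q/x. The extra factors balance the constants of three theta functions against those
  of one.\<close>

lemma jtheta_trisect:
  assumes "0 < norm q" "norm q < 1"
  shows "jtheta x q * qpoch_inf (q^3) (q^3) ^ 3 =
    qpoch_inf q q * jtheta x (q^3) * jtheta (x * q) (q^3) * jtheta (x * q\<^sup>2) (q^3)"
proof -
  have q0: "q \<noteq> 0" using assms by auto
  have "q^3 / (x * q) = q / x * q" "q^3 / (x * q\<^sup>2) = q / x" "q^3 / x = q / x * q\<^sup>2"
    using q0 by (auto simp: field_simps power3_eq_cube power2_eq_square)
  thus ?thesis
    unfolding jtheta_def qpoch_trisect[OF assms(2), of x] qpoch_trisect[OF assms(2), of "q / x"]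
    by (simp only: power3_eq_cube[of "qpoch_inf (q^3) (q^3)"] mult_ac)
qed

text \<open>Inverting a primitive cube root of unity squares it, so passing from x to q/x merely
  exchanges the factors at w and w^2.\<close>

lemma jtheta_cube:
  assumes "0 < norm q" "norm q < 1" and w: "1 + w + w\<^sup>2 = 0"
  shows "jtheta (x^3) (q^3) * qpoch_inf q q ^ 3 =
     jtheta x q * jtheta (w * x) q * jtheta (w\<^sup>2 * x) q * qpoch_inf (q^3) (q^3)"
proof -
  note w3 = cube_root_unity_mult[OF w]
  have "inverse w = w\<^sup>2" "inverse (w\<^sup>2) = w"
    using w3 by (auto intro!: inverse_unique simp: mult_ac)
  hence e: "q / (w * x) = w\<^sup>2 * (q / x)" "q / (w\<^sup>2 * x) = w * (q / x)"
    by (simp_all add: divide_inverse mult_ac)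
  have e3: "q^3 / x^3 = (q / x)^3" by (simp add: power_divide)
  show ?thesis unfolding jtheta_def e e3 qpoch_cube[OF assms(2) w]
    by (simp add: power3_eq_cube)
qed

text \<open>Splitting off the factor 1 - w leaves the products at q, w q and w^2 q, which together
  form the product at q^3.\<close>

lemma jtheta_cube_root_unity:
  assumes "0 < norm q" "norm q < 1" and w: "1 + w + w\<^sup>2 = 0"
  shows "jtheta w q = (1 - w) * qpoch_inf (q^3) (q^3)"
proof -
  note w3 = cube_root_unity_mult[OF w]
  from w3 have e: "q / w = w\<^sup>2 * q" by (cases "w = 0") (auto simp: divide_eq_eq mult_ac)
  show ?thesis unfolding jtheta_def e qpoch_rec[OF assms(2), of w] qpoch_cube[OF assms(2) w, of q]
    by (simp add: mult_ac)
qed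

section \<open>Bilateral series\<close>

text \<open>Tannery's theorem for an arbitrary index set and filter: domination makes the finite
  partial sums converge uniformly in x, so the two limits may be exchanged.\<close>

lemma tendsto_infsum_dominated:
  fixes f :: "'i \<Rightarrow> 'a \<Rightarrow> 'b :: banach"
  assumes lim: "\<And>i. i \<in> A \<Longrightarrow> (f i \<longlongrightarrow> g i) F"
    and bound: "\<forall>\<^sub>F x in F. \<forall>i\<in>A. norm (f i x) \<le> M i"
    and "M summable_on A" and "F \<noteq> bot"
  shows "((\<lambda>x. \<Sum>\<^sub>\<infinity>i\<in>A. f i x) \<longlongrightarrow> (\<Sum>\<^sub>\<infinity>i\<in>A. g i)) F"
proof (rule swap_uniform_limit')
  show "\<forall>\<^sub>F X in finite_subsets_at_top A. ((\<lambda>x. \<Sum>i\<in>X. f i x) \<longlongrightarrow> (\<Sum>i\<in>X. g i)) F"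
    using eventually_finite_subsets_at_top_weakI[of A "\<lambda>X. X \<subseteq> A"]
    by (rule eventually_mono) (auto intro!: tendsto_sum lim)
  have g: "norm (g i) \<le> M i" if "i \<in> A" for i
    using tendsto_upperbound[OF tendsto_norm[OF lim[OF that]] eventually_mono[OF bound] assms(4)] that
    by blast
  have "g summable_on A"
    using abs_summable_summable[OF Infinite_Sum.abs_summable_on_comparison_test'[OF assms(3) g]] .
  thus "((\<lambda>X. \<Sum>i\<in>X. g i) \<longlongrightarrow> (\<Sum>\<^sub>\<infinity>i\<in>A. g i)) (finite_subsets_at_top A)"
    using has_sum_infsum has_sum_def by blast
  show "uniform_limit {x. \<forall>i\<in>A. norm (f i x) \<le> M i} (\<lambda>X x. \<Sum>i\<in>X. f i x)
     (\<lambda>x. \<Sum>\<^sub>\<infinity>i\<in>A. f i x) (finite_subsets_at_top A)"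
    by (rule Weierstrass_m_test_general[OF _ assms(3)]) auto
qed (use bound in auto)

text \<open>A summable majorant on a ball makes the net of finite partial sums converge uniformly on
  a smaller closed ball. Holomorphy being local, the majorant may vary from point to point.\<close>

lemma holomorphic_on_infsum:
  fixes f :: "'i \<Rightarrow> complex \<Rightarrow> complex"
  assumes S: "open S" and hol: "\<And>i. i \<in> A \<Longrightarrow> f i holomorphic_on S"
    and bound: "\<And>x. x \<in> S \<Longrightarrow> \<exists>d>0. \<exists>M. M summable_on A \<and> (\<forall>y\<in>ball x d. \<forall>i\<in>A. norm (f i y) \<le> M i)"
  shows "(\<lambda>x. \<Sum>\<^sub>\<infinity>i\<in>A. f i x) holomorphic_on S"
proof -
  let ?g = "\<lambda>x. \<Sum>\<^sub>\<infinity>i\<in>A. f i x"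
  have "?g field_differentiable (at x)" if x: "x \<in> S" for x
  proof -
    obtain d M where d: "d > 0" "M summable_on A" "\<And>y i. y \<in> ball x d \<Longrightarrow> i \<in> A \<Longrightarrow> norm (f i y) \<le> M i"
      using bound[OF x] by blast
    obtain e where e: "e > 0" "ball x e \<subseteq> S" using S x openE by blast
    define r where "r = min d e / 2"
    have r: "r > 0" "cball x r \<subseteq> ball x d" "cball x r \<subseteq> S"
      using d(1) e by (auto simp: r_def subset_iff)
    have hr: "f i holomorphic_on cball x r" if "i \<in> A" for i
      using hol[OF that] r(3) holomorphic_on_subset by blast
    have "uniform_limit (cball x r) (\<lambda>X y. \<Sum>i\<in>X. f i y) ?g (finite_subsets_at_top A)"
      by (rule Weierstrass_m_test_general[OF _ d(2)]) (use d(3) r(2) in auto)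
    moreover have "\<forall>\<^sub>F X in finite_subsets_at_top A. continuous_on (cball x r) (\<lambda>y. \<Sum>i\<in>X. f i y) \<and>
        (\<lambda>y. \<Sum>i\<in>X. f i y) holomorphic_on ball x r"
      using eventually_finite_subsets_at_top_weakI[of A "\<lambda>X. X \<subseteq> A"]
    proof (rule eventually_mono)
      fix X assume "X \<subseteq> A"
      hence "(\<lambda>y. \<Sum>i\<in>X. f i y) holomorphic_on cball x r"
        by (intro holomorphic_on_sum hr) auto
      thus "continuous_on (cball x r) (\<lambda>y. \<Sum>i\<in>X. f i y) \<and> (\<lambda>y. \<Sum>i\<in>X. f i y) holomorphic_on ball x r"
        using holomorphic_on_imp_continuous_on holomorphic_on_subset ball_subset_cball by blast
    qed auto
    ultimately have "?g holomorphic_on ball x r"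
      by (rule_tac holomorphic_uniform_limit[where F = "finite_subsets_at_top A"]) auto
    thus ?thesis using r(1) holomorphic_on_imp_differentiable_at by (metis centre_in_ball open_ball)
  qed
  thus ?thesis using S by (simp add: holomorphic_on_def field_differentiable_at_within)
qed

section \<open>Triangular exponents and convergence of theta series\<close>

lemma binom2_int: "binom2 (int n) = int (n choose 2)"
  by (cases n) (simp_all add: binom2_def choose_two of_nat_div algebra_simps)

lemma binom2_add: "binom2 (r + s) = binom2 r + binom2 s + r * s"
proof -
  have e: "2 * binom2 r = r * (r - 1)" for r
    unfolding binom2_def by (simp add: even_mult_iff)
  have "2 * binom2 (r + s) = 2 * (binom2 r + binom2 s + r * s)"
    unfolding distrib_left[of 2] e by (simp add: algebra_simps)
  thus ?thesis by simp
qed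

lemma binom2_uminus: "binom2 (- r) = binom2 r + r"
proof -
  have e: "2 * binom2 r = r * (r - 1)" for r
    unfolding binom2_def by (simp add: even_mult_iff)
  have "2 * binom2 (- r) = 2 * (binom2 r + r)"
    unfolding distrib_left[of 2] e by (simp add: algebra_simps)
  thus ?thesis by simp
qed

lemma binom2_1 [simp]: "binom2 1 = 0" and binom2_0 [simp]: "binom2 0 = 0"
  by (simp_all add: binom2_def)

text \<open>Consecutive terms have ratio A \<rho>^n, which tends to 0 whatever the size of
  A.\<close>

lemma theta_nat_summable:
  fixes A \<rho> :: real
  assumes "A > 0" "0 < \<rho>" "\<rho> < 1"
  shows "summable (\<lambda>n::nat. A ^ n * \<rho> powi binom2 (int n))"
proof -
  have "(\<lambda>n. A * \<rho> ^ n) \<longlonglongrightarrow> A * 0"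
    using assms by (intro tendsto_intros LIMSEQ_realpow_zero) auto
  hence "\<forall>\<^sub>F n in sequentially. A * \<rho> ^ n < 1/2"
    by (auto dest: order_tendstoD(2)[of _ _ _ "1/2"])
  then obtain N where N: "\<And>n. n \<ge> N \<Longrightarrow> A * \<rho> ^ n < 1/2"
    by (auto simp: eventually_at_top_linorder)
  show ?thesis
  proof (rule summable_ratio_test[of "1/2" N])
    fix n assume "n \<ge> N"
    have "binom2 (int (Suc n)) = binom2 (int n) + int n"
      using binom2_add[of 1 "int n"] by simp
    hence "A ^ Suc n * \<rho> powi binom2 (int (Suc n)) = A * \<rho> ^ n * (A ^ n * \<rho> powi binom2 (int n))"
      using assms by (simp add: power_int_add)
    moreover have "A * \<rho> ^ n * (A ^ n * \<rho> powi binom2 (int n)) \<le> 1/2 * (A ^ n * \<rho> powi binom2 (int n))"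
      using N[OF \<open>n \<ge> N\<close>] assms by (intro mult_right_mono) auto
    moreover have "A ^ n * \<rho> powi binom2 (int n) \<ge> 0" for n using assms by simp
    ultimately show "norm (A ^ Suc n * \<rho> powi binom2 (int (Suc n))) \<le> 1/2 * norm (A ^ n * \<rho> powi binom2 (int n))"
      by (metis abs_of_nonneg real_norm_def)
  qed auto
qed

lemma theta_real_summable:
  fixes A \<rho> :: real
  assumes "A > 0" "0 < \<rho>" "\<rho> < 1"
  shows "(\<lambda>r::int. A powi r * \<rho> powi binom2 r) summable_on UNIV"
proof -
  let ?f = "\<lambda>r::int. A powi r * \<rho> powi binom2 r"
  have nn: "?f r \<ge> 0" for r using assms by simp
  have "?f summable_on range int"
    unfolding summable_on_reindex[OF inj_of_nat] o_def
    using theta_nat_summable[OF assms] nn[of "int _"] by (subst summable_on_UNIV_nonneg_real_iff) auto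
  moreover have "?f summable_on range (\<lambda>n. - int n)"
  proof -
    have i: "inj (\<lambda>n. - int n)" by (auto simp: inj_def)
    have "?f (- int n) = (\<rho> / A) ^ n * \<rho> powi binom2 (int n)" for n
      using assms by (simp add: binom2_uminus power_int_add power_int_minus power_divide field_simps)
    moreover have "summable (\<lambda>n. (\<rho> / A) ^ n * \<rho> powi binom2 (int n))"
      using assms by (intro theta_nat_summable) auto
    ultimately show ?thesis
      unfolding summable_on_reindex[OF i] o_def
      using assms by (subst summable_on_UNIV_nonneg_real_iff) auto
  qed
  ultimately have "?f summable_on (range int \<union> range (\<lambda>n. - int n))"
    by (rule summable_on_union)
  moreover have "range int \<union> range (\<lambda>n. - int n) = UNIV"
    by (auto simp: image_iff) (metis int_cases2)
  ultimately show ?thesis by simp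
qed

text \<open>The weight A^|r| dominates t^r for every t between 1/A and A, so this series is a
  majorant for theta series on a whole annulus.\<close>

lemma theta_real_abs_summable:
  fixes A \<rho> :: real
  assumes "A > 0" "0 < \<rho>" "\<rho> < 1"
  shows "(\<lambda>r::int. A powi \<bar>r\<bar> * \<rho> powi binom2 r) summable_on UNIV"
proof (rule summable_on_comparison_test)
  show "(\<lambda>r::int. A powi r * \<rho> powi binom2 r + (1 / A) powi r * \<rho> powi binom2 r) summable_on UNIV"
    using assms by (intro summable_on_add theta_real_summable) auto
  show "A powi \<bar>r\<bar> * \<rho> powi binom2 r \<le> A powi r * \<rho> powi binom2 r + (1 / A) powi r * \<rho> powi binom2 r" for r
    using assms by (auto simp: abs_if power_int_minus_divide power_int_divide_distrib)
qed (use assms in auto)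

section \<open>The Jacobi triple product\<close>

definition theta_term :: "complex \<Rightarrow> complex \<Rightarrow> int \<Rightarrow> complex" where
  "theta_term q x r = (-1) powi r * q powi binom2 r * x powi r"

lemma norm_power_int: "norm (x powi r) = norm x powi r" for x :: complex
  by (simp add: power_int_def norm_power norm_inverse)

lemma norm_theta_term: "norm (theta_term q x r) = norm x powi r * norm q powi binom2 r"
  by (simp add: theta_term_def norm_mult norm_power_int)

lemma theta_term_abs_summable:
  assumes "0 < norm q" "norm q < 1" "x \<noteq> 0"
  shows "(\<lambda>r. norm (theta_term q x r)) summable_on UNIV"
  unfolding norm_theta_term using assms by (intro theta_real_summable) auto

text \<open>The Gaussian binomial coefficient, given by a q-Pascal rule so that no division by 1 -
  q^k occurs. The truncated exponent \<open>M - j\<close> is harmless: for \<open>j > M\<close> the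
  coefficient beside it is 0.\<close>

fun qbinom :: "complex \<Rightarrow> nat \<Rightarrow> nat \<Rightarrow> complex" where
  "qbinom q M 0 = 1"
| "qbinom q 0 (Suc j) = 0"
| "qbinom q (Suc M) (Suc j) = qbinom q M (Suc j) + q ^ (M - j) * qbinom q M j"

lemma qbinom_eq_0: "M < j \<Longrightarrow> qbinom q M j = 0"
  by (induction q M j rule: qbinom.induct) auto

text \<open>Rothe's q-binomial theorem: the q-Pascal rule is exactly multiplication by the last
  factor 1 - x q^M.\<close>

lemma qbinom_theorem:
  "(\<Prod>k<M. 1 - x * q ^ k) = (\<Sum>j\<le>M. (-1) ^ j * q ^ (j choose 2) * qbinom q M j * x ^ j)"
proof (induction M)
  case (Suc M)
  let ?a = "\<lambda>j. (-1) ^ j * q ^ (j choose 2) * x ^ j :: complex"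
  have "(\<Sum>j\<le>Suc M. ?a j * qbinom q (Suc M) j) = 1 + (\<Sum>j\<le>M. ?a (Suc j) * qbinom q (Suc M) (Suc j))"
    by (subst sum.atMost_Suc_shift) (simp add: binomial_eq_0)
  also have "(\<Sum>j\<le>M. ?a (Suc j) * qbinom q (Suc M) (Suc j)) =
      (\<Sum>j\<le>M. ?a (Suc j) * qbinom q M (Suc j)) - (\<Sum>j\<le>M. x * q ^ M * (?a j * qbinom q M j))"
    unfolding sum_subtractf[symmetric]
  proof (rule sum.cong)
    fix j assume "j \<in> {..M}"
    hence "q ^ M = q ^ j * q ^ (M - j)" by (simp flip: power_add)
    moreover have "Suc j choose 2 = j + (j choose 2)" by (simp add: numeral_2_eq_2)
    ultimately show "?a (Suc j) * qbinom q (Suc M) (Suc j) =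
        ?a (Suc j) * qbinom q M (Suc j) - x * q ^ M * (?a j * qbinom q M j)"
      by (simp add: power_add algebra_simps)
  qed simp
  also have "1 + ((\<Sum>j\<le>M. ?a (Suc j) * qbinom q M (Suc j)) - (\<Sum>j\<le>M. x * q ^ M * (?a j * qbinom q M j)))
     = (\<Sum>j\<le>Suc M. ?a j * qbinom q M j) - x * q ^ M * (\<Sum>j\<le>M. ?a j * qbinom q M j)"
    by (subst sum.atMost_Suc_shift[of "\<lambda>j. ?a j * qbinom q M j"]) (simp add: sum_distrib_left binomial_eq_0)
  also have "(\<Sum>j\<le>Suc M. ?a j * qbinom q M j) = (\<Sum>j\<le>M. ?a j * qbinom q M j)"
    by (simp add: qbinom_eq_0)
  finally show ?case using Suc.IH by (simp add: algebra_simps)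
qed (simp add: numeral_2_eq_2)

text \<open>The quotient formula, multiplied out. The induction rests on (1 - q^(M-j)) + q^(M-j) (1
  - q^(j+1)) = 1 - q^(M+1); the formula is what gives access to the limit of the
  coefficients.\<close>

lemma qbinom_fact:
  "j \<le> M \<Longrightarrow> qbinom q M j * (\<Prod>k<j. 1 - q * q ^ k) * (\<Prod>k<M - j. 1 - q * q ^ k) = (\<Prod>k<M. 1 - q * q ^ k)"
proof (induction q M j rule: qbinom.induct)
  case (3 q M j)
  let ?p = "\<lambda>j. \<Prod>k<j. 1 - q * q ^ k :: complex"
  have "j \<le> M" using 3 by simp
  have 2: "q ^ (M - j) * qbinom q M j * ?p (Suc j) * ?p (M - j) = q ^ (M - j) * (1 - q ^ Suc j) * ?p M"
    using "3.IH"(2)[OF \<open>j \<le> M\<close>, symmetric] by simp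
  have 1: "qbinom q M (Suc j) * ?p (Suc j) * ?p (M - j) = (1 - q ^ (M - j)) * ?p M"
  proof (cases "Suc j \<le> M")
    case True
    hence "M - j = Suc (M - Suc j)" by simp
    thus ?thesis using "3.IH"(1)[OF True, symmetric] by simp
  qed (use \<open>j \<le> M\<close> in \<open>simp add: qbinom_eq_0\<close>)
  have "q ^ (M - j) * q ^ Suc j = q ^ Suc M" using \<open>j \<le> M\<close> by (simp only: power_add[symmetric]) simp
  hence e: "(1 - q ^ (M - j)) + q ^ (M - j) * (1 - q ^ Suc j) = 1 - q ^ Suc M"
    by (simp only: right_diff_distrib mult_1_right) simp
  have "qbinom q (Suc M) (Suc j) * ?p (Suc j) * ?p (Suc M - Suc j) =
     (1 - q ^ (M - j)) * ?p M + q ^ (M - j) * (1 - q ^ Suc j) * ?p M"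
    unfolding 1[symmetric] 2[symmetric] by (simp add: algebra_simps)
  also have "\<dots> = (1 - q ^ Suc M) * ?p M" unfolding e[symmetric] by (simp add: algebra_simps)
  finally show ?case by simp
qed auto

text \<open>The q-binomial theorem with 2N factors is evaluated at x q^(-N): the upper N factors
  give the product in x, the lower N, after monomials are extracted, the product in q/x.\<close>

lemma finite_jacobi_triple_product:
  assumes "q \<noteq> 0" "x \<noteq> 0"
  shows "(\<Prod>k<N. 1 - x * q ^ k) * (\<Prod>k<N. 1 - q / x * q ^ k) =
    (\<Sum>r\<in>{-int N..int N}. theta_term q x r * qbinom q (2 * N) (nat (r + int N)))"
proof -
  \<comment> \<open>\<open>C N\<close> is the product of the monomials -x q^(-m) for m = 1, ..., N,
    extracted when the lower half of the factors is reflected.\<close>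
  define C where "C = (\<lambda>N. (-1) ^ N * q powi (- binom2 (int N + 1)) * x ^ N)"
  define z where "z = (\<lambda>N. x * q powi (- int N))"
  have C0: "C N \<noteq> 0" for N using assms by (simp add: C_def)
  have C_Suc: "C (Suc N) = C N * (- z (Suc N))" for N
  proof -
    have "- binom2 (int (Suc N) + 1) = - binom2 (int N + 1) + (- int (Suc N))"
      using binom2_add[of "int N + 1" 1] by (simp add: add_ac)
    hence "q powi (- binom2 (int (Suc N) + 1)) = q powi (- binom2 (int N + 1)) * q powi (- int (Suc N))"
      using assms(1) by (simp only: power_int_add simp_thms)
    thus ?thesis by (simp add: C_def z_def)
  qed
  have z_Suc: "z (Suc N) * q = z N" for N
    using assms power_int_add[of q "- int (Suc N)" 1] by (simp add: z_def)
  have zN: "z N * q ^ N = x" for N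
    using assms by (simp add: z_def power_int_minus)
  have zx: "z N * (q / x * q ^ k) = q ^ Suc k / q ^ N" for k N
    using assms by (simp add: z_def power_int_minus field_simps)
  have reflect: "(\<Prod>k<N. 1 - z N * q ^ k) = C N * (\<Prod>k<N. 1 - q / x * q ^ k)" for N
  proof (induction N)
    case 0 show ?case by (simp add: C_def)
  next
    case (Suc N)
    have "(\<Prod>k<Suc N. 1 - z (Suc N) * q ^ k) = (1 - z (Suc N)) * (\<Prod>k<N. 1 - z N * q ^ k)"
      unfolding prod.lessThan_Suc_shift z_Suc[symmetric, of N] by (simp add: mult_ac)
    also have "1 - z (Suc N) = - z (Suc N) * (1 - q / x * q ^ N)"
      using zx[of "Suc N" N] assms by (simp add: right_diff_distrib)
    finally show ?case unfolding Suc.IH C_Suc by simp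
  qed
  have split: "(\<Prod>k<N + M. f k) = (\<Prod>k<N. f k) * (\<Prod>k<M. f (N + k) :: complex)" for M f
    by (induction M) auto
  have "(\<Prod>k<2 * N. 1 - z N * q ^ k) = (\<Prod>k<N. 1 - z N * q ^ k) * (\<Prod>k<N. 1 - z N * q ^ (N + k))"
    unfolding mult_2 by (rule split)
  also have "(\<Prod>k<N. 1 - z N * q ^ (N + k)) = (\<Prod>k<N. 1 - x * q ^ k)"
    unfolding power_add mult.assoc[symmetric] zN ..
  finally have "C N * ((\<Prod>k<N. 1 - x * q ^ k) * (\<Prod>k<N. 1 - q / x * q ^ k)) =
      (\<Sum>j\<le>2 * N. (-1) ^ j * q ^ (j choose 2) * qbinom q (2 * N) j * z N ^ j)"
    unfolding reflect qbinom_theorem by (simp add: mult_ac)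
  also have "\<dots> = (\<Sum>r\<in>{-int N..int N}. C N * (theta_term q x r * qbinom q (2 * N) (nat (r + int N))))"
  proof (rule sum.reindex_bij_witness[of _ "\<lambda>r. nat (r + int N)" "\<lambda>j. int j - int N"])
    fix j assume "j \<in> {..2 * N}"
    have "binom2 (int j - int N) - binom2 (int N + 1) = int (j choose 2) - int N * int j"
      using binom2_add[of "int j" "- int N"] binom2_uminus[of "int N"] binom2_add[of "int N" 1]
      unfolding binom2_int[symmetric] by (simp add: algebra_simps)
    hence *: "binom2 (int j - int N) + - binom2 (int N + 1) = int (j choose 2) + - int N * int j"
      by simp
    have "q powi binom2 (int j - int N) * q powi (- binom2 (int N + 1)) = q powi (int (j choose 2)) * q powi (- int N * int j)"
      using arg_cong[OF *, of "\<lambda>k. q powi k"] assms(1) by (simp only: power_int_add simp_thms)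
    hence e: "q powi binom2 (int j - int N) * q powi (- binom2 (int N + 1)) = q ^ (j choose 2) * (q powi (- int N)) ^ j"
      by (simp only: power_int_power' power_int_of_nat)
    have "C N * theta_term q x (int j - int N) = 
       ((-1) ^ N * (-1) powi (int j - int N)) * (q powi binom2 (int j - int N) * q powi (- binom2 (int N + 1))) * (x ^ N * x powi (int j - int N))"
      by (simp add: C_def theta_term_def)
    also have "\<dots> = (-1) ^ j * (q ^ (j choose 2) * (q powi (- int N)) ^ j) * x ^ j"
      unfolding e using assms by (simp add: power_int_diff)
    also have "\<dots> = (-1) ^ j * q ^ (j choose 2) * z N ^ j"
      by (simp add: z_def power_mult_distrib)
    finally show "C N * (theta_term q x (int j - int N) * qbinom q (2 * N) (nat (int j - int N + int N))) =
        (-1) ^ j * q ^ (j choose 2) * qbinom q (2 * N) j * z N ^ j"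
      by simp
  qed auto
  finally show ?thesis using C0[of N] by (simp flip: sum_distrib_left)
qed

text \<open>In the finite identity the coefficient of index r is P(2N) / (P(N+r) P(N-r)). It tends
  to 1/L and is bounded uniformly in r and N, because P and 1/P converge; Tannery's theorem does the
  rest.\<close>

theorem jacobi_triple_product:
  assumes q: "0 < norm q" "norm q < 1" and x: "x \<noteq> 0"
  shows "(theta_term q x has_sum jtheta x q) UNIV"
proof -
  have q0: "q \<noteq> 0" using q by auto
  define P where "P = (\<lambda>N. \<Prod>k<N. 1 - q * q ^ k)"
  define L where "L = qpoch_inf q q"
  have L0: "L \<noteq> 0" unfolding L_def by (rule qpoch_self_nonzero[OF q(2)])
  have P: "P \<longlonglongrightarrow> L" unfolding P_def L_def by (rule qpoch_LIMSEQ[OF q(2)])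
  have P0: "P N \<noteq> 0" for N
  proof -
    have "1 - q * q ^ k \<noteq> 0" for k
    proof
      assume "1 - q * q ^ k = 0"
      hence "\<exists>k. q * q ^ k = 1" by (intro exI[of _ k]) simp
      hence "L = 0" unfolding L_def using qpoch_eq_0_iff[OF q(2), of q] by blast
      thus False using L0 by simp
    qed
    thus ?thesis by (simp add: P_def)
  qed
  obtain B1 where B1: "\<And>N. norm (P N) \<le> B1"
    using convergent_imp_Bseq[OF convergentI[OF P]] by (auto simp: Bseq_def)
  obtain B2 where B2: "\<And>N. norm (inverse (P N)) \<le> B2"
    using convergent_imp_Bseq[OF convergentI[OF tendsto_inverse[OF P L0]]] by (auto simp: Bseq_def)
  \<comment> \<open>Extending the coefficients by 0 beyond |r| \<le> N turns each finite sum into a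
    series over all integers.\<close>
  define c where "c = (\<lambda>r N. if \<bar>r\<bar> \<le> int N then qbinom q (2 * N) (nat (r + int N)) else 0)"
  have c: "c r N = P (2 * N) * inverse (P (nat (int N + r))) * inverse (P (nat (int N - r)))" if "\<bar>r\<bar> \<le> int N" for r N
  proof -
    have "2 * N - nat (r + int N) = nat (int N - r)" using that by auto
    hence "qbinom q (2 * N) (nat (r + int N)) * P (nat (r + int N)) * P (nat (int N - r)) = P (2 * N)"
      using qbinom_fact[of "nat (r + int N)" "2 * N" q] that unfolding P_def by (simp add: nat_le_iff)
    thus ?thesis using that P0 by (simp add: c_def field_simps add.commute)
  qed
  have c_lim: "(\<lambda>N. theta_term q x r * c r N) \<longlonglongrightarrow> theta_term q x r * (1 / L)" for r
  proof -
    have f: "filterlim (\<lambda>N. nat (int N + s)) at_top sequentially" for s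
    proof -
      have "filterlim (\<lambda>N. N - nat (- s)) at_top sequentially" by (rule filterlim_minus_const_nat_at_top)
      thus ?thesis
        by (rule filterlim_at_top_mono) (auto intro!: always_eventually)
    qed
    have f2: "filterlim (\<lambda>N::nat. 2 * N) at_top sequentially"
      by (rule filterlim_subseq) (auto simp: strict_mono_def)
    have "(\<lambda>N. P (2 * N) * inverse (P (nat (int N + r))) * inverse (P (nat (int N + (- r))))) \<longlonglongrightarrow> L * inverse L * inverse L"
      by (intro tendsto_intros L0 filterlim_compose[OF P] f f2)
    moreover have "\<forall>\<^sub>F N in sequentially. P (2 * N) * inverse (P (nat (int N + r))) * inverse (P (nat (int N + (- r)))) = c r N"
      using eventually_ge_at_top[of "nat \<bar>r\<bar>"] by eventually_elim (simp add: c)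
    ultimately have "c r \<longlonglongrightarrow> L * inverse L * inverse L"
      by (rule Lim_transform_eventually)
    thus ?thesis using L0 by (intro tendsto_intros) (simp add: divide_inverse)
  qed
  have c_bound: "norm (c r N) \<le> B1 * B2 * B2" for r N
  proof (cases "\<bar>r\<bar> \<le> int N")
    case True
    show ?thesis unfolding c[OF True] norm_mult
      by (intro mult_mono B1 B2 mult_nonneg_nonneg) (use B1[of 0] B2[of 0] norm_ge_zero order_trans in blast)+
  next
    case False
    moreover have "B1 \<ge> 0" "B2 \<ge> 0" using B1[of 0] B2[of 0] norm_ge_zero order_trans by blast+
    ultimately show ?thesis by (simp add: c_def)
  qed
  have "(\<lambda>N. \<Sum>\<^sub>\<infinity>r. theta_term q x r * c r N) \<longlonglongrightarrow> (\<Sum>\<^sub>\<infinity>r. theta_term q x r * (1 / L))"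
  proof (rule tendsto_infsum_dominated)
    show "(\<lambda>r. norm (theta_term q x r) * (B1 * B2 * B2)) summable_on UNIV"
      by (intro summable_on_cmult_left theta_term_abs_summable q x)
    show "\<forall>\<^sub>F N in sequentially. \<forall>r\<in>UNIV. norm (theta_term q x r * c r N) \<le> norm (theta_term q x r) * (B1 * B2 * B2)"
      by (auto simp: norm_mult intro!: always_eventually mult_left_mono c_bound)
  qed (use c_lim in auto)
  moreover have "(\<Sum>\<^sub>\<infinity>r. theta_term q x r * c r N) = (\<Prod>k<N. 1 - x * q ^ k) * (\<Prod>k<N. 1 - q / x * q ^ k)" for N
  proof -
    have "(\<Sum>\<^sub>\<infinity>r. theta_term q x r * c r N) = (\<Sum>\<^sub>\<infinity>r\<in>{-int N..int N}. theta_term q x r * qbinom q (2 * N) (nat (r + int N)))"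
      by (rule infsum_cong_neutral) (auto simp: c_def)
    thus ?thesis using finite_jacobi_triple_product[OF q0 x, of N] by simp
  qed
  moreover have "(\<lambda>N. (\<Prod>k<N. 1 - x * q ^ k) * (\<Prod>k<N. 1 - q / x * q ^ k)) \<longlonglongrightarrow> qpoch_inf x q * qpoch_inf (q / x) q"
    by (intro tendsto_intros qpoch_LIMSEQ q)
  ultimately have "(\<Sum>\<^sub>\<infinity>r. theta_term q x r * (1 / L)) = qpoch_inf x q * qpoch_inf (q / x) q"
    using LIMSEQ_unique by simp
  hence "(\<Sum>\<^sub>\<infinity>r. theta_term q x r) = jtheta x q"
    using L0 unfolding infsum_cmult_left' by (simp add: jtheta_def L_def field_simps)
  thus ?thesis
    using abs_summable_summable[OF theta_term_abs_summable[OF q x]] by (simp add: has_sum_iff)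
qed

section \<open>Quasi-periodic functions on the punctured plane\<close>

lemma ex_power_int_between:
  fixes \<rho> r :: real
  assumes "0 < \<rho>" "\<rho> < 1" "r > 0"
  shows "\<exists>k::int. \<rho> < r / \<rho> powi k \<and> r / \<rho> powi k \<le> 1"
proof -
  define L where "L = - ln \<rho>"
  have L: "L > 0" using assms by (simp add: L_def)
  \<comment> \<open>\<open>k\<close> is the floor of the logarithm of r to the base \<rho>.\<close>
  define k where "k = \<lfloor>- ln r / L\<rfloor>"
  have "of_int k \<le> - ln r / L" "- ln r / L < of_int k + 1"
    unfolding k_def by linarith+
  hence k: "of_int k * L \<le> - ln r" "- ln r < (of_int k + 1) * L"
    using L by (simp_all add: field_simps)
  have e: "ln (r / \<rho> powi k) = ln r + of_int k * L"
    using assms by (simp add: ln_div L_def powr_real_of_int' [symmetric] ln_powr)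
  have "r / \<rho> powi k > 0" using assms by simp
  moreover have "ln (r / \<rho> powi k) \<le> 0" "ln \<rho> < ln (r / \<rho> powi k)"
    using k unfolding e L_def by (simp_all add: algebra_simps)
  ultimately show ?thesis using assms by (intro exI[of _ k]) (simp add: ln_le_zero_iff)
qed

text \<open>The upper bound on |c| keeps K bounded near 0, so the singularity there is removable.
  Under z -> q z the difference quotient at 0 is multiplied by c/q, of modulus greater than 1,
  although along q^m z it tends to a finite derivative; hence it vanishes.\<close>

lemma quasi_periodic_imp_constant:
  assumes q: "0 < norm q" "norm q < 1"
    and hol: "K holomorphic_on - {0}"
    and per: "\<And>z. z \<noteq> 0 \<Longrightarrow> K (q * z) = c * K z"
    and c: "norm q < norm c" "norm c \<le> 1"
  shows "\<exists>a. \<forall>z. z \<noteq> 0 \<longrightarrow> K z = a"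
proof -
  have q0: "q \<noteq> 0" using q by auto
  have per_pow: "K (q ^ m * z) = c ^ m * K z" if "z \<noteq> 0" for m z
  proof (induction m)
    case (Suc m)
    have "K (q ^ Suc m * z) = K (q * (q ^ m * z))" by (simp add: mult_ac)
    also have "\<dots> = c * K (q ^ m * z)" using that q0 by (intro per) auto
    finally show ?case using Suc.IH by simp
  qed simp
  define R where "R = {z::complex. norm q \<le> norm z \<and> norm z \<le> 1}"
  have "R = cball 0 1 - ball 0 (norm q)" by (auto simp: R_def)
  hence "compact R" by (simp add: compact_diff)
  moreover have "R \<subseteq> - {0}" using q by (auto simp: R_def)
  hence "continuous_on R K" using hol holomorphic_on_imp_continuous_on holomorphic_on_subset by blast
  ultimately have "bounded (K ` R)" by (intro compact_imp_bounded compact_continuous_image)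
  then obtain B where B: "\<And>z. z \<in> R \<Longrightarrow> norm (K z) \<le> B" by (auto simp: bounded_iff)
  have bnd: "norm (K z) \<le> B" if z: "z \<noteq> 0" "norm z < 1" for z
  proof -
    obtain k :: int where k: "norm q < norm z / norm q powi k" "norm z / norm q powi k \<le> 1"
      using ex_power_int_between[OF q, of "norm z"] z by auto
    have "k \<ge> 0"
    proof (rule ccontr)
      assume "\<not> k \<ge> 0"
      hence "norm q powi (k + 1) \<ge> 1"
        using q power_int_decreasing[of "k + 1" 0 "norm q"] by auto
      moreover have "norm q powi (k + 1) = norm q powi k * norm q" using q by (simp add: power_int_add)
      ultimately show False using k(1) z q by (simp add: field_simps)
    qed
    then obtain m where m: "k = int m" using nonneg_int_cases by blast
    define w where "w = z / q ^ m"
    have w: "w \<in> R" "w \<noteq> 0" "z = q ^ m * w"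
      using k z q0 by (auto simp: R_def w_def m norm_divide norm_power)
    have "norm (K z) = norm c ^ m * norm (K w)"
      using per_pow[OF w(2), of m] w(3) by (simp add: norm_mult norm_power)
    also have "\<dots> \<le> 1 * B" using c B[OF w(1)] by (intro mult_mono power_le_one) auto
    finally show ?thesis by simp
  qed
  have "\<exists>B. \<forall>\<^sub>F z in at 0. norm (K z) \<le> B"
  proof
    show "\<forall>\<^sub>F z in at 0. norm (K z) \<le> B"
      unfolding eventually_at by (intro exI[of _ 1]) (auto intro: bnd)
  qed
  then obtain g where g: "g holomorphic_on UNIV" "\<And>z. z \<noteq> 0 \<Longrightarrow> g z = K z"
    using holomorphic_on_extend_bounded[of K UNIV 0] hol by (auto simp: Compl_eq_Diff_UNIV)
  have g_cont: "isCont g 0"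
    using holomorphic_on_imp_continuous_on[OF g(1)] continuous_on_eq_continuous_at[of UNIV g] by simp
  have pw: "(\<lambda>m. q ^ m * z) \<longlonglongrightarrow> 0" for z
    using q by (intro tendsto_mult_left_zero LIMSEQ_power_zero)
  have g0: "g 0 = c * g 0"
  proof (rule LIMSEQ_unique)
    have l: "(\<lambda>m. g (q ^ m * z)) \<longlonglongrightarrow> g 0" for z
      using isCont_tendsto_compose[OF g_cont pw] .
    show "(\<lambda>m. g (q ^ Suc m * 1)) \<longlonglongrightarrow> g 0" using l[of 1] by (rule LIMSEQ_Suc)
    have "(\<lambda>m. c * g (q ^ m * 1)) \<longlonglongrightarrow> c * g 0" by (intro tendsto_intros l)
    moreover have "g (q ^ Suc m * 1) = c * g (q ^ m * 1)" for m
      using per[of "q ^ m"] q0 by (simp add: g(2))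
    ultimately show "(\<lambda>m. g (q ^ Suc m * 1)) \<longlonglongrightarrow> c * g 0"
      by presburger
  qed
  have "K z = g 0" if z: "z \<noteq> 0" for z
  proof -
    define h where "h = (\<lambda>z. (g z - g 0) / z)"
    have "g field_differentiable at 0" using g(1) by (simp add: holomorphic_on_def)
    then obtain g' where "(g has_field_derivative g') (at 0)" by (auto simp: field_differentiable_def)
    hence "(h \<longlongrightarrow> g') (at 0)" unfolding has_field_derivative_iff h_def by simp
    moreover have "filterlim (\<lambda>m. q ^ m * z) (at 0) sequentially"
      using pw[of z] z q0 by (auto simp: filterlim_at intro!: always_eventually)
    ultimately have "(\<lambda>m. h (q ^ m * z)) \<longlonglongrightarrow> g'" by (rule filterlim_compose)
    moreover have "h (q ^ m * z) = (c / q) ^ m * h z" for m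
    proof -
      have "c ^ m * g 0 = g 0" using g0 by (induction m) (auto simp: mult_ac)
      hence "g (q ^ m * z) - g 0 = c ^ m * (g z - g 0)"
        using per_pow[OF z, of m] z q0 by (simp add: g(2) algebra_simps)
      thus ?thesis by (simp add: h_def power_divide)
    qed
    ultimately have "(\<lambda>m. (c / q) ^ m * h z) \<longlonglongrightarrow> g'" by simp
    moreover have "norm c > 0" using c q by linarith
    hence "norm (q / c) < 1" using c by (simp add: norm_divide)
    ultimately have lim: "(\<lambda>m. (q / c) ^ m * ((c / q) ^ m * h z)) \<longlonglongrightarrow> 0 * g'"
      by (intro tendsto_mult LIMSEQ_power_zero)
    have "(q / c) ^ m * ((c / q) ^ m * h z) = h z" for m
      using q0 c q by (auto simp: power_divide)
    hence "(\<lambda>m::nat. h z) \<longlonglongrightarrow> 0" using lim by (simp only: mult_zero_left)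
    hence "h z = 0" by (simp add: LIMSEQ_const_iff)
    thus ?thesis using z g(2)[OF z] by (simp add: h_def)
  qed
  thus ?thesis by blast
qed

text \<open>Multiplication by z^(-k) divides the multiplier by q^k and brings it into the range of
  \<open>quasi_periodic_imp_constant\<close>. The resulting constant is fixed by a multiplier
  different from 1.\<close>

lemma quasi_periodic_imp_zero:
  assumes q: "0 < norm q" "norm q < 1"
    and hol: "K holomorphic_on - {0}"
    and per: "\<And>z. z \<noteq> 0 \<Longrightarrow> K (q * z) = c * K z"
    and c: "\<And>k::int. c \<noteq> q powi k" and z: "z \<noteq> 0"
  shows "K z = 0"
proof (cases "c = 0")
  case True
  thus ?thesis using per[of "z / q"] z q by auto
next
  case False
  have q0: "q \<noteq> 0" using q by auto
  obtain k :: int where k: "norm q < norm c / norm q powi k" "norm c / norm q powi k \<le> 1"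
    using ex_power_int_between[OF q, of "norm c"] False by auto
  define c' where "c' = c / q powi k"
  have nc': "norm c' = norm c / norm q powi k"
    by (simp add: c'_def norm_divide power_int_def norm_power norm_inverse)
  have per': "K (q * z) * (q * z) powi (- k) = c' * (K z * z powi (- k))" if "z \<noteq> 0" for z
    using per[OF that] by (simp add: power_int_mult_distrib power_int_minus c'_def divide_inverse mult_ac)
  have "\<exists>a. \<forall>z. z \<noteq> 0 \<longrightarrow> K z * z powi (- k) = a"
  proof (rule quasi_periodic_imp_constant[OF q])
    show "(\<lambda>z. K z * z powi (- k)) holomorphic_on - {0}"
      by (intro holomorphic_intros hol) auto
  qed (use k nc' per' in auto)
  then obtain a where a: "\<And>z. z \<noteq> 0 \<Longrightarrow> K z * z powi (- k) = a" by blast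
  have "a = c' * a" using per'[of 1] a[of q] a[of 1] q0 by simp
  moreover have "c' \<noteq> 1" using c[of k] q0 by (auto simp: c'_def)
  ultimately have "a = 0" by simp
  thus ?thesis using a[OF z] z by simp
qed

text \<open>Riemann's theorem at each zero of T. The point t, where T does not vanish, guarantees
  that the zeros are isolated, the punctured plane being connected.\<close>

lemma removable_extension:
  assumes T: "T holomorphic_on - {0}" "t \<noteq> 0" "T t \<noteq> 0"
    and G: "G holomorphic_on {z. z \<noteq> 0 \<and> T z \<noteq> 0}"
    and lim: "\<And>z0. z0 \<noteq> 0 \<Longrightarrow> T z0 = 0 \<Longrightarrow> ((\<lambda>z. (z - z0) * G z) \<longlongrightarrow> 0) (at z0)"
  shows "\<exists>K. K holomorphic_on - {0} \<and> (\<forall>z. z \<noteq> 0 \<and> T z \<noteq> 0 \<longrightarrow> K z = G z)"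
proof -
  define U where "U = {z. z \<noteq> 0 \<and> T z \<noteq> 0}"
  have U: "open U"
  proof -
    have "open (- {0} \<inter> T -` (- {0}))"
      using T(1) by (intro continuous_open_preimage holomorphic_on_imp_continuous_on) auto
    moreover have "- {0} \<inter> T -` (- {0}) = U" by (auto simp: U_def)
    ultimately show ?thesis by simp
  qed
  define K where "K = (\<lambda>z. if z \<in> U then G z else Lim (at z) G)"
  have "K field_differentiable at z0" if z0: "z0 \<noteq> 0" for z0
  proof (cases "z0 \<in> U")
    case True
    have "K holomorphic_on U" using G by (subst holomorphic_cong[of U U K G]) (auto simp: K_def U_def)
    thus ?thesis using True U holomorphic_on_imp_differentiable_at by blast
  next
    case False
    hence T0: "T z0 = 0" using z0 by (auto simp: U_def)
    have conn: "connected (- {0::complex})"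
      using connected_punctured_universe[of "0::complex"] by (simp add: DIM_complex)
    obtain e where e: "e > 0" "ball z0 e \<subseteq> - {0}" "\<And>z. z \<in> ball z0 e - {z0} \<Longrightarrow> T z \<noteq> 0"
      using isolated_zeros[OF T(1) _ conn, of z0 t] z0 T0 T(2,3) by auto
    have sub: "ball z0 e - {z0} \<subseteq> U" using e by (auto simp: U_def)
    have "G holomorphic_on ball z0 e - {z0}" using G sub holomorphic_on_subset unfolding U_def by blast
    then obtain g where g: "g holomorphic_on ball z0 e" "\<And>z. z \<in> ball z0 e - {z0} \<Longrightarrow> g z = G z"
      using holomorphic_on_extend_lim[of G "ball z0 e" z0] lim[OF z0 T0] e(1) by auto
    have "isCont g z0"
      using holomorphic_on_imp_continuous_on[OF g(1)] continuous_on_eq_continuous_at[of "ball z0 e" g] e(1) by simp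
    hence "(g \<longlongrightarrow> g z0) (at z0)" by (simp add: isCont_def)
    moreover have "\<forall>\<^sub>F z in at z0. g z = G z"
      unfolding eventually_at using e(1) g(2) by (intro exI[of _ e]) (auto simp: dist_commute)
    ultimately have "(G \<longlongrightarrow> g z0) (at z0)" by (rule Lim_transform_eventually)
    hence "Lim (at z0) G = g z0" by (intro tendsto_Lim) auto
    hence "K z = g z" if "z \<in> ball z0 e" for z
      using that sub g(2) False by (cases "z = z0") (auto simp: K_def)
    hence "K holomorphic_on ball z0 e" using g(1) by (subst holomorphic_cong[of _ "ball z0 e" K g]) auto
    thus ?thesis using e(1) holomorphic_on_imp_differentiable_at by (metis centre_in_ball open_ball)
  qed
  hence "K holomorphic_on - {0}" by (auto simp: holomorphic_on_def intro: field_differentiable_at_within)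
  thus ?thesis by (intro exI[of _ K]) (auto simp: K_def U_def)
qed

text \<open>The functional equation is given only off the zeros of T; it reaches them by continuity,
  since a punctured ball around each of them is free of zeros.\<close>

lemma quasi_periodic_extension:
  assumes q: "q \<noteq> 0"
    and T: "T holomorphic_on - {0}" "t \<noteq> 0" "T t \<noteq> 0"
    and G: "G holomorphic_on {z. z \<noteq> 0 \<and> T z \<noteq> 0}"
    and lim: "\<And>z0. z0 \<noteq> 0 \<Longrightarrow> T z0 = 0 \<Longrightarrow> ((\<lambda>z. (z - z0) * G z) \<longlongrightarrow> 0) (at z0)"
    and T_per: "\<And>z. z \<noteq> 0 \<Longrightarrow> T z \<noteq> 0 \<Longrightarrow> T (q * z) \<noteq> 0"
    and per: "\<And>z. z \<noteq> 0 \<Longrightarrow> T z \<noteq> 0 \<Longrightarrow> G (q * z) = c * G z"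
  shows "\<exists>K. K holomorphic_on - {0} \<and> (\<forall>z. z \<noteq> 0 \<and> T z \<noteq> 0 \<longrightarrow> K z = G z) \<and>
            (\<forall>z. z \<noteq> 0 \<longrightarrow> K (q * z) = c * K z)"
proof -
  obtain K where K: "K holomorphic_on - {0}" "\<And>z. z \<noteq> 0 \<Longrightarrow> T z \<noteq> 0 \<Longrightarrow> K z = G z"
    using removable_extension[OF T G lim] by blast
  have "K (q * z0) = c * K z0" if z0: "z0 \<noteq> 0" for z0
  proof (cases "T z0 = 0")
    case False
    thus ?thesis using K(2) per T_per z0 q by simp
  next
    case True
    have conn: "connected (- {0::complex})"
      using connected_punctured_universe[of "0::complex"] by (simp add: DIM_complex)
    obtain e where e: "e > 0" "ball z0 e \<subseteq> - {0}" "\<And>z. z \<in> ball z0 e - {z0} \<Longrightarrow> T z \<noteq> 0"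
      using isolated_zeros[OF T(1) _ conn, of z0 t] z0 True T(2,3) by auto
    have K_cont: "isCont K z" if "z \<noteq> 0" for z
      using that K(1) by (metis Compl_iff continuous_on_eq_continuous_at holomorphic_on_imp_continuous_on
          open_Compl closed_singleton singletonD)
    have "((\<lambda>z. K (q * z)) \<longlongrightarrow> K (q * z0)) (at z0)"
      by (rule isCont_tendsto_compose[OF K_cont]) (use z0 q in \<open>auto intro!: tendsto_intros\<close>)
    moreover have "((\<lambda>z. c * K z) \<longlongrightarrow> c * K z0) (at z0)"
      using K_cont[OF z0] by (intro tendsto_intros) (simp add: isCont_def)
    moreover have "\<forall>\<^sub>F z in at z0. K (q * z) = c * K z"
      unfolding eventually_at
    proof (intro exI[of _ e] conjI e(1) ballI impI)
      fix z assume "z \<noteq> z0 \<and> dist z z0 < e"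
      hence z: "z \<in> ball z0 e - {z0}" by (simp add: dist_commute)
      hence "T z \<noteq> 0" "z \<noteq> 0" using e by auto
      thus "K (q * z) = c * K z" using K(2) per T_per q by simp
    qed
    ultimately show ?thesis
      using Lim_transform_eventually[of "\<lambda>z. K (q * z)" "K (q * z0)" "at z0" "\<lambda>z. c * K z"]
        tendsto_unique[of "at z0" "\<lambda>z. c * K z" "K (q * z0)" "c * K z0"] by simp
  qed
  thus ?thesis using K by blast
qed

section \<open>Powers of q, cube roots of unity and a quintuple-product identity\<close>

lemma power_int_inject_complex:
  fixes q :: complex
  assumes "0 < norm q" "norm q < 1" "q powi k = q powi (l::int)"
  shows "k = l"
proof (rule ccontr)
  have n: "norm (q powi i) = norm q powi i" for i :: int
    by (simp add: power_int_def norm_power norm_inverse)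
  assume "k \<noteq> l"
  hence "norm q powi k \<noteq> norm q powi l"
    using power_int_strict_decreasing[of k l "norm q"] power_int_strict_decreasing[of l k "norm q"] assms(1,2)
    by (cases "k < l") auto
  thus False using assms(3) n by metis
qed

text \<open>Its cube would be q^0, which forces the exponent 0, and 1 is not a root of 1 + w + w^2.
  This keeps different families of theta zeros apart.\<close>

lemma cube_root_unity_not_power_int:
  fixes q :: complex
  assumes "0 < norm q" "norm q < 1" and w: "1 + w + w\<^sup>2 = 0"
  shows "w \<noteq> q powi k"
proof
  assume k: "w = q powi k"
  hence "q powi (k * 3) = q powi 0"
    using cube_root_unity_mult[OF w] by (simp add: power_int_mult power3_eq_cube power2_eq_square mult.assoc)
  hence "k * 3 = 0" by (rule power_int_inject_complex[OF assms(1,2)])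
  hence "k = 0" by simp
  thus False using k w by simp
qed

lemma cube_root_unity_square:
  assumes w: "1 + w + w\<^sup>2 = (0::complex)"
  shows "1 + w\<^sup>2 + (w\<^sup>2)\<^sup>2 = 0"
proof -
  have "(w\<^sup>2)\<^sup>2 = w * (w * w\<^sup>2)" by (simp add: power2_eq_square)
  thus ?thesis using w cube_root_unity_mult[OF w] by (simp add: add_ac)
qed

lemma jtheta_simple_zero_scaled:
  assumes q: "0 < norm q" "norm q < 1" and "a \<noteq> 0" "x0 \<noteq> 0" "jtheta (a * x0) q = 0"
  shows "\<exists>l. ((\<lambda>x. (x - x0) / jtheta (a * x) q) \<longlongrightarrow> l) (at x0)"
proof -
  obtain l where l: "((\<lambda>x. (x - a * x0) / jtheta x q) \<longlongrightarrow> l) (at (a * x0))"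
    using jtheta_simple_zero[OF q, of "a * x0"] assms by auto
  have "filterlim (\<lambda>x. a * x) (at (a * x0)) (at x0)"
    using assms(3) by (auto simp: filterlim_at eventually_at_filter intro!: tendsto_intros)
  from filterlim_compose[OF l this]
  have "((\<lambda>x. (a * x - a * x0) / jtheta (a * x) q) \<longlongrightarrow> l) (at x0)" .
  hence "((\<lambda>x. 1 / a * ((a * x - a * x0) / jtheta (a * x) q)) \<longlongrightarrow> 1 / a * l) (at x0)"
    by (intro tendsto_intros)
  moreover have "1 / a * ((a * x - a * x0) / jtheta (a * x) q) = (x - x0) / jtheta (a * x) q" for x
    using assms(3) by (simp flip: right_diff_distrib)
  ultimately show ?thesis by auto
qed

text \<open>Both sides are quasi-periodic with the same multiplier under \<open>s \<mapsto> p\<^sup>3 s\<close>, and the left-hand side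
  vanishes at the (simple) zeros of the right-hand side, so their quotient is constant.\<close>

lemma theta_quintuple_variant:
  assumes p: "0 < norm p" "norm p < 1" and w: "1 + w + w\<^sup>2 = 0" and s: "s \<noteq> 0"
  shows "(jtheta (s\<^sup>2 * p) (p^3) * jtheta (s * p) (p^3) -
          w\<^sup>2 * s * jtheta (s\<^sup>2 * p\<^sup>2) (p^3) * jtheta (s * p\<^sup>2) (p^3)) * qpoch_inf (p^3) (p^3) =
         jtheta (w\<^sup>2 * s) p * jtheta (s * p) (p^3) * jtheta (s * p\<^sup>2) (p^3)"
proof -
  define Q where "Q = p^3"
  define J where "J = (\<lambda>x. jtheta x Q)"
  define \<phi> where "\<phi> = (\<lambda>s. J (s\<^sup>2 * p) * J (s * p) - w\<^sup>2 * s * J (s\<^sup>2 * p\<^sup>2) * J (s * p\<^sup>2))"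
  define T where "T = (\<lambda>s. jtheta (w\<^sup>2 * s) p * J (s * p) * J (s * p\<^sup>2))"
  have p0: "p \<noteq> 0" using p by auto
  have Q: "0 < norm Q" "norm Q < 1" using p by (auto simp: Q_def norm_power power_less_one_iff)
  have Q0: "Q \<noteq> 0" using Q by auto
  note w3 = cube_root_unity_mult[OF w]
  have w0: "w \<noteq> 0" using w3 by auto
  have w2: "1 / w = w\<^sup>2" "1 / w\<^sup>2 = w" using w3 w0 by (auto simp: field_simps)
  have J_shift: "J (Q * x) = - J x / x" if "x \<noteq> 0" for x
    unfolding J_def by (rule jtheta_q_mult[OF Q that])
  have J_inv: "J (1 / x) = - J x / x" if "x \<noteq> 0" for x
    unfolding J_def by (rule jtheta_inverse[OF Q that])
  have J_flip: "J (Q / x) = J x" for x unfolding J_def by (rule jtheta_flip[OF Q0])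
  have J1: "J 1 = 0" unfolding J_def using Q by simp
  have \<phi>_shift: "\<phi> (Q * s) = - \<phi> s / (Q\<^sup>2 * s ^ 5)" if s: "s \<noteq> 0" for s
  proof -
    have e: "(Q * s)\<^sup>2 * y = Q * (Q * (s\<^sup>2 * y))" "Q * s * y = Q * (s * y)" for y
      by (simp_all add: power2_eq_square mult_ac)
    have Qp: "Q = p * p * p" by (simp add: Q_def power3_eq_cube)
    have 1: "J ((Q * s)\<^sup>2 * p) * J (Q * s * p) = - (J (s\<^sup>2 * p) * J (s * p)) / (Q\<^sup>2 * s ^ 5)"
      unfolding e using s p0 Q0
      by (simp add: J_shift) (simp add: Qp field_simps eval_nat_numeral)
    have 2: "w\<^sup>2 * (Q * s) * J ((Q * s)\<^sup>2 * p\<^sup>2) * J (Q * s * p\<^sup>2) = - (w\<^sup>2 * s * J (s\<^sup>2 * p\<^sup>2) * J (s * p\<^sup>2)) / (Q\<^sup>2 * s ^ 5)"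
      unfolding e using s p0 Q0
      by (simp add: J_shift) (simp add: Qp field_simps eval_nat_numeral)
    show ?thesis unfolding \<phi>_def 1 2 by (simp add: diff_divide_distrib)
  qed
  have T_shift: "T (Q * s) = - T s / (Q\<^sup>2 * s ^ 5)" if s: "s \<noteq> 0" for s
  proof -
    have e: "Q * s * y = Q * (s * y)" for y by simp
    have e': "w\<^sup>2 * (Q * s) = p * (p * (p * (w\<^sup>2 * s)))"
      by (simp add: Q_def power3_eq_cube mult_ac)
    have "jtheta (w\<^sup>2 * (Q * s)) p = - jtheta (w\<^sup>2 * s) p / (p ^ 3 * (w * w\<^sup>2)\<^sup>2 * s ^ 3)"
      unfolding e' using s p0 w0
      by (simp add: jtheta_q_mult[OF p]) (simp add: field_simps eval_nat_numeral)
    hence "jtheta (w\<^sup>2 * (Q * s)) p = - jtheta (w\<^sup>2 * s) p / (p ^ 3 * s ^ 3)" by (simp add: w3)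
    moreover have "J (Q * s * p) * J (Q * s * p\<^sup>2) = J (s * p) * J (s * p\<^sup>2) / (p ^ 3 * s\<^sup>2)"
      unfolding e using s p0 by (simp add: J_shift eval_nat_numeral mult_ac)
    ultimately have "T (Q * s) = (- jtheta (w\<^sup>2 * s) p / (p ^ 3 * s ^ 3)) * (J (s * p) * J (s * p\<^sup>2) / (p ^ 3 * s\<^sup>2))"
      by (simp add: T_def mult.assoc)
    thus ?thesis by (simp add: T_def Q_def eval_nat_numeral mult_ac)
  qed
  have \<phi>_zero: "\<phi> (Q powi m * s) = 0 \<longleftrightarrow> \<phi> s = 0" if s: "s \<noteq> 0" for m s
  proof -
    have step: "\<phi> (Q powi (m + 1) * s) = 0 \<longleftrightarrow> \<phi> (Q powi m * s) = 0" for m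
      using \<phi>_shift[of "Q powi m * s"] s Q0 by (simp add: power_int_add mult_ac)
    show ?thesis
    proof (induction m rule: int_induct[where k = 0])
      case (step2 i) thus ?case using step[of "i - 1"] by simp
    qed (simp_all add: step)
  qed
  have Jw: "J (w\<^sup>2 * p) = J (w * p\<^sup>2)" "J (w\<^sup>2 * p\<^sup>2) = J (w * p)"
  proof -
    have "Q / (w\<^sup>2 * p) = (1 / w\<^sup>2) * p\<^sup>2" "Q / (w\<^sup>2 * p\<^sup>2) = (1 / w\<^sup>2) * p"
      using p0 by (simp_all add: Q_def eval_nat_numeral)
    thus "J (w\<^sup>2 * p) = J (w * p\<^sup>2)" "J (w\<^sup>2 * p\<^sup>2) = J (w * p)"
      using J_flip[of "w\<^sup>2 * p"] J_flip[of "w\<^sup>2 * p\<^sup>2"] unfolding w2 by simp_all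
  qed
  have zero_a: "\<phi> s = 0" if h: "jtheta (w\<^sup>2 * s) p = 0" "s \<noteq> 0" for s
  proof -
    obtain k :: int where k: "w\<^sup>2 * s = p powi k"
      using jtheta_eq_0_iff[OF p, of "w\<^sup>2 * s"] h w0 by auto
    have "s = w * w\<^sup>2 * s" using w3 by simp
    also have "\<dots> = w * p powi k" using k by (simp add: mult.assoc)
    finally have s: "s = w * p powi k" .
    \<comment> \<open>Rounding k/3 to the nearest integer leaves remainder 0, 1 or -1, so the three
      base points w, w p and w/p suffice.\<close>
    define m where "m = (k + 1) div 3"
    have "k = 3 * m \<or> k = 3 * m + 1 \<or> k = 3 * m - 1" unfolding m_def by presburger
    moreover have Qm: "Q powi m = p powi (3 * m)" by (simp add: Q_def power_int_power)
    ultimately have "s = Q powi m * w \<or> s = Q powi m * (w * p) \<or> s = Q powi m * (w / p)"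
      unfolding s Qm using p0 by (auto simp: power_int_add power_int_diff)
    \<comment> \<open>At s = w the prefactor w^2 s is 1, and x -> Q/x turns each of the two products
      into the other.\<close>
    moreover have "\<phi> w = 0"
    proof -
      have "w\<^sup>2 * w = 1" using w3 by (simp add: mult.commute)
      thus ?thesis by (simp add: \<phi>_def Jw)
    qed
    moreover have "\<phi> (w * p) = 0"
    proof -
      have "(w * p)\<^sup>2 * p = Q * w\<^sup>2" "w * p * p = w * p\<^sup>2" "w * p * p\<^sup>2 = Q * w"
          "(w * p)\<^sup>2 * p\<^sup>2 = Q * (w\<^sup>2 * p)" "w\<^sup>2 * (w * p) = (w * w\<^sup>2) * p"
        by (simp_all add: Q_def eval_nat_numeral mult_ac)
      hence "\<phi> (w * p) = - J (w\<^sup>2) / w\<^sup>2 * J (w * p\<^sup>2) - p * (- J (w\<^sup>2 * p) / (w\<^sup>2 * p)) * (- J w / w)"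
        using w0 p0 unfolding \<phi>_def by (simp only: J_shift w3 mult_1_left) (simp add: J_shift)
      also have "J (w\<^sup>2) = - J w / w" using J_inv[OF w0] w2 by simp
      also have "J (w\<^sup>2 * p) = J (w * p\<^sup>2)" by (rule Jw)
      finally show ?thesis using p0 w0 by (simp add: field_simps)
    qed
    moreover have "\<phi> (w / p) = 0"
    proof -
      have e: "(w / p)\<^sup>2 * p = w\<^sup>2 / p" "w / p * p = w" "w / p * p\<^sup>2 = w * p"
          "(w / p)\<^sup>2 * p\<^sup>2 = w\<^sup>2" "w\<^sup>2 * (w / p) = (w * w\<^sup>2) / p"
        using p0 by (simp_all add: power_divide eval_nat_numeral)
      have "w\<^sup>2 / p = 1 / (w * p)" using w2 by (metis divide_divide_eq_left)
      hence a1: "J (w\<^sup>2 / p) = - J (w * p) / (w * p)" using J_inv[of "w * p"] w0 p0 by simp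
      have a2: "J (w\<^sup>2) = - J w / w" using J_inv[OF w0] w2 by simp
      show ?thesis unfolding \<phi>_def e w3 a1 a2 using p0 w0 by (simp add: field_simps)
    qed
    ultimately show ?thesis
      using \<phi>_zero[of w m] \<phi>_zero[of "w * p" m] \<phi>_zero[of "w / p" m] w0 p0 by auto
  qed
  have zero_b: "\<phi> s = 0" if h: "J (s * p) = 0" "s \<noteq> 0" for s
  proof -
    obtain k :: int where k: "s * p = Q powi k"
      using jtheta_eq_0_iff[OF Q, of "s * p"] h p0 by (auto simp: J_def)
    hence "s = Q powi k * (1 / p)" using p0 by (simp add: field_simps)
    moreover have "\<phi> (1 / p) = 0" using p0 by (simp add: \<phi>_def J1 power_divide)
    ultimately show ?thesis using \<phi>_zero[of "1 / p" k] p0 by simp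
  qed
  have zero_c: "\<phi> s = 0" if h: "J (s * p\<^sup>2) = 0" "s \<noteq> 0" for s
  proof -
    obtain k :: int where k: "s * p\<^sup>2 = Q powi k"
      using jtheta_eq_0_iff[OF Q, of "s * p\<^sup>2"] h p0 by (auto simp: J_def)
    hence "s = Q powi k * (1 / p\<^sup>2)" using p0 by (simp add: field_simps)
    moreover have "(1 / p\<^sup>2)\<^sup>2 * p = 1 / Q" using p0 by (simp add: Q_def field_simps eval_nat_numeral)
    hence "\<phi> (1 / p\<^sup>2) = 0" using p0 J_inv[OF Q0] J_flip[of 1] by (simp add: \<phi>_def J1)
    ultimately show ?thesis using \<phi>_zero[of "1 / p\<^sup>2" k] p0 by simp
  qed
  note w_not = cube_root_unity_not_power_int[OF p w]
  note w2_not = cube_root_unity_not_power_int[OF p cube_root_unity_square[OF w]]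
  \<comment> \<open>The three factors of T have disjoint zero sets. Hence all zeros of T are simple,
    and the vanishing of \<phi> there removes every pole of the quotient.\<close>
  have ab: "\<not> (jtheta (w\<^sup>2 * s) p = 0 \<and> J (s * p) = 0)" if h: "s \<noteq> 0" for s
  proof
    assume *: "jtheta (w\<^sup>2 * s) p = 0 \<and> J (s * p) = 0"
    obtain k :: int where k: "w\<^sup>2 * s = p powi k"
      using jtheta_eq_0_iff[OF p, of "w\<^sup>2 * s"] * h w0 by auto
    obtain l :: int where l: "s * p = Q powi l"
      using jtheta_eq_0_iff[OF Q, of "s * p"] * h p0 by (auto simp: J_def)
    have "w\<^sup>2 * (s * p) = (w\<^sup>2 * s) * p" by simp
    hence "w\<^sup>2 * p powi (3 * l) = p powi k * p" unfolding k l by (simp add: Q_def power_int_power)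
    hence "w\<^sup>2 = p powi (k + 1 - 3 * l)"
      using p0 by (simp add: power_int_add power_int_diff eq_divide_eq)
    thus False using w2_not by blast
  qed
  have ac: "\<not> (jtheta (w\<^sup>2 * s) p = 0 \<and> J (s * p\<^sup>2) = 0)" if h: "s \<noteq> 0" for s
  proof
    assume *: "jtheta (w\<^sup>2 * s) p = 0 \<and> J (s * p\<^sup>2) = 0"
    obtain k :: int where k: "w\<^sup>2 * s = p powi k"
      using jtheta_eq_0_iff[OF p, of "w\<^sup>2 * s"] * h w0 by auto
    obtain l :: int where l: "s * p\<^sup>2 = Q powi l"
      using jtheta_eq_0_iff[OF Q, of "s * p\<^sup>2"] * h p0 by (auto simp: J_def)
    have "w\<^sup>2 * (s * p\<^sup>2) = (w\<^sup>2 * s) * p\<^sup>2" by simp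
    hence "w\<^sup>2 * p powi (3 * l) = p powi k * p\<^sup>2" unfolding k l by (simp add: Q_def power_int_power)
    hence "w\<^sup>2 = p powi (k + 2 - 3 * l)"
      using p0 by (simp add: power_int_add power_int_diff eq_divide_eq)
    thus False using w2_not by blast
  qed
  have bc: "\<not> (J (s * p) = 0 \<and> J (s * p\<^sup>2) = 0)" if h: "s \<noteq> 0" for s
  proof
    assume *: "J (s * p) = 0 \<and> J (s * p\<^sup>2) = 0"
    obtain k :: int where k: "s * p = Q powi k"
      using jtheta_eq_0_iff[OF Q, of "s * p"] * h p0 by (auto simp: J_def)
    obtain l :: int where l: "s * p\<^sup>2 = Q powi l"
      using jtheta_eq_0_iff[OF Q, of "s * p\<^sup>2"] * h p0 by (auto simp: J_def)
    have "p powi (3 * k + 1) = p powi (3 * l)"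
      using k l p0 by (simp add: Q_def power_int_power power_int_add power2_eq_square flip: mult.assoc)
    hence "3 * k + 1 = 3 * l" by (rule power_int_inject_complex[OF p])
    thus False by presburger
  qed
  have hol_J: "(\<lambda>z. J (f z)) holomorphic_on A" if "f holomorphic_on A" "\<And>z. z \<in> A \<Longrightarrow> f z \<noteq> 0" for f A
    unfolding J_def by (rule jtheta_holomorphic[OF Q(2) that])
  have T_hol: "T holomorphic_on - {0}"
    unfolding T_def using p0 w0 by (intro holomorphic_intros hol_J jtheta_holomorphic p) auto
  have \<phi>_hol: "\<phi> holomorphic_on - {0}"
    unfolding \<phi>_def using p0 by (intro holomorphic_intros hol_J) auto
  define G where "G = (\<lambda>s. \<phi> s / T s)"
  \<comment> \<open>The constant is read off at s = 1, where J(p^2) = J(p) makes both sides explicit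
    multiples of J(p)^2.\<close>
  have T1: "T 1 = (1 - w\<^sup>2) * qpoch_inf Q Q * (J p)\<^sup>2" and \<phi>1: "\<phi> 1 = (1 - w\<^sup>2) * (J p)\<^sup>2"
  proof -
    have "J (p\<^sup>2) = J p" using J_flip[of p] p0 by (simp add: Q_def eval_nat_numeral)
    thus "\<phi> 1 = (1 - w\<^sup>2) * (J p)\<^sup>2" "T 1 = (1 - w\<^sup>2) * qpoch_inf Q Q * (J p)\<^sup>2"
      by (simp_all add: T_def \<phi>_def Q_def jtheta_cube_root_unity[OF p cube_root_unity_square[OF w]]
        left_diff_distrib power2_eq_square[of "J p"])
  qed
  have T1_nz: "T 1 \<noteq> 0"
  proof -
    have "w\<^sup>2 \<noteq> 1" using w2_not[of 0] by simp
    moreover have "J p \<noteq> 0"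
    proof
      assume "J p = 0"
      then obtain k :: int where k: "p = Q powi k"
        using jtheta_eq_0_iff[OF Q p0] by (auto simp: J_def)
      have "p powi 1 = p powi (3 * k)" using k by (simp add: Q_def power_int_power)
      hence "1 = 3 * k" by (rule power_int_inject_complex[OF p])
      thus False by presburger
    qed
    ultimately show ?thesis using T1 qpoch_self_nonzero[OF Q(2)] by simp
  qed
  have "\<exists>K. K holomorphic_on - {0} \<and> (\<forall>z. z \<noteq> 0 \<and> T z \<noteq> 0 \<longrightarrow> K z = G z) \<and>
            (\<forall>z. z \<noteq> 0 \<longrightarrow> K (Q * z) = 1 * K z)"
  proof (rule quasi_periodic_extension[OF Q0 T_hol _ T1_nz])
    show "G holomorphic_on {z. z \<noteq> 0 \<and> T z \<noteq> 0}"
      unfolding G_def by (intro holomorphic_intros holomorphic_on_subset[OF \<phi>_hol] holomorphic_on_subset[OF T_hol]) auto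
    fix s assume s: "s \<noteq> 0" "T s \<noteq> 0"
    show "T (Q * s) \<noteq> 0" "G (Q * s) = 1 * G s" using s Q0 by (auto simp: G_def T_shift \<phi>_shift)
  next
    fix s0 assume s0: "s0 \<noteq> 0" "T s0 = 0"
    have \<phi>_lim: "(\<phi> \<longlongrightarrow> 0) (at s0)"
    proof -
      have "\<phi> s0 = 0" using s0 zero_a zero_b zero_c by (auto simp: T_def)
      moreover have "isCont \<phi> s0" using \<phi>_hol s0(1)
        by (metis Compl_iff continuous_on_eq_continuous_at holomorphic_on_imp_continuous_on
          open_Compl closed_singleton singletonD)
      ultimately show ?thesis by (simp add: isCont_def)
    qed
    have lims: "((\<lambda>s. jtheta (w\<^sup>2 * s) p) \<longlongrightarrow> jtheta (w\<^sup>2 * s0) p) (at s0)"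
      "((\<lambda>s. J (s * p)) \<longlongrightarrow> J (s0 * p)) (at s0)" "((\<lambda>s. J (s * p\<^sup>2)) \<longlongrightarrow> J (s0 * p\<^sup>2)) (at s0)"
      unfolding J_def using s0 p0 w0 by (intro jtheta_tendsto p Q tendsto_intros; simp)+
    consider "jtheta (w\<^sup>2 * s0) p = 0" | "J (s0 * p) = 0" | "J (s0 * p\<^sup>2) = 0"
      using s0 by (auto simp: T_def)
    thus "((\<lambda>s. (s - s0) * G s) \<longlongrightarrow> 0) (at s0)"
    proof cases
      case 1
      obtain l where l: "((\<lambda>s. (s - s0) / jtheta (w\<^sup>2 * s) p) \<longlongrightarrow> l) (at s0)"
        using jtheta_simple_zero_scaled[OF p _ s0(1) 1] w0 by auto
      have "((\<lambda>s. (s - s0) / jtheta (w\<^sup>2 * s) p * \<phi> s / (J (s * p) * J (s * p\<^sup>2))) \<longlongrightarrow>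
          l * 0 / (J (s0 * p) * J (s0 * p\<^sup>2))) (at s0)"
        by (intro tendsto_intros l lims \<phi>_lim) (use 1 ab ac s0 in auto)
      thus ?thesis by (simp add: G_def T_def mult_ac)
    next
      case 2
      obtain l where l: "((\<lambda>s. (s - s0) / J (s * p)) \<longlongrightarrow> l) (at s0)"
        using jtheta_simple_zero_scaled[OF Q p0 s0(1)] 2 by (auto simp: J_def mult.commute)
      have "((\<lambda>s. (s - s0) / J (s * p) * \<phi> s / (jtheta (w\<^sup>2 * s) p * J (s * p\<^sup>2))) \<longlongrightarrow>
          l * 0 / (jtheta (w\<^sup>2 * s0) p * J (s0 * p\<^sup>2))) (at s0)"
        by (intro tendsto_intros l lims \<phi>_lim) (use 2 ab bc s0 in auto)
      thus ?thesis by (simp add: G_def T_def mult_ac)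
    next
      case 3
      obtain l where l: "((\<lambda>s. (s - s0) / J (s * p\<^sup>2)) \<longlongrightarrow> l) (at s0)"
        using jtheta_simple_zero_scaled[OF Q _ s0(1), of "p\<^sup>2"] p0 3 by (auto simp: J_def mult.commute)
      have "((\<lambda>s. (s - s0) / J (s * p\<^sup>2) * \<phi> s / (jtheta (w\<^sup>2 * s) p * J (s * p))) \<longlongrightarrow>
          l * 0 / (jtheta (w\<^sup>2 * s0) p * J (s0 * p))) (at s0)"
        by (intro tendsto_intros l lims \<phi>_lim) (use 3 ac bc s0 in auto)
      thus ?thesis by (simp add: G_def T_def mult_ac)
    qed
  qed auto
  then obtain K where K: "K holomorphic_on - {0}" "\<And>z. z \<noteq> 0 \<Longrightarrow> T z \<noteq> 0 \<Longrightarrow> K z = G z"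
      "\<And>z. z \<noteq> 0 \<Longrightarrow> K (Q * z) = 1 * K z" by blast
  obtain a where a: "\<And>z. z \<noteq> 0 \<Longrightarrow> K z = a"
    using quasi_periodic_imp_constant[OF Q K(1) K(3)] Q by auto
  have "\<phi> s * qpoch_inf Q Q = T s"
  proof (cases "T s = 0")
    case True
    hence "\<phi> s = 0" using s zero_a zero_b zero_c by (auto simp: T_def)
    thus ?thesis using True by simp
  next
    case False
    have "G s = G 1" using s a[of s] a[of 1] K(2)[OF s False] K(2)[OF _ T1_nz] by simp
    also have "G 1 = 1 / qpoch_inf Q Q" using T1_nz unfolding G_def T1 \<phi>1 by auto
    finally show ?thesis using False qpoch_self_nonzero[OF Q(2)] by (simp add: G_def field_simps)
  qed
  thus ?thesis by (simp add: \<phi>_def T_def J_def Q_def)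
qed

section \<open>Lerch sums\<close>

text \<open>The series in m(x,q,z), with w = x z / q. Separating w from z and dropping the theta
  denominator keeps it regular at the zeros of j(z;q), and lets w and z be shifted
  separately.\<close>

definition lerch_sum :: "complex \<Rightarrow> complex \<Rightarrow> complex \<Rightarrow> complex" where
  "lerch_sum q w z = (\<Sum>\<^sub>\<infinity>r::int. theta_term q z r / (1 - q powi r * w))"

lemma appell_lerch_eq_lerch_sum:
  assumes "q \<noteq> 0"
  shows "appell_lerch x q z = lerch_sum q (x * z / q) z / jtheta z q"
  using assms by (simp add: appell_lerch_def lerch_sum_def theta_term_def power_int_diff mult.assoc)

section \<open>Convergence, holomorphy and poles of Lerch sums\<close>

lemma power_int_le_abs:
  fixes A t :: real
  assumes "A > 0" "1 / A \<le> t" "t \<le> A"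
  shows "t powi r \<le> A powi \<bar>r\<bar>"
proof (cases "r \<ge> 0")
  case True
  have "t > 0" using assms by (meson divide_pos_pos less_le_trans zero_less_one)
  thus ?thesis using True assms by (simp add: power_int_mono)
next
  case False
  have t: "t > 0" using assms by (meson divide_pos_pos less_le_trans zero_less_one)
  have "1 / t \<le> A" using assms t by (simp add: field_simps)
  hence "(1 / t) powi (- r) \<le> A powi (- r)" using False t by (intro power_int_mono) auto
  moreover have "(1 / t) powi (- r) = t powi r"
    by (simp add: power_int_divide_distrib power_int_minus_divide)
  ultimately show ?thesis using False by simp
qed

lemma eventually_theta_term_bound:
  assumes q: "0 < norm q" "norm q < 1" and z: "(z \<longlongrightarrow> z0) F" "z0 \<noteq> 0"
  shows "\<exists>M. M summable_on UNIV \<and> (\<forall>\<^sub>F y in F. \<forall>r. norm (theta_term q (z y) r) \<le> M r)"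
proof -
  \<comment> \<open>This choice puts |z0| strictly between 1/A and A, so all nearby values share one
    majorant.\<close>
  define A where "A = 2 * norm z0 + 2 / norm z0"
  have A: "A > 0" "norm z0 < A" using z(2) by (auto simp: A_def add_pos_pos)
  have "1 / A < norm z0"
  proof -
    have "A * norm z0 = 2 * (norm z0)\<^sup>2 + 2" using z(2) by (simp add: A_def field_simps power2_eq_square)
    hence "A * norm z0 > 1" by (smt (verit) zero_le_power2)
    thus ?thesis using A by (simp add: field_simps)
  qed
  have "\<forall>\<^sub>F y in F. norm (z y) < A" "\<forall>\<^sub>F y in F. 1 / A < norm (z y)"
    using order_tendstoD[OF tendsto_norm[OF z(1)]] A(2) \<open>1 / A < norm z0\<close> by blast+
  hence "\<forall>\<^sub>F y in F. \<forall>r. norm (theta_term q (z y) r) \<le> A powi \<bar>r\<bar> * norm q powi binom2 r"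
    by eventually_elim (auto simp: norm_theta_term intro!: mult_right_mono power_int_le_abs A)
  thus ?thesis using theta_real_abs_summable[OF A(1) q] by blast
qed

text \<open>For w near w0 the denominators are close to 1 when r is large and large when -r is
  large, uniformly in w, so only finitely many indices need individual bounds. Indices whose
  denominator vanishes at w0 are excluded, which makes the bound usable at a pole.\<close>

lemma eventually_lerch_denom_bound:
  fixes q :: complex
  assumes q: "0 < norm q" "norm q < 1" and w: "(w \<longlongrightarrow> w0) F" "w0 \<noteq> 0"
  shows "\<exists>B>0. \<forall>\<^sub>F y in F. \<forall>r. q powi r * w0 \<noteq> 1 \<longrightarrow> norm (1 / (1 - q powi r * w y)) \<le> B"
proof -
  have q0: "q \<noteq> 0" using q by auto
  have "(\<lambda>n. norm q ^ n * (2 * norm w0)) \<longlonglongrightarrow> 0 * (2 * norm w0)"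
    "(\<lambda>n. norm q ^ n * (2 / norm w0)) \<longlonglongrightarrow> 0 * (2 / norm w0)"
    using q by (intro tendsto_intros LIMSEQ_realpow_zero; simp)+
  hence "\<forall>\<^sub>F n in sequentially. norm q ^ n * (2 * norm w0) < 1/2"
    "\<forall>\<^sub>F n in sequentially. norm q ^ n * (2 / norm w0) < 1/2"
    by (auto dest: order_tendstoD(2)[of _ _ _ "1/2"])
  hence "\<forall>\<^sub>F n in sequentially. norm q ^ n * (2 * norm w0) < 1/2 \<and> norm q ^ n * (2 / norm w0) < 1/2"
    by eventually_elim auto
  then obtain N where N: "\<And>n. n \<ge> N \<Longrightarrow> norm q ^ n * (2 * norm w0) < 1/2"
       "\<And>n. n \<ge> N \<Longrightarrow> norm q ^ n * (2 / norm w0) < 1/2"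
    by (auto simp: eventually_at_top_linorder)
  have far: "\<forall>\<^sub>F y in F. \<forall>r. r \<notin> {- int N..int N} \<longrightarrow> norm (1 / (1 - q powi r * w y)) \<le> 2"
  proof -
    have "\<forall>\<^sub>F y in F. norm (w y) < 2 * norm w0" "\<forall>\<^sub>F y in F. norm w0 / 2 < norm (w y)"
      using order_tendstoD(2)[OF tendsto_norm[OF w(1)], of "2 * norm w0"]
        order_tendstoD(1)[OF tendsto_norm[OF w(1)], of "norm w0 / 2"] w(2) by simp_all
    thus ?thesis
    proof eventually_elim
      case (elim y)
      show ?case
      proof (intro allI impI)
        fix r assume r: "r \<notin> {- int N..int N}"
        have "norm (1 - q powi r * w y) \<ge> 1/2"
        proof (cases "r > 0")
          case True
          then obtain n where n: "r = int n" "n \<ge> N" using r zero_less_imp_eq_int by fastforce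
          have "norm (q powi r * w y) = norm q ^ n * norm (w y)" by (simp add: n norm_mult norm_power)
          also have "\<dots> \<le> norm q ^ n * (2 * norm w0)" using elim by (intro mult_left_mono) auto
          also have "\<dots> < 1/2" using N(1)[OF n(2)] .
          finally show ?thesis using norm_triangle_ineq2[of 1 "q powi r * w y"] by simp
        next
          case False
          then obtain n where n: "r = - int n" "n \<ge> N" using r nonpos_int_cases[of r] by force
          have "norm q ^ n * (2 / norm w0) < 1/2" using N(2)[OF n(2)] .
          hence "4 * norm q ^ n < norm w0" using w(2) by (simp add: field_simps)
          hence "2 * norm q ^ n < norm (w y)" using elim by linarith
          hence "norm (q powi r * w y) > 2"
            using q0 by (simp add: n norm_mult norm_power power_int_minus norm_inverse norm_divide
                divide_inverse[symmetric] mult.commute[of "inverse _"] less_divide_eq)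
          thus ?thesis using norm_triangle_ineq2[of "q powi r * w y" 1] by (simp add: norm_minus_commute)
        qed
        thus "norm (1 / (1 - q powi r * w y)) \<le> 2"
          using le_imp_inverse_le[of "1/2" "norm (1 - q powi r * w y)"]
          by (simp add: norm_divide inverse_eq_divide)
      qed
    qed
  qed
  define E where "E = {r \<in> {- int N..int N}. q powi r * w0 \<noteq> 1}"
  have fE: "finite E" by (rule finite_subset[of _ "{- int N..int N}"]) (auto simp: E_def)
  define B where "B = 2 + (\<Sum>r\<in>E. 1 + norm (1 / (1 - q powi r * w0)))"
  have near: "\<forall>\<^sub>F y in F. \<forall>r\<in>E. norm (1 / (1 - q powi r * w y)) \<le> 1 + norm (1 / (1 - q powi r * w0))"
  proof (rule eventually_ball_finite)
    show "\<forall>r\<in>E. \<forall>\<^sub>F y in F. norm (1 / (1 - q powi r * w y)) \<le> 1 + norm (1 / (1 - q powi r * w0))"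
    proof
      fix r assume "r \<in> E"
      hence "1 - q powi r * w0 \<noteq> 0" by (auto simp: E_def)
      hence "((\<lambda>y. norm (1 / (1 - q powi r * w y))) \<longlongrightarrow> norm (1 / (1 - q powi r * w0))) F"
        by (intro tendsto_intros w)
      from order_tendstoD(2)[OF this, of "1 + norm (1 / (1 - q powi r * w0))"]
      show "\<forall>\<^sub>F y in F. norm (1 / (1 - q powi r * w y)) \<le> 1 + norm (1 / (1 - q powi r * w0))"
        by (auto elim: eventually_mono)
    qed
  qed (rule fE)
  have "\<forall>\<^sub>F y in F. \<forall>r. q powi r * w0 \<noteq> 1 \<longrightarrow> norm (1 / (1 - q powi r * w y)) \<le> B"
    using far near
  proof eventually_elim
    case (elim y)
    show ?case
    proof (intro allI impI)
      fix r assume r: "q powi r * w0 \<noteq> 1"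
      show "norm (1 / (1 - q powi r * w y)) \<le> B"
      proof (cases "r \<in> E")
        case True
        have "1 + norm (1 / (1 - q powi r * w0)) \<le> (\<Sum>r\<in>E. 1 + norm (1 / (1 - q powi r * w0)))"
          using fE True by (intro member_le_sum) (auto intro: add_nonneg_nonneg)
        thus ?thesis using elim(2) True by (force simp: B_def)
      next
        case False
        hence "norm (1 / (1 - q powi r * w y)) \<le> 2" using elim(1) r by (auto simp: E_def)
        moreover have "(\<Sum>r\<in>E. 1 + norm (1 / (1 - q powi r * w0))) \<ge> 0"
          by (intro sum_nonneg add_nonneg_nonneg) auto
        ultimately show ?thesis by (simp add: B_def)
      qed
    qed
  qed
  moreover have "B > 0" unfolding B_def by (intro add_pos_nonneg sum_nonneg add_nonneg_nonneg) auto
  ultimately show ?thesis by blast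
qed

lemma lerch_abs_summable:
  assumes q: "0 < norm q" "norm q < 1" and z: "z \<noteq> 0" and w: "\<And>r. q powi r * w \<noteq> 1"
  shows "(\<lambda>r. norm (theta_term q z r / (1 - q powi r * w))) summable_on UNIV"
proof (cases "w = 0")
  case True
  thus ?thesis using theta_term_abs_summable[OF q z] by simp
next
  case False
  \<comment> \<open>The parameter is constant here; any nontrivial filter would do, since only the
    bound is extracted.\<close>
  have "\<exists>B>0. \<forall>\<^sub>F y in at (0::complex). \<forall>r. q powi r * w \<noteq> 1 \<longrightarrow> norm (1 / (1 - q powi r * w)) \<le> B"
    using eventually_lerch_denom_bound[OF q tendsto_const[of w] False] .
  then obtain B where B: "B > 0" "\<And>r. norm (1 / (1 - q powi r * w)) \<le> B" using w by auto
  show ?thesis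
  proof (rule Infinite_Sum.abs_summable_on_comparison_test')
    show "(\<lambda>r. norm (theta_term q z r) * B) summable_on UNIV"
      by (intro summable_on_cmult_left theta_term_abs_summable q z)
    show "norm (theta_term q z r / (1 - q powi r * w)) \<le> norm (theta_term q z r) * B" for r
      using mult_left_mono[OF B(2)[of r], of "norm (theta_term q z r)"] by (simp add: norm_divide)
  qed
qed

lemma lerch_summable:
  assumes "0 < norm q" "norm q < 1" and "z \<noteq> 0" and "\<And>r. q powi r * w \<noteq> 1"
  shows "(\<lambda>r. theta_term q z r / (1 - q powi r * w)) summable_on UNIV"
  using abs_summable_summable[OF lerch_abs_summable[OF assms]] .

lemma lerch_sum_holomorphic:
  assumes q: "0 < norm q" "norm q < 1" and S: "open S"
    and hol: "w holomorphic_on S" "z holomorphic_on S"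
    and nz: "\<And>y. y \<in> S \<Longrightarrow> w y \<noteq> 0" "\<And>y. y \<in> S \<Longrightarrow> z y \<noteq> 0"
    and gen: "\<And>y r. y \<in> S \<Longrightarrow> q powi r * w y \<noteq> 1"
  shows "(\<lambda>y. lerch_sum q (w y) (z y)) holomorphic_on S"
  unfolding lerch_sum_def
proof (rule holomorphic_on_infsum[OF S])
  show "(\<lambda>y. theta_term q (z y) r / (1 - q powi r * w y)) holomorphic_on S" for r
    unfolding theta_term_def using gen nz by (intro holomorphic_intros hol) auto
  fix y0 assume y0: "y0 \<in> S"
  have c: "(f \<longlongrightarrow> f y0) (nhds y0)" if "f holomorphic_on S" for f
    using holomorphic_on_imp_continuous_on[OF that] S y0
    by (simp add: continuous_on_eq_continuous_at tendsto_nhds_iff isCont_def)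
  obtain M where M: "M summable_on UNIV" "\<forall>\<^sub>F y in nhds y0. \<forall>r. norm (theta_term q (z y) r) \<le> M r"
    using eventually_theta_term_bound[OF q c[OF hol(2)] nz(2)[OF y0]] by blast
  obtain B where B: "B > 0" "\<forall>\<^sub>F y in nhds y0. \<forall>r. norm (1 / (1 - q powi r * w y)) \<le> B"
    using eventually_lerch_denom_bound[OF q c[OF hol(1)] nz(1)[OF y0]] gen[OF y0] by auto
  have "\<forall>\<^sub>F y in nhds y0. \<forall>r. norm (theta_term q (z y) r / (1 - q powi r * w y)) \<le> M r * B"
    using M(2) B(2)
  proof eventually_elim
    case (elim y)
    show ?case
    proof
      fix r
      have "norm (theta_term q (z y) r) * norm (1 / (1 - q powi r * w y)) \<le> M r * B"
        using elim by (intro mult_mono) (auto intro: order_trans[OF norm_ge_zero])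
      thus "norm (theta_term q (z y) r / (1 - q powi r * w y)) \<le> M r * B" by (simp add: norm_divide)
    qed
  qed
  then obtain d where "d > 0" "\<forall>y. dist y y0 < d \<longrightarrow> (\<forall>r. norm (theta_term q (z y) r / (1 - q powi r * w y)) \<le> M r * B)"
    by (auto simp: eventually_nhds_metric)
  thus "\<exists>d>0. \<exists>M. M summable_on UNIV \<and> (\<forall>y\<in>ball y0 d. \<forall>r\<in>UNIV. norm (theta_term q (z y) r / (1 - q powi r * w y)) \<le> M r)"
    using summable_on_cmult_left[OF M(1), of B]
    by (intro exI[of _ d] conjI exI[of _ "\<lambda>r. M r * B"]) (auto simp: dist_commute)
qed

text \<open>After multiplication by the vanishing denominator the series is still dominated: the
  singular term reduces to its numerator, and every other term carries a factor tending to 0. Only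
  one term is singular because the powers of q are distinct.\<close>

lemma lerch_sum_pole:
  assumes q: "0 < norm q" "norm q < 1"
    and lim: "(w \<longlongrightarrow> w0) F" "(z \<longlongrightarrow> z0) F" "F \<noteq> bot" and nz: "z0 \<noteq> 0"
    and pole: "q powi k * w0 = 1" and ev: "\<forall>\<^sub>F y in F. w y \<noteq> w0"
  shows "((\<lambda>y. (1 - q powi k * w y) * lerch_sum q (w y) (z y)) \<longlongrightarrow> theta_term q z0 k) F"
proof -
  have q0: "q \<noteq> 0" using q by auto
  have w0: "w0 \<noteq> 0" using pole by auto
  have other: "q powi r * w0 \<noteq> 1" if "r \<noteq> k" for r
  proof
    assume "q powi r * w0 = 1"
    hence "q powi r = q powi k" using pole w0 by (metis mult_right_cancel)
    thus False using that power_int_inject_complex[OF q] by blast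
  qed
  obtain M where M: "M summable_on UNIV" "\<forall>\<^sub>F y in F. \<forall>r. norm (theta_term q (z y) r) \<le> M r"
    using eventually_theta_term_bound[OF q lim(2) nz] by blast
  obtain B where B: "B > 0" "\<forall>\<^sub>F y in F. \<forall>r. q powi r * w0 \<noteq> 1 \<longrightarrow> norm (1 / (1 - q powi r * w y)) \<le> B"
    using eventually_lerch_denom_bound[OF q lim(1) w0] by auto
  have lim0: "((\<lambda>y. 1 - q powi k * w y) \<longlongrightarrow> 0) F"
    using tendsto_diff[OF tendsto_const[of 1] tendsto_mult_left[OF lim(1), of "q powi k"]] pole by simp
  have "\<forall>\<^sub>F y in F. norm (1 - q powi k * w y) < 1"
    using order_tendstoD(2)[OF tendsto_norm[OF lim0], of 1] by simp
  hence bound: "\<forall>\<^sub>F y in F. \<forall>r\<in>UNIV. norm ((1 - q powi k * w y) * (theta_term q (z y) r / (1 - q powi r * w y))) \<le> M r * (1 + B)"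
    using M(2) B(2)
  proof eventually_elim
    case (elim y)
    show ?case
    proof
      fix r
      have M0: "M r \<ge> 0" using elim(2) norm_ge_zero order_trans by blast
      have "norm ((1 - q powi k * w y) / (1 - q powi r * w y)) \<le> 1 + B"
      proof (cases "r = k")
        case True
        \<comment> \<open>The case split accounts for 0 / 0 = 0, where the quotient is not
          1.\<close>
        thus ?thesis using B(1) by (cases "1 - q powi k * w y = 0") (auto simp: norm_divide)
      next
        case False
        have "norm (1 - q powi k * w y) * norm (1 / (1 - q powi r * w y)) \<le> 1 * B"
          using elim(1,3) other[OF False] by (intro mult_mono) auto
        thus ?thesis by (simp add: norm_divide)
      qed
      hence "norm (theta_term q (z y) r) * norm ((1 - q powi k * w y) / (1 - q powi r * w y)) \<le> M r * (1 + B)"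
        using elim(2) M0 by (intro mult_mono) auto
      thus "norm ((1 - q powi k * w y) * (theta_term q (z y) r / (1 - q powi r * w y))) \<le> M r * (1 + B)"
        by (simp add: norm_mult norm_divide mult_ac)
    qed
  qed
  have tt: "((\<lambda>y. theta_term q (z y) r) \<longlongrightarrow> theta_term q z0 r) F" for r
    unfolding theta_term_def by (intro tendsto_intros lim nz) (use nz in auto)
  have "((\<lambda>y. \<Sum>\<^sub>\<infinity>r. (1 - q powi k * w y) * (theta_term q (z y) r / (1 - q powi r * w y))) \<longlongrightarrow>
      (\<Sum>\<^sub>\<infinity>r. if r = k then theta_term q z0 k else 0)) F"
  proof (rule tendsto_infsum_dominated[OF _ bound summable_on_cmult_left[OF M(1)] lim(3)])
    fix r
    show "((\<lambda>y. (1 - q powi k * w y) * (theta_term q (z y) r / (1 - q powi r * w y))) \<longlongrightarrow>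
        (if r = k then theta_term q z0 k else 0)) F"
    proof (cases "r = k")
      case True
      have "\<forall>\<^sub>F y in F. theta_term q (z y) k = (1 - q powi k * w y) * (theta_term q (z y) k / (1 - q powi k * w y))"
        using ev
      proof eventually_elim
        case (elim y)
        have "q powi k * w y \<noteq> 1" using elim pole q0 by (metis mult_left_cancel power_int_not_zero)
        thus ?case by simp
      qed
      from Lim_transform_eventually[OF tt this] show ?thesis using True by simp
    next
      case False
      have "((\<lambda>y. (1 - q powi k * w y) * (theta_term q (z y) r / (1 - q powi r * w y))) \<longlongrightarrow>
         0 * (theta_term q z0 r / (1 - q powi r * w0))) F"
        using other[OF False] by (intro tendsto_mult[OF lim0] tendsto_intros tt lim) auto
      thus ?thesis using False by simp
    qed
  qed
  also have "(\<Sum>\<^sub>\<infinity>r. if r = k then theta_term q z0 k else 0) = theta_term q z0 k"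
    using infsum_cong_neutral[of UNIV "{k}" "\<lambda>r. if r = k then theta_term q z0 k else 0" "\<lambda>r. theta_term q z0 k"] by simp
  finally show ?thesis unfolding lerch_sum_def infsum_cmult_right' .
qed

section \<open>Functional equations of Lerch sums\<close>

lemma theta_term_Suc: 
  assumes "q \<noteq> 0" "z \<noteq> 0"
  shows "theta_term q z (r + 1) = - (q powi r * z) * theta_term q z r"
  using assms by (simp add: theta_term_def binom2_add power_int_add)

lemma theta_term_mult: "theta_term q (a * z) r = a powi r * theta_term q z r"
  by (simp add: theta_term_def power_int_mult_distrib)

lemma infsum_int_shift: "(\<Sum>\<^sub>\<infinity>r::int. f (r + 1)) = (\<Sum>\<^sub>\<infinity>r. f r)"
  by (rule infsum_reindex_bij_witness[of _ "\<lambda>r. r - 1" "\<lambda>r. r + 1"]) auto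

text \<open>Reindexing by one: the q gained in the denominator moves into w, and the numerator gains
  -q^r z, whose power q^r turns z into q z.\<close>

lemma lerch_sum_shift_both:
  assumes "q \<noteq> 0" "z \<noteq> 0"
  shows "lerch_sum q (q * w) (q * z) = - lerch_sum q w z / z"
proof -
  have "lerch_sum q w z = (\<Sum>\<^sub>\<infinity>r. theta_term q z (r + 1) / (1 - q powi (r + 1) * w))"
    unfolding lerch_sum_def by (rule infsum_int_shift[symmetric])
  also have "\<dots> = (\<Sum>\<^sub>\<infinity>r. - z * (theta_term q (q * z) r / (1 - q powi r * (q * w))))"
    using assms by (intro infsum_cong) (simp add: theta_term_Suc theta_term_mult power_int_add mult_ac)
  also have "\<dots> = - z * lerch_sum q (q * w) (q * z)"
    unfolding lerch_sum_def by (rule infsum_cmult_right')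
  finally show ?thesis using assms by (simp add: field_simps)
qed

text \<open>The relation m(q x, q, z) = 1 - x m(x, q, z), cleared of theta denominators. Termwise it
  is 1 + u/(1-u) = 1/(1-u) with u = q^r w; the parts coming from the 1 sum to a theta function by
  the triple product.\<close>

lemma lerch_sum_shift:
  assumes q: "0 < norm q" "norm q < 1" and z: "z \<noteq> 0" and w: "\<And>r. q powi r * w \<noteq> 1"
  shows "lerch_sum q (q * w) z = jtheta z q - q * w / z * lerch_sum q w z"
proof -
  have q0: "q \<noteq> 0" using q by auto
  have w': "q powi r * (q * w) \<noteq> 1" for r
    using w[of "r + 1"] q0 by (simp add: power_int_add mult_ac)
  have s1: "(theta_term q (z / q) has_sum jtheta (z / q) q) UNIV"
    using jacobi_triple_product[OF q, of "z / q"] z q0 by simp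
  have s2: "((\<lambda>r. w * (theta_term q z r / (1 - q powi r * w))) has_sum w * lerch_sum q w z) UNIV"
    unfolding lerch_sum_def by (intro has_sum_cmult_right has_sum_infsum lerch_summable q z w)
  have e: "theta_term q (z / q) r + w * (theta_term q z r / (1 - q powi r * w)) = 
      (- z / q) * (theta_term q z (r - 1) / (1 - q powi (r - 1) * (q * w)))" for r
  proof -
    define X T where "X = q powi r" and "T = theta_term q z (r - 1)"
    have X: "q powi (r - 1) = X / q" "X \<noteq> 0" using q0 by (simp_all add: power_int_diff X_def)
    have D: "1 - X * w \<noteq> 0" using w[of r] by (auto simp: X_def)
    have a: "theta_term q z r = - (X / q * z) * T"
      using theta_term_Suc[OF q0 z, of "r - 1"] X(1) by (simp add: T_def)
    have "theta_term q (z / q) r = theta_term q z r / X"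
      by (simp add: theta_term_def power_int_divide_distrib X_def)
    hence "theta_term q (z / q) r = (- z / q) * T" using X(2) unfolding a by simp
    moreover have "w * (theta_term q z r / (1 - X * w)) = (- z / q) * T * (X * w / (1 - X * w))"
      unfolding a by simp
    ultimately have "theta_term q (z / q) r + w * (theta_term q z r / (1 - X * w)) =
        (- z / q) * T * (1 + X * w / (1 - X * w))" by (simp only: distrib_left mult_1_right)
    also have "1 + X * w / (1 - X * w) = 1 / (1 - X * w)" using D by (simp add: field_simps)
    finally show ?thesis using q0 unfolding X_def[symmetric] T_def[symmetric] X(1) by simp
  qed
  have "((\<lambda>r. (- z / q) * (theta_term q z (r - 1) / (1 - q powi (r - 1) * (q * w)))) has_sum
     (jtheta (z / q) q + w * lerch_sum q w z)) UNIV"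
    using has_sum_add[OF s1 s2] unfolding e .
  moreover have "((\<lambda>r. (- z / q) * (theta_term q z (r - 1) / (1 - q powi (r - 1) * (q * w)))) has_sum 
      (- z / q) * lerch_sum q (q * w) z) UNIV"
  proof (rule has_sum_cmult_right)
    have "((\<lambda>r. theta_term q z r / (1 - q powi r * (q * w))) has_sum lerch_sum q (q * w) z) UNIV"
      unfolding lerch_sum_def by (intro has_sum_infsum lerch_summable q z w')
    thus "((\<lambda>r. theta_term q z (r - 1) / (1 - q powi (r - 1) * (q * w))) has_sum lerch_sum q (q * w) z) UNIV"
      by (subst has_sum_reindex_bij_witness[of UNIV "\<lambda>r. r + 1" "\<lambda>r. r - 1" UNIV "\<lambda>r. theta_term q z r / (1 - q powi r * (q * w))"]) auto
  qed
  ultimately have "jtheta (z / q) q + w * lerch_sum q w z = (- z / q) * lerch_sum q (q * w) z"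
    by (rule has_sum_unique)
  moreover have "jtheta (z / q) q = (- z / q) * jtheta z q"
    using jtheta_q_mult[OF q, of "z / q"] z q0 by (simp add: field_simps)
  moreover have "(- z / q) * (jtheta z q - q * w / z * lerch_sum q w z) = (- z / q) * jtheta z q + w * lerch_sum q w z"
    using z q0 by (simp add: right_diff_distrib)
  ultimately have "(- z / q) * lerch_sum q (q * w) z = (- z / q) * (jtheta z q - q * w / z * lerch_sum q w z)"
    by (simp only:)
  thus ?thesis using z q0 by simp
qed

section \<open>Hecke-type double sums\<close>

definition hecke_term :: "nat \<Rightarrow> nat \<Rightarrow> nat \<Rightarrow> complex \<Rightarrow> complex \<Rightarrow> complex \<Rightarrow> int \<times> int \<Rightarrow> complex" where
  "hecke_term a b c q x y = (\<lambda>(r, s). (-1) powi (r + s) * x powi r * y powi s *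
        q powi (int a * binom2 r + int b * r * s + int c * binom2 s))"

text \<open>The index set becomes a weight on all pairs of integers, so that a shift of r reindexes
  a sum over the whole lattice and only weights have to be compared.\<close>

definition hecke_sign :: "int \<times> int \<Rightarrow> complex" where
  "hecke_sign = (\<lambda>(r, s). if sg r = sg s then of_int (sg r) else 0)"

lemma hecke_f_altdef:
  "hecke_f a b c x y q = (\<Sum>\<^sub>\<infinity>p. hecke_sign p * hecke_term a b c q x y p)"
  unfolding hecke_f_def by (rule infsum_cong_neutral) (auto simp: hecke_sign_def hecke_term_def mult_ac)

lemma hecke_f_swap: "hecke_f a b c x y q = hecke_f c b a y x q"
  unfolding hecke_f_def
  by (rule infsum_reindex_bij_witness[of _ prod.swap prod.swap]) (auto simp: mult_ac add_ac)

lemma summable_on_product_nonneg: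
  fixes f :: "'a \<Rightarrow> real" and g :: "'b \<Rightarrow> real"
  assumes "f summable_on UNIV" "g summable_on UNIV" "\<And>x. f x \<ge> 0" "\<And>y. g y \<ge> 0"
  shows "(\<lambda>p. f (fst p) * g (snd p)) summable_on UNIV"
proof -
  have "(\<lambda>p. f (fst p) * g (snd p)) summable_on (UNIV \<times> UNIV)"
  proof (rule summable_on_SigmaI)
    show "((\<lambda>y. f (fst (x, y)) * g (snd (x, y))) has_sum f x * infsum g UNIV) UNIV" for x
      using assms(2) by (auto intro!: has_sum_cmult_right)
    show "(\<lambda>x. f x * infsum g UNIV) summable_on UNIV"
      by (intro summable_on_cmult_left assms)
  qed (use assms in auto)
  thus ?thesis by simp
qed

lemma hecke_term_bound:
  assumes q: "0 < norm q" "norm q < 1" and A: "A > 0" "1 / A \<le> norm x" "norm x \<le> A" "1 / A \<le> norm y" "norm y \<le> A"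
  shows "norm (hecke_sign p * hecke_term a b c q x y p) \<le>
     (A powi \<bar>fst p\<bar> * (norm q ^ a) powi binom2 (fst p)) * (A powi \<bar>snd p\<bar> * (norm q ^ c) powi binom2 (snd p))"
proof (cases p)
  case (Pair r s)
  show ?thesis
  proof (cases "sg r = sg s")
    case False
    thus ?thesis using Pair A(1) by (simp add: hecke_sign_def)
  next
    case True
    hence rs: "r * s \<ge> 0" by (auto simp: sg_def zero_le_mult_iff split: if_splits)
    have "norm q powi (int a * binom2 r + int b * r * s + int c * binom2 s) =
        norm q powi (int b * (r * s)) * ((norm q ^ a) powi binom2 r * (norm q ^ c) powi binom2 s)"
      using q by (simp add: power_int_add power_int_power mult_ac)
    also have "\<dots> \<le> 1 * ((norm q ^ a) powi binom2 r * (norm q ^ c) powi binom2 s)"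
      using q rs by (intro mult_right_mono power_int_le_one) auto
    finally have 1: "norm q powi (int a * binom2 r + int b * r * s + int c * binom2 s) \<le>
       (norm q ^ a) powi binom2 r * (norm q ^ c) powi binom2 s" by simp
    have "norm (hecke_sign p * hecke_term a b c q x y p) =
        norm x powi r * norm y powi s * norm q powi (int a * binom2 r + int b * r * s + int c * binom2 s)"
      using True Pair by (simp add: hecke_sign_def hecke_term_def norm_mult norm_power_int sg_def)
    also have "\<dots> \<le> A powi \<bar>r\<bar> * A powi \<bar>s\<bar> * ((norm q ^ a) powi binom2 r * (norm q ^ c) powi binom2 s)"
      using A by (intro mult_mono power_int_le_abs 1) auto
    finally show ?thesis using Pair by (simp add: mult_ac)
  qed
qed

lemma hecke_bound_summable:
  assumes q: "0 < norm (q::complex)" "norm q < 1" and A: "A > 0" and "a > 0" "c > 0"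
  shows "(\<lambda>p. (A powi \<bar>fst p\<bar> * (norm q ^ a) powi binom2 (fst p)) * (A powi \<bar>snd p\<bar> * (norm q ^ c) powi binom2 (snd p)))
     summable_on UNIV"
proof -
  have "0 < norm q ^ a" "norm q ^ a < 1" "0 < norm q ^ c" "norm q ^ c < 1"
    using q assms(4,5) by (auto simp: power_less_one_iff)
  thus ?thesis using A by (intro summable_on_product_nonneg theta_real_abs_summable) auto
qed

lemma ex_annulus:
  assumes "x \<noteq> 0" "y \<noteq> (0::complex)"
  shows "\<exists>A>0. 1 / A < norm x \<and> norm x < A \<and> 1 / A < norm y \<and> norm y < A"
proof -
  define A where "A = norm x + norm y + 1 / norm x + 1 / norm y"
  have A: "A > norm x" "A > norm y" "A > 1 / norm x" "A > 1 / norm y"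
    using assms by (auto simp: A_def add_pos_pos)
  hence "A > 0" by (meson le_less_trans norm_ge_zero)
  moreover have "1 / A < norm x" "1 / A < norm y" using A(3,4) assms \<open>A > 0\<close> by (simp_all add: field_simps)
  ultimately show ?thesis using A by blast
qed

lemma hecke_summable:
  assumes q: "0 < norm q" "norm q < 1" and "x \<noteq> 0" "y \<noteq> 0" and ac: "a > 0" "c > 0"
  shows "(\<lambda>p. hecke_sign p * hecke_term a b c q x y p) summable_on UNIV"
proof -
  obtain A where A: "A > 0" "1 / A < norm x" "norm x < A" "1 / A < norm y" "norm y < A"
    using ex_annulus assms by blast
  show ?thesis
    by (rule abs_summable_summable,
        rule Infinite_Sum.abs_summable_on_comparison_test'[OF hecke_bound_summable[OF q A(1) ac]],
        rule hecke_term_bound[OF q A(1)]) (use A in auto)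
qed

lemma hecke_f_holomorphic:
  assumes q: "0 < norm q" "norm q < 1" and "x \<noteq> 0" and ac: "a > 0" "c > 0"
  shows "(\<lambda>y. hecke_f a b c x y q) holomorphic_on - {0}"
  unfolding hecke_f_altdef
proof (rule holomorphic_on_infsum)
  show "(\<lambda>y. hecke_sign p * hecke_term a b c q x y p) holomorphic_on - {0}" for p
    unfolding hecke_term_def by (cases p) (auto intro!: holomorphic_intros)
  fix y :: complex assume "y \<in> - {0}"
  then obtain A where A: "A > 0" "1 / A < norm x" "norm x < A" "1 / A < norm y" "norm y < A"
    using ex_annulus[of x y] assms by auto
  define d where "d = min (norm y - 1 / A) (A - norm y)"
  have "d > 0" using A by (simp add: d_def)
  moreover have "norm (hecke_sign p * hecke_term a b c q x y' p) \<le>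
     (A powi \<bar>fst p\<bar> * (norm q ^ a) powi binom2 (fst p)) * (A powi \<bar>snd p\<bar> * (norm q ^ c) powi binom2 (snd p))"
    if "y' \<in> ball y d" for y' p
  proof -
    have "norm (y - y') < d" using that by (simp add: dist_norm)
    hence "1 / A \<le> norm y'" "norm y' \<le> A"
      using norm_triangle_ineq2[of y y'] norm_triangle_ineq3[of y y'] by (auto simp: d_def)
    thus ?thesis using A by (intro hecke_term_bound q) auto
  qed
  ultimately show "\<exists>d>0. \<exists>M. M summable_on UNIV \<and> (\<forall>y\<in>ball y d. \<forall>p\<in>UNIV. norm (hecke_sign p * hecke_term a b c q x y p) \<le> M p)"
    using hecke_bound_summable[OF q A(1) ac] by blast
qed auto

text \<open>Shifting r by one changes the weight only on the line r = 0, where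
  \<open>hecke_sign (0, s) - hecke_sign (-1, s)\<close> equals 1 for every s of either sign. Here
  \<open>sg 0 = 1\<close> matters; the leftover is a complete theta series in s.\<close>

lemma hecke_f_shift:
  assumes q: "0 < norm q" "norm q < 1" and xy: "x \<noteq> 0" "y \<noteq> 0" and ac: "a > 0" "c > 0"
  shows "hecke_f a b c x y q = - x * hecke_f a b c (q ^ a * x) (q ^ b * y) q + jtheta y (q ^ c)"
proof -
  have q0: "q \<noteq> 0" using q by auto
  let ?u = "\<lambda>p. hecke_sign p * hecke_term a b c q x y p"
  let ?v = "\<lambda>p. hecke_sign p * hecke_term a b c q (q ^ a * x) (q ^ b * y) p"
  let ?w = "\<lambda>(r, s). hecke_sign (r - 1, s) * hecke_term a b c q x y (r, s)"
  have u: "(?u has_sum hecke_f a b c x y q) UNIV"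
    unfolding hecke_f_altdef by (intro has_sum_infsum hecke_summable q xy ac)
  have "(?v has_sum hecke_f a b c (q ^ a * x) (q ^ b * y) q) UNIV"
    unfolding hecke_f_altdef using q0 xy by (intro has_sum_infsum hecke_summable q ac) auto
  hence v: "((\<lambda>p. - x * ?v p) has_sum - x * hecke_f a b c (q ^ a * x) (q ^ b * y) q) UNIV"
    by (rule has_sum_cmult_right)
  have e: "- x * ?v (r, s) = ?w (r + 1, s)" for r s
  proof -
    have "q powi (int a * binom2 (r + 1) + int b * (r + 1) * s + int c * binom2 s) =
        (q ^ a) powi r * (q ^ b) powi s * q powi (int a * binom2 r + int b * r * s + int c * binom2 s)"
      unfolding power_int_power using q0 by (simp add: binom2_add algebra_simps flip: power_int_add)
    thus ?thesis using xy q0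
      by (simp add: hecke_term_def power_int_mult_distrib power_int_add mult_ac)
  qed
  have e': "- x * ?v (r - 1, s) = ?w (r, s)" for r s using e[of "r - 1" s] by simp
  have w: "(?w has_sum - x * hecke_f a b c (q ^ a * x) (q ^ b * y) q) UNIV"
    using v by (subst has_sum_reindex_bij_witness[of UNIV "\<lambda>(r, s). (r + 1, s)" "\<lambda>(r, s). (r - 1, s)" UNIV "\<lambda>p. - x * ?v p"])
       (use e' in auto)
  have d1: "((\<lambda>p. ?u p - ?w p) has_sum hecke_f a b c x y q - (- x * hecke_f a b c (q ^ a * x) (q ^ b * y) q)) UNIV"
    using has_sum_add[OF u has_sum_uminusI[OF w]] by (simp only: diff_conv_add_uminus)
  have d2: "?u p - ?w p = (if fst p = 0 then theta_term (q ^ c) y (snd p) else 0)" for p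
    by (cases p) (auto simp: hecke_sign_def hecke_term_def theta_term_def sg_def power_int_power mult_ac)
  have d3: "((\<lambda>p. if fst p = 0 then theta_term (q ^ c) y (snd p) else 0) has_sum jtheta y (q ^ c)) UNIV"
  proof -
    have "(theta_term (q ^ c) y has_sum jtheta y (q ^ c)) UNIV"
      using q ac xy by (intro jacobi_triple_product) (auto simp: norm_power power_less_one_iff)
    hence "((\<lambda>p. theta_term (q ^ c) y (snd p)) has_sum jtheta y (q ^ c)) ({0} \<times> UNIV)"
      by (subst has_sum_reindex_bij_witness[of _ "\<lambda>s. (0, s)" snd UNIV "theta_term (q ^ c) y"]) auto
    thus ?thesis by (subst (asm) has_sum_cong_neutral[where T = UNIV and g = "\<lambda>p. if fst p = 0 then theta_term (q ^ c) y (snd p) else 0"]) auto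
  qed
  have "hecke_f a b c x y q - (- x * hecke_f a b c (q ^ a * x) (q ^ b * y) q) = jtheta y (q ^ c)"
    using has_sum_unique[OF d1[unfolded d2] d3] .
  thus ?thesis by (simp add: algebra_simps)
qed

lemma jtheta_q_power_mult:
  assumes "0 < norm q" "norm q < 1" "x \<noteq> 0"
  shows "jtheta (q ^ k * x) q = (-1) ^ k * jtheta x q / (q ^ (k choose 2) * x ^ k)"
  using jtheta_q_powi_mult[OF assms, of "int k"]
  by (simp add: binom2_int power_int_minus_divide field_simps)

lemma lerch_sum_tendsto:
  assumes q: "0 < norm q" "norm q < 1"
    and lim: "(w \<longlongrightarrow> w0) F" "(z \<longlongrightarrow> z0) F" "F \<noteq> bot" and nz: "w0 \<noteq> 0" "z0 \<noteq> 0"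
    and gen: "\<And>r. q powi r * w0 \<noteq> 1"
  shows "((\<lambda>y. lerch_sum q (w y) (z y)) \<longlongrightarrow> lerch_sum q w0 z0) F"
proof -
  obtain M where M: "M summable_on UNIV" "\<forall>\<^sub>F y in F. \<forall>r. norm (theta_term q (z y) r) \<le> M r"
    using eventually_theta_term_bound[OF q lim(2) nz(2)] by blast
  obtain B where B: "B > 0" "\<forall>\<^sub>F y in F. \<forall>r. norm (1 / (1 - q powi r * w y)) \<le> B"
    using eventually_lerch_denom_bound[OF q lim(1) nz(1)] gen by auto
  have bound: "\<forall>\<^sub>F y in F. \<forall>r\<in>UNIV. norm (theta_term q (z y) r / (1 - q powi r * w y)) \<le> M r * B"
    using M(2) B(2)
  proof eventually_elim
    case (elim y)
    show ?case
    proof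
      fix r
      have "norm (theta_term q (z y) r) * norm (1 / (1 - q powi r * w y)) \<le> M r * B"
        using elim by (intro mult_mono) (auto intro: order_trans[OF norm_ge_zero])
      thus "norm (theta_term q (z y) r / (1 - q powi r * w y)) \<le> M r * B" by (simp add: norm_divide)
    qed
  qed
  show ?thesis unfolding lerch_sum_def
  proof (rule tendsto_infsum_dominated[OF _ bound summable_on_cmult_left[OF M(1)] lim(3)])
    show "((\<lambda>y. theta_term q (z y) r / (1 - q powi r * w y)) \<longlongrightarrow> theta_term q z0 r / (1 - q powi r * w0)) F" for r
      unfolding theta_term_def using gen[of r] nz by (intro tendsto_intros lim) auto
  qed
qed

section \<open>Functional equations\<close>

locale hecke_3 =
  fixes q :: complex and n :: nat
  assumes q: "0 < norm q" "norm q < 1" and n: "n > 0"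
begin

text \<open>\<open>M\<close> is the modulus of all Appell--Lerch sums in g, as n ((n+3)^2 - n^2) =
  3n(2n+3). The relations M = Q^n and Q = p^3 govern all shifts; \<mu> rescales the variables so
  that the poles in y satisfy (\<mu> y)^3 = Q^k.\<close>

definition p where "p = q ^ (2 * n + 3)"
definition Q where "Q = q ^ (3 * (2 * n + 3))"
definition M where "M = q ^ (3 * n * (2 * n + 3))"
definition \<mu> where "\<mu> = q ^ (n\<^sup>2 + n)"

lemma q0: "q \<noteq> 0" using q by auto

lemma norm_q_power: "k > 0 \<Longrightarrow> 0 < norm (q ^ k)" "k > 0 \<Longrightarrow> norm (q ^ k) < 1"
  using q by (auto simp: norm_power power_less_one_iff)

lemma p: "0 < norm p" "norm p < 1" and Q: "0 < norm Q" "norm Q < 1" and M: "0 < norm M" "norm M < 1"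
  and qn: "0 < norm (q ^ n)" "norm (q ^ n) < 1"
  unfolding p_def Q_def M_def using n by (intro norm_q_power; simp)+

lemma nz: "p \<noteq> 0" "Q \<noteq> 0" "M \<noteq> 0" "\<mu> \<noteq> 0"
  using q0 by (simp_all add: p_def Q_def M_def \<mu>_def)

lemma Q_eq: "Q = p ^ 3" by (simp add: p_def Q_def flip: power_mult)
lemma M_eq: "M = Q ^ n" by (simp add: M_def Q_def mult_ac flip: power_mult)

text \<open>The factor \<mu>^3 is what n + 3 shifts collect in excess of n shifts; it is also the
  \<mu>^3 in the Lerch parameter of \<open>half\<close>.\<close>

lemma mu_choose: "q ^ (n * ((n + 3) choose 2)) = q ^ (n * (n choose 2)) * \<mu> ^ 3"
proof -
  have "(n + 3) choose 2 = (n choose 2) + (3 * n + 3)" by (simp add: numeral_2_eq_2 numeral_3_eq_3)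
  hence "n * ((n + 3) choose 2) = n * (n choose 2) + (n\<^sup>2 + n) * 3"
    by (simp only: distrib_left power2_eq_square) (simp add: algebra_simps)
  thus ?thesis by (simp add: \<mu>_def flip: power_mult power_add)
qed

text \<open>The two halves of \<open>hecke_g\<close>, multiplied by the theta functions in the denominators
  of the Appell--Lerch sums.\<close>

definition half :: "complex \<Rightarrow> complex \<Rightarrow> complex \<Rightarrow> complex" where
  "half x y z = (\<Sum>t<n. (- y) ^ t * q ^ (n * (t choose 2)) * jtheta (q ^ ((n + 3) * t) * x) (q ^ n) *
     lerch_sum M (y ^ n / x ^ (n + 3) * z / (\<mu> ^ 3 * Q ^ t)) z)"

text \<open>One condition for all denominators of \<open>half x y z\<close>: they involve Q^(n r -
  t), and with 0 \<le> t < n these exponents run once through all integers.\<close>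

definition gen :: "complex \<Rightarrow> complex \<Rightarrow> complex \<Rightarrow> bool" where
  "gen x y z \<longleftrightarrow> (\<forall>k::int. Q powi k * (y ^ n / x ^ (n + 3) * z / \<mu> ^ 3) \<noteq> 1)"

lemma ratio_shift1: "(q ^ (n + 3) * y) ^ n / (q ^ n * x) ^ (n + 3) = y ^ n / x ^ (n + 3)"
proof -
  have "(q ^ (n + 3)) ^ n = (q ^ n) ^ (n + 3)" by (simp add: mult_ac flip: power_mult)
  thus ?thesis using q0 by (simp add: power_mult_distrib)
qed

lemma ratio_shift2: "(q ^ n * y) ^ n / (q ^ (n + 3) * x) ^ (n + 3) = y ^ n / x ^ (n + 3) / Q"
proof -
  have "(q ^ (n + 3)) ^ (n + 3) = (q ^ n) ^ n * Q"
    by (simp add: Q_def algebra_simps flip: power_mult power_add)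
  thus ?thesis using q0 by (simp add: power_mult_distrib field_simps)
qed

lemma gen_shift1: "gen (q ^ n * x) (q ^ (n + 3) * y) z \<longleftrightarrow> gen x y z"
  unfolding gen_def ratio_shift1 ..

lemma gen_shift2: "gen (q ^ (n + 3) * x) (q ^ n * y) z \<longleftrightarrow> gen x y z"
proof -
  have e: "Q powi k * (y ^ n / x ^ (n + 3) / Q * z / \<mu> ^ 3) = Q powi (k - 1) * (y ^ n / x ^ (n + 3) * z / \<mu> ^ 3)" for k
    using nz by (simp add: power_int_diff)
  have "(\<forall>k. P (k - 1)) \<longleftrightarrow> (\<forall>k. P k)" for P :: "int \<Rightarrow> bool" by (metis add_diff_cancel_right')
  thus ?thesis unfolding gen_def ratio_shift2 e .
qed

text \<open>Holds term by term: the Lerch parameters are unchanged, and the power q^((n+3)t) gained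
  by (-y)^t cancels against the theta multiplier, leaving -1/x.\<close>

lemma half_shift1:
  assumes "x \<noteq> 0"
  shows "half x y z = - x * half (q ^ n * x) (q ^ (n + 3) * y) z"
  unfolding half_def ratio_shift1 sum_distrib_left
proof (rule sum.cong)
  fix t
  have "jtheta (q ^ ((n + 3) * t) * (q ^ n * x)) (q ^ n) = - jtheta (q ^ ((n + 3) * t) * x) (q ^ n) / (q ^ ((n + 3) * t) * x)"
    using jtheta_q_mult[OF qn, of "q ^ ((n + 3) * t) * x"] assms q0 by (simp add: mult_ac)
  moreover have "(- (q ^ (n + 3) * y)) ^ t = q ^ ((n + 3) * t) * (- y) ^ t"
    by (simp only: minus_mult_right power_mult_distrib power_mult)
  ultimately show "(- y) ^ t * q ^ (n * (t choose 2)) * jtheta (q ^ ((n + 3) * t) * x) (q ^ n) *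
        lerch_sum M (y ^ n / x ^ (n + 3) * z / (\<mu> ^ 3 * Q ^ t)) z =
     - x * ((- (q ^ (n + 3) * y)) ^ t * q ^ (n * (t choose 2)) * jtheta (q ^ ((n + 3) * t) * (q ^ n * x)) (q ^ n) *
        lerch_sum M (y ^ n / x ^ (n + 3) * z / (\<mu> ^ 3 * Q ^ t)) z)"
    using assms q0 by (simp only:) simp
qed simp

text \<open>The shift moves summand t to t + 1, so the difference telescopes to the summands 0 and
  n. As Q^n = M, their Lerch parameters differ by the factor M, and \<open>lerch_sum_shift\<close>
  evaluates the difference.\<close>

lemma half_shift2:
  assumes "x \<noteq> 0" "z \<noteq> 0" "gen x y z"
  shows "half x y z = - y * half (q ^ (n + 3) * x) (q ^ n * y) z + jtheta z M * jtheta x (q ^ n)"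
proof -
  define W where "W = y ^ n / x ^ (n + 3) * z / \<mu> ^ 3"
  define h where "h = (\<lambda>t. (- y) ^ t * q ^ (n * (t choose 2)) * jtheta (q ^ ((n + 3) * t) * x) (q ^ n) *
     lerch_sum M (W / Q ^ t) z)"
  have h: "half x y z = (\<Sum>t<n. h t)"
    unfolding half_def h_def W_def by (simp add: mult_ac)
  have "- y * half (q ^ (n + 3) * x) (q ^ n * y) z = (\<Sum>t<n. h (Suc t))"
    unfolding half_def ratio_shift2 sum_distrib_left
  proof (rule sum.cong)
    fix t
    have "Suc t choose 2 = t + (t choose 2)" by (simp add: numeral_2_eq_2)
    moreover have "(- (q ^ n * y)) ^ t = q ^ (n * t) * (- y) ^ t"
      by (simp only: minus_mult_right power_mult_distrib power_mult)
    ultimately have "(- y) ^ Suc t * q ^ (n * (Suc t choose 2)) = - y * ((- (q ^ n * y)) ^ t * q ^ (n * (t choose 2)))"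
      by (simp add: distrib_left power_add)
    moreover have "q ^ ((n + 3) * t) * (q ^ (n + 3) * x) = q ^ ((n + 3) * Suc t) * x"
      by (simp add: power_add mult_ac)
    moreover have "y ^ n / x ^ (n + 3) / Q * z / (\<mu> ^ 3 * Q ^ t) = W / Q ^ Suc t"
      by (simp add: W_def)
    ultimately show "- y * ((- (q ^ n * y)) ^ t * q ^ (n * (t choose 2)) * jtheta (q ^ ((n + 3) * t) * (q ^ (n + 3) * x)) (q ^ n) *
      lerch_sum M (y ^ n / x ^ (n + 3) / Q * z / (\<mu> ^ 3 * Q ^ t)) z) = h (Suc t)"
      unfolding h_def by (simp only: mult.assoc)
  qed simp
  hence "half x y z - (- y * half (q ^ (n + 3) * x) (q ^ n * y) z) = h 0 - h n"
    unfolding h using sum.lessThan_Suc[of h n] sum.lessThan_Suc_shift[of h n] by (simp add: algebra_simps)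
  also have "h 0 - h n = jtheta z M * jtheta x (q ^ n)"
  proof -
    have WM: "M powi r * (W / M) \<noteq> 1" for r
    proof -
      have "M powi r * (W / M) = Q powi (int n * (r - 1)) * W"
        using nz by (simp add: M_eq power_int_diff flip: power_int_power)
      thus ?thesis using assms(3) unfolding gen_def W_def[symmetric] by metis
    qed
    have l: "lerch_sum M W z = jtheta z M - W / z * lerch_sum M (W / M) z"
      using lerch_sum_shift[OF M assms(2) WM] nz by simp
    have "jtheta (q ^ ((n + 3) * n) * x) (q ^ n) = (-1) ^ (n + 3) * jtheta x (q ^ n) / ((q ^ n) ^ ((n + 3) choose 2) * x ^ (n + 3))"
      using jtheta_q_power_mult[OF qn assms(1), of "n + 3"] by (simp add: power_mult mult.commute)
    moreover have "(q ^ n) ^ ((n + 3) choose 2) = q ^ (n * (n choose 2)) * \<mu> ^ 3"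
      using mu_choose by (simp only: power_mult)
    \<comment> \<open>The n + 3 theta shifts produce exactly the coefficient W / z of
      \<open>lerch_sum_shift\<close>; the odd total n + (n + 3) of signs gives the minus.\<close>
    ultimately have "(- y) ^ n * q ^ (n * (n choose 2)) * jtheta (q ^ ((n + 3) * n) * x) (q ^ n) =
        - (y ^ n / x ^ (n + 3) / \<mu> ^ 3) * jtheta x (q ^ n)"
      using q0 nz assms(1) by (simp add: power_minus[of y] power_add field_simps)
    also have "y ^ n / x ^ (n + 3) / \<mu> ^ 3 = W / z" using assms(2) by (simp add: W_def)
    finally have "h n = - (W / z) * jtheta x (q ^ n) * lerch_sum M (W / M) z"
      by (simp add: h_def M_eq)
    moreover have "h 0 = jtheta x (q ^ n) * lerch_sum M W z" by (simp add: h_def binomial_eq_0)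
    ultimately show ?thesis unfolding l by (simp add: algebra_simps)
  qed
  finally show ?thesis by (simp add: algebra_simps)
qed

lemma half_z_shift:
  assumes "z \<noteq> 0"
  shows "half x y (M * z) = - half x y z / z"
proof -
  have "lerch_sum M (y ^ n / x ^ (n + 3) * (M * z) / (\<mu> ^ 3 * Q ^ t)) (M * z) =
     - lerch_sum M (y ^ n / x ^ (n + 3) * z / (\<mu> ^ 3 * Q ^ t)) z / z" for t
    using lerch_sum_shift_both[OF nz(3) assms, of "y ^ n / x ^ (n + 3) * z / (\<mu> ^ 3 * Q ^ t)"] by (simp add: mult_ac)
  thus ?thesis unfolding half_def by (simp add: sum_divide_distrib sum_negf)
qed

text \<open>For \<open>jtheta z M \<noteq> 0\<close> this is \<open>jtheta z M\<close> times the difference of \<open>hecke_f\<close> and \<open>hecke_g\<close>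
  at \<open>z1 = z\<close>, \<open>z0 = 1 / z\<close>; the factor \<open>- z\<close> is \<open>jtheta z M / jtheta (1 / z) M\<close>. As \<open>z\<close> is
  independent of \<open>x\<close> and \<open>y\<close>, both functional equations are homogeneous.\<close>

definition F0 :: "complex \<Rightarrow> complex \<Rightarrow> complex \<Rightarrow> complex" where
  "F0 x y z = jtheta z M * hecke_f n (n + 3) n x y q - (- z * half x y (1 / z) + half y x z)"

text \<open>The inhomogeneous terms of the double sum and of \<open>half y x z\<close> are both
  \<open>jtheta z M * jtheta y (q ^ n)\<close> and cancel.\<close>

lemma F0_shift1:
  assumes "x \<noteq> 0" "y \<noteq> 0" "z \<noteq> 0" "gen y x z"
  shows "F0 x y z = - x * F0 (q ^ n * x) (q ^ (n + 3) * y) z"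
  unfolding F0_def half_shift1[OF assms(1), of y] half_shift2[OF assms(2-4)]
    hecke_f_shift[OF q assms(1,2) n n]
  by (simp add: algebra_simps)

text \<open>The same cancellation with the halves exchanged; -z j(1/z; M) = j(z; M) makes the theta
  factors match.\<close>

lemma F0_shift2:
  assumes "x \<noteq> 0" "y \<noteq> 0" "z \<noteq> 0" "gen x y (1 / z)"
  shows "F0 x y z = - y * F0 (q ^ (n + 3) * x) (q ^ n * y) z"
proof -
  have z: "1 / z \<noteq> 0" using assms by simp
  have f: "hecke_f n (n + 3) n x y q = - y * hecke_f n (n + 3) n (q ^ (n + 3) * x) (q ^ n * y) q + jtheta x (q ^ n)"
    using hecke_f_shift[OF q assms(2,1) n n] hecke_f_swap by metis
  show ?thesis
    unfolding F0_def half_shift1[OF assms(2), of x] half_shift2[OF assms(1) z assms(4)] f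
      jtheta_inverse[OF M assms(3)]
    using assms(3) by (simp add: algebra_simps)
qed

lemma F0_z_shift:
  assumes "z \<noteq> 0"
  shows "F0 x y (M * z) = - F0 x y z / z"
proof -
  have "half x y (1 / z) = - (M * z) * half x y (1 / (M * z))"
    using half_z_shift[of "1 / (M * z)" x y] assms nz by simp
  hence "- (M * z) * half x y (1 / (M * z)) = - (- z * half x y (1 / z)) / z" using assms by simp
  thus ?thesis unfolding F0_def half_z_shift[OF assms] jtheta_q_mult[OF M assms]
    using assms by (simp add: field_simps)
qed

text \<open>Genericity at the shifted point is carried along because the induction step applies
  \<open>F0_shift1\<close> there.\<close>

lemma F0_shift1_iterate:
  assumes "x \<noteq> 0" "y \<noteq> 0" "z \<noteq> 0" "gen y x z"
  shows "F0 x y z = (- x) ^ l * q ^ (n * (l choose 2)) * F0 (q ^ (n * l) * x) (q ^ ((n + 3) * l) * y) z \<and>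
     gen (q ^ ((n + 3) * l) * y) (q ^ (n * l) * x) z"
proof (induction l)
  case (Suc l)
  have e: "q ^ (n * Suc l) * x = q ^ n * (q ^ (n * l) * x)" "q ^ ((n + 3) * Suc l) * y = q ^ (n + 3) * (q ^ ((n + 3) * l) * y)"
    by (simp_all add: power_add mult_ac)
  have g: "gen (q ^ ((n + 3) * Suc l) * y) (q ^ (n * Suc l) * x) z" unfolding e gen_shift2 using Suc by blast
  have "Suc l choose 2 = l + (l choose 2)" by (simp add: numeral_2_eq_2)
  hence c: "(- x) ^ Suc l * q ^ (n * (Suc l choose 2)) = (- x) ^ l * q ^ (n * (l choose 2)) * - (q ^ (n * l) * x)"
    by (simp add: distrib_left power_add)
  have "F0 (q ^ (n * l) * x) (q ^ ((n + 3) * l) * y) z = - (q ^ (n * l) * x) * F0 (q ^ (n * Suc l) * x) (q ^ ((n + 3) * Suc l) * y) z"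
    unfolding e using Suc assms q0 by (intro F0_shift1) auto
  thus ?case using Suc g unfolding c by (simp only: mult.assoc)
qed (use assms in \<open>simp add: binomial_eq_0\<close>)

lemma F0_shift2_iterate:
  assumes "x \<noteq> 0" "y \<noteq> 0" "z \<noteq> 0" "gen x y (1 / z)"
  shows "F0 x y z = (- y) ^ l * q ^ (n * (l choose 2)) * F0 (q ^ ((n + 3) * l) * x) (q ^ (n * l) * y) z \<and>
     gen (q ^ ((n + 3) * l) * x) (q ^ (n * l) * y) (1 / z)"
proof (induction l)
  case (Suc l)
  have e: "q ^ (n * Suc l) * y = q ^ n * (q ^ (n * l) * y)" "q ^ ((n + 3) * Suc l) * x = q ^ (n + 3) * (q ^ ((n + 3) * l) * x)"
    by (simp_all add: power_add mult_ac)
  have g: "gen (q ^ ((n + 3) * Suc l) * x) (q ^ (n * Suc l) * y) (1 / z)" unfolding e gen_shift2 using Suc by blast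
  have "Suc l choose 2 = l + (l choose 2)" by (simp add: numeral_2_eq_2)
  hence c: "(- y) ^ Suc l * q ^ (n * (Suc l choose 2)) = (- y) ^ l * q ^ (n * (l choose 2)) * - (q ^ (n * l) * y)"
    by (simp add: distrib_left power_add)
  have "F0 (q ^ ((n + 3) * l) * x) (q ^ (n * l) * y) z = - (q ^ (n * l) * y) * F0 (q ^ ((n + 3) * Suc l) * x) (q ^ (n * Suc l) * y) z"
    unfolding e using Suc assms q0 by (intro F0_shift2) auto
  thus ?case using Suc g unfolding c by (simp only: mult.assoc)
qed (use assms in \<open>simp add: binomial_eq_0\<close>)

section \<open>Restriction to the diagonal z = y^n / x^n\<close>

lemma not_Q_power_iff:
  assumes "x \<noteq> 0"
  shows "jtheta ((\<mu> * x) ^ 3) Q \<noteq> 0 \<longleftrightarrow> (\<forall>k::int. Q powi k / (\<mu> * x) ^ 3 \<noteq> 1)"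
  using jtheta_eq_0_iff[OF Q, of "(\<mu> * x) ^ 3"] assms nz by (simp add: eq_commute[of "Q powi _"])

lemma gen_diag:
  assumes "x \<noteq> 0" "y \<noteq> 0"
  shows "gen x y (x ^ n / y ^ n) \<longleftrightarrow> jtheta ((\<mu> * x) ^ 3) Q \<noteq> 0"
proof -
  have "y ^ n / x ^ (n + 3) * (x ^ n / y ^ n) / \<mu> ^ 3 = 1 / (\<mu> * x) ^ 3"
    using assms by (simp add: power_add power_mult_distrib)
  thus ?thesis unfolding gen_def not_Q_power_iff[OF assms(1)] by simp
qed

text \<open>On the diagonal the Lerch parameters depend on the first argument only. As a function of
  y, \<open>S x y\<close> therefore has no poles off 0, and those of the halves come from
  \<open>S y x\<close>.\<close>

definition S :: "complex \<Rightarrow> complex \<Rightarrow> complex" where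
  "S x y = (\<Sum>t<n. (- y) ^ t * q ^ (n * (t choose 2)) * jtheta (q ^ ((n + 3) * t) * x) (q ^ n) *
     lerch_sum M (1 / ((\<mu> * x) ^ 3 * Q ^ t)) (x ^ n / y ^ n))"

lemma half_diag:
  assumes "x \<noteq> 0" "y \<noteq> 0"
  shows "half x y (x ^ n / y ^ n) = S x y"
proof -
  have e: "y ^ n / x ^ (n + 3) * (x ^ n / y ^ n) / (\<mu> ^ 3 * Q ^ t) = 1 / ((\<mu> * x) ^ 3 * Q ^ t)" for t
    using assms by (simp add: power_add power_mult_distrib)
  show ?thesis unfolding half_def S_def e ..
qed

definition G0 :: "complex \<Rightarrow> complex \<Rightarrow> complex" where
  "G0 x y = jtheta (y ^ n / x ^ n) M * hecke_f n (n + 3) n x y q - (- (y ^ n / x ^ n) * S x y + S y x)"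

lemma G0_eq_F0:
  assumes "x \<noteq> 0" "y \<noteq> 0"
  shows "G0 x y = F0 x y (y ^ n / x ^ n)"
  using half_diag[OF assms] half_diag[OF assms(2,1)] by (simp add: G0_def F0_def)

text \<open>Two routes meet: n shifts of the second kind from (x, Q y) and n + 3 of the first kind
  from (x, y), because n^2 + 3(2n+3) = (n+3)^2. Meanwhile z is held fixed; \<open>F0_z_shift\<close>
  accounts for the diagonal value M z belonging to Q y.\<close>

lemma G0_Q_shift:
  assumes xy: "x \<noteq> 0" "y \<noteq> 0" and g: "jtheta ((\<mu> * x) ^ 3) Q \<noteq> 0" "jtheta ((\<mu> * y) ^ 3) Q \<noteq> 0"
  shows "G0 x (Q * y) = M / (\<mu> * x) ^ 3 * G0 x y"
proof -
  define z where "z = y ^ n / x ^ n"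
  have z: "z \<noteq> 0" "1 / z = x ^ n / y ^ n" using xy by (simp_all add: z_def)
  have "(Q * y) ^ n / x ^ n = M * z" by (simp add: z_def M_eq power_mult_distrib)
  hence 1: "G0 x (Q * y) = - F0 x (Q * y) z / z"
    using G0_eq_F0[of x "Q * y"] F0_z_shift[OF z(1)] xy nz by simp
  have gx: "gen x (Q * y) (1 / z)"
  proof -
    have "Q powi k * ((Q * y) ^ n / x ^ (n + 3) * (1 / z) / \<mu> ^ 3) =
        Q powi (k + int n) * (y ^ n / x ^ (n + 3) * (1 / z) / \<mu> ^ 3)" for k
      using nz by (simp add: power_int_add power_mult_distrib)
    moreover have "gen x y (1 / z)" using g(1) gen_diag[OF xy] z by simp
    ultimately show ?thesis unfolding gen_def by metis
  qed
  have gy: "gen y x z" using gen_diag[OF xy(2,1)] g by (simp add: z_def)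
  have pts: "q ^ (n * n) * (Q * y) = q ^ ((n + 3) * (n + 3)) * y" "q ^ ((n + 3) * n) = q ^ (n * (n + 3))"
    by (simp_all add: Q_def algebra_simps flip: power_add)
  define E where "E = F0 (q ^ (n * (n + 3)) * x) (q ^ ((n + 3) * (n + 3)) * y) z"
  have "(- (Q * y)) ^ n = (-1) ^ n * (M * y ^ n)"
    by (simp add: power_minus[of "Q * y"] M_eq power_mult_distrib)
  hence F1: "F0 x (Q * y) z = (-1) ^ n * (M * y ^ n) * q ^ (n * (n choose 2)) * E"
    using F0_shift2_iterate[OF xy(1) _ z(1) gx, of n] xy nz unfolding pts E_def by simp
  have "(- x) ^ (n + 3) = - ((-1) ^ n) * x ^ (n + 3)"
    by (subst power_minus) (simp add: power_add)
  hence F2: "F0 x y z = - ((-1) ^ n) * x ^ (n + 3) * (q ^ (n * (n choose 2)) * \<mu> ^ 3) * E"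
    using F0_shift1_iterate[OF xy z(1) gy, of "n + 3"] unfolding E_def mu_choose by simp
  have "(-1) ^ n * (m * Y) * k * E = - (m * Y / (X * u)) * (- ((-1) ^ n) * X * (k * u) * E)"
    if "X \<noteq> 0" "u \<noteq> 0" for m Y k E X u :: complex using that by simp
  hence "F0 x (Q * y) z = - (M * y ^ n / (x ^ (n + 3) * \<mu> ^ 3)) * F0 x y z"
    unfolding F1 F2 using xy nz power_not_zero by blast
  thus ?thesis unfolding 1 G0_eq_F0[OF xy] z_def[symmetric] using xy nz z(1)
    by (simp add: z_def power_add power_mult_distrib)
qed

text \<open>One shift of each kind multiplies both variables by q^n q^(n+3) = p, so y/x and the
  diagonal value of z do not change.\<close>

lemma G0_p_shift:
  assumes xy: "x \<noteq> 0" "y \<noteq> 0" and g: "jtheta ((\<mu> * x) ^ 3) Q \<noteq> 0" "jtheta ((\<mu> * y) ^ 3) Q \<noteq> 0"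
  shows "G0 x y = x * y * q ^ (n + 3) * G0 (p * x) (p * y)"
proof -
  define z where "z = y ^ n / x ^ n"
  have z: "z \<noteq> 0" "1 / z = x ^ n / y ^ n" using xy by (simp_all add: z_def)
  have "(p * y) ^ n / (p * x) ^ n = z" using nz by (simp add: z_def power_mult_distrib)
  hence 1: "G0 (p * x) (p * y) = F0 (p * x) (p * y) z"
    using G0_eq_F0[of "p * x" "p * y"] xy nz by simp
  have gy: "gen y x z" using gen_diag[OF xy(2,1)] g by (simp add: z_def)
  have gx: "gen (q ^ n * x) (q ^ (n + 3) * y) (1 / z)"
    unfolding gen_shift1 using g(1) gen_diag[OF xy] z by simp
  have "q ^ (n + 3) * q ^ n = p" "q ^ n * q ^ (n + 3) = p"
    unfolding p_def power_add[symmetric] by (rule arg_cong[of _ _ "\<lambda>k. q ^ k"]; simp)+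
  hence pts: "q ^ (n + 3) * (q ^ n * x) = p * x" "q ^ n * (q ^ (n + 3) * y) = p * y"
    by (simp_all flip: mult.assoc)
  have "F0 x y z = - x * F0 (q ^ n * x) (q ^ (n + 3) * y) z"
    by (rule F0_shift1[OF xy z(1) gy])
  also have "F0 (q ^ n * x) (q ^ (n + 3) * y) z = - (q ^ (n + 3) * y) * F0 (p * x) (p * y) z"
    using F0_shift2[OF _ _ z(1) gx] xy q0 unfolding pts by simp
  finally show ?thesis unfolding 1 G0_eq_F0[OF xy] z_def[symmetric] by simp
qed

section \<open>The theta correction\<close>

text \<open>The braces of \<Theta> in the variables X = \<mu> x and Y = \<mu> y; the prefactors of
  the theta arguments there are \<mu>^3 p and \<mu>^3 p^2.\<close>

definition theta_bracket :: "complex \<Rightarrow> complex \<Rightarrow> complex" where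
  "theta_bracket X Y = jtheta (p * X\<^sup>2 * Y) Q * jtheta (p * X * Y\<^sup>2) Q
     - X * Y * jtheta (p\<^sup>2 * X\<^sup>2 * Y) Q * jtheta (p\<^sup>2 * X * Y\<^sup>2) Q"

definition theta_quot :: "complex \<Rightarrow> complex \<Rightarrow> complex" where
  "theta_quot X Y = X * Y ^ n * jtheta (Y / X) Q * jtheta X p * jtheta Y p * theta_bracket X Y / (jtheta (X ^ 3) Q * jtheta (Y ^ 3) Q)"

text \<open>The power \<mu>^(n+1) compensates for writing X Y^n in place of x y^n.\<close>

definition theta_const :: complex where
  "theta_const = - ((-1) ^ n) * q ^ (n * ((n + 1) choose 2)) * Jtheta (3 * n) q * Jtheta (3 * (2 * n + 3)) q
      / ((Jtheta (2 * n + 3) q)\<^sup>2 * \<mu> ^ (n + 1))"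

definition theta_corr :: "complex \<Rightarrow> complex \<Rightarrow> complex" where
  "theta_corr x y = theta_const * theta_quot (\<mu> * x) (\<mu> * y)"

lemma Theta3_eq:
  assumes "x \<noteq> 0" "jtheta (y ^ n / x ^ n) M \<noteq> 0"
  shows "Theta3 n x y q * jtheta (y ^ n / x ^ n) M = theta_corr x y"
proof -
  have e: "q ^ (3 * n\<^sup>2 + 3 * n) = \<mu> ^ 3" "q ^ (3 * n\<^sup>2 + 5 * n + 3) = \<mu> ^ 3 * p"
    "q ^ (3 * n\<^sup>2 + 7 * n + 6) = \<mu> ^ 3 * p\<^sup>2" "q ^ (2 * n\<^sup>2 + 2 * n) = \<mu>\<^sup>2"
    by (simp_all add: \<mu>_def p_def algebra_simps flip: power_mult power_add)
  have m: "\<mu> ^ 3 * x ^ 3 = (\<mu> * x) ^ 3" "\<mu> ^ 3 * y ^ 3 = (\<mu> * y) ^ 3"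
    "\<mu> ^ 3 * p * x\<^sup>2 * y = p * (\<mu> * x)\<^sup>2 * (\<mu> * y)" "\<mu> ^ 3 * p * x * y\<^sup>2 = p * (\<mu> * x) * (\<mu> * y)\<^sup>2"
    "\<mu> ^ 3 * p\<^sup>2 * x\<^sup>2 * y = p\<^sup>2 * (\<mu> * x)\<^sup>2 * (\<mu> * y)" "\<mu> ^ 3 * p\<^sup>2 * x * y\<^sup>2 = p\<^sup>2 * (\<mu> * x) * (\<mu> * y)\<^sup>2"
    "\<mu>\<^sup>2 * x * y = (\<mu> * x) * (\<mu> * y)" "y / x = (\<mu> * y) / (\<mu> * x)"
    using nz by (simp_all add: power_mult_distrib power2_eq_square power3_eq_cube)
  have s: "(- x) * (- y) ^ n = - ((-1) ^ n) * (\<mu> * x) * (\<mu> * y) ^ n / \<mu> ^ (n + 1)"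
    using nz by (simp add: power_minus[of y] power_mult_distrib)
  have "Theta3 n x y q =
      (q ^ (n * ((n + 1) choose 2)) * ((- x) * (- y) ^ n) *
        Jtheta (3 * n) q * Jtheta (3 * (2 * n + 3)) q * jtheta ((\<mu> * y) / (\<mu> * x)) Q *
        jtheta (\<mu> * x) p * jtheta (\<mu> * y) p)
       / ((Jtheta (2 * n + 3) q)\<^sup>2 * jtheta (y ^ n / x ^ n) M *
       jtheta ((\<mu> * x) ^ 3) Q * jtheta ((\<mu> * y) ^ 3) Q) * theta_bracket (\<mu> * x) (\<mu> * y)"
    unfolding Theta3_def Theta3_denom_def Let_def Q_def[symmetric] M_def[symmetric] p_def[symmetric]
      \<mu>_def[symmetric] e m theta_bracket_def by (simp only: mult.assoc)
  moreover have "(a * (s * X * Y / m) * j1 * j2 * j3 * j4 * j5) / (d * z * e * f) * b * z =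
      s * a * j1 * j2 / (d * m) * (X * Y * j3 * j4 * j5 * b / (e * f))" if "z \<noteq> 0"
    for a s X Y m j1 j2 j3 j4 j5 d z e f b :: complex
    using that by (simp add: mult_ac)
  ultimately show ?thesis using assms(2) unfolding s theta_corr_def theta_const_def theta_quot_def by presburger
qed

text \<open>Both products must acquire the same multiplier: p^2 in place of p costs an extra factor
  p^3 = Q in the denominator, which the prefactor X Y of the second product restores.\<close>

lemma theta_bracket_Q_shift:
  assumes "X \<noteq> 0" "Y \<noteq> 0"
  shows "theta_bracket X (Q * Y) = - theta_bracket X Y / (Q\<^sup>2 * X ^ 4 * Y ^ 5)"
proof -
  have J: "jtheta (Q * z) Q = - jtheta z Q / z" if "z \<noteq> 0" for z
    by (rule jtheta_q_mult[OF Q that])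
  have 1: "jtheta (P * X\<^sup>2 * (Q * Y)) Q = - jtheta (P * X\<^sup>2 * Y) Q / (P * X\<^sup>2 * Y)" if "P \<noteq> 0" for P
    using J[of "P * X\<^sup>2 * Y"] that assms by (simp add: mult_ac)
  have 2: "jtheta (P * X * (Q * Y)\<^sup>2) Q = jtheta (P * X * Y\<^sup>2) Q / (Q * (P * X * Y\<^sup>2)\<^sup>2)" if "P \<noteq> 0" for P
  proof -
    have "P * X * (Q * Y)\<^sup>2 = Q * (Q * (P * X * Y\<^sup>2))" by (simp add: power2_eq_square mult_ac)
    thus ?thesis using J[of "Q * (P * X * Y\<^sup>2)"] J[of "P * X * Y\<^sup>2"] that assms nz
      by (simp add: power2_eq_square mult_ac)
  qed
  have "jtheta (p * X\<^sup>2 * (Q * Y)) Q * jtheta (p * X * (Q * Y)\<^sup>2) Q =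
      - (jtheta (p * X\<^sup>2 * Y) Q * jtheta (p * X * Y\<^sup>2) Q) / (Q\<^sup>2 * X ^ 4 * Y ^ 5)"
    unfolding 1[OF nz(1)] 2[OF nz(1)] by (simp add: Q_eq eval_nat_numeral mult_ac)
  moreover have p2: "p\<^sup>2 \<noteq> 0" using nz by simp
  have "X * (Q * Y) * jtheta (p\<^sup>2 * X\<^sup>2 * (Q * Y)) Q * jtheta (p\<^sup>2 * X * (Q * Y)\<^sup>2) Q =
      - (X * Y * jtheta (p\<^sup>2 * X\<^sup>2 * Y) Q * jtheta (p\<^sup>2 * X * Y\<^sup>2) Q) / (Q\<^sup>2 * X ^ 4 * Y ^ 5)"
    unfolding 1[OF p2] 2[OF p2] using nz assms by (simp add: Q_eq eval_nat_numeral mult_ac)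
  ultimately show ?thesis unfolding theta_bracket_def by (simp add: diff_divide_distrib)
qed

text \<open>Every theta argument has total degree 3 in X and Y, so it is multiplied by p^3 =
  Q.\<close>

lemma theta_bracket_p_shift:
  assumes "X \<noteq> 0" "Y \<noteq> 0"
  shows "theta_bracket (p * X) (p * Y) = theta_bracket X Y / (p\<^sup>2 * X ^ 3 * Y ^ 3)"
proof -
  have J: "jtheta (Q * z) Q = - jtheta z Q / z" if "z \<noteq> 0" for z
    by (rule jtheta_q_mult[OF Q that])
  have 1: "jtheta (P * (p * X)\<^sup>2 * (p * Y)) Q = - jtheta (P * X\<^sup>2 * Y) Q / (P * X\<^sup>2 * Y)" if "P \<noteq> 0" for P
    using J[of "P * X\<^sup>2 * Y"] that assms by (simp add: Q_eq power2_eq_square power3_eq_cube mult_ac)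
  have 2: "jtheta (P * (p * X) * (p * Y)\<^sup>2) Q = - jtheta (P * X * Y\<^sup>2) Q / (P * X * Y\<^sup>2)" if "P \<noteq> 0" for P
    using J[of "P * X * Y\<^sup>2"] that assms by (simp add: Q_eq power2_eq_square power3_eq_cube mult_ac)
  have "jtheta (p * (p * X)\<^sup>2 * (p * Y)) Q * jtheta (p * (p * X) * (p * Y)\<^sup>2) Q =
      (jtheta (p * X\<^sup>2 * Y) Q * jtheta (p * X * Y\<^sup>2) Q) / (p\<^sup>2 * X ^ 3 * Y ^ 3)"
    unfolding 1[OF nz(1)] 2[OF nz(1)] by (simp add: eval_nat_numeral mult_ac)
  moreover have p2: "p\<^sup>2 \<noteq> 0" using nz by simp
  have "p * X * (p * Y) * jtheta (p\<^sup>2 * (p * X)\<^sup>2 * (p * Y)) Q * jtheta (p\<^sup>2 * (p * X) * (p * Y)\<^sup>2) Q =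
      (X * Y * jtheta (p\<^sup>2 * X\<^sup>2 * Y) Q * jtheta (p\<^sup>2 * X * Y\<^sup>2) Q) / (p\<^sup>2 * X ^ 3 * Y ^ 3)"
    unfolding 1[OF p2] 2[OF p2] using nz assms by (simp add: eval_nat_numeral mult_ac)
  ultimately show ?thesis unfolding theta_bracket_def by (simp add: diff_divide_distrib)
qed

lemma jtheta_cube_p_shift:
  assumes "Y \<noteq> 0"
  shows "jtheta ((p * Y) ^ 3) Q = - jtheta (Y ^ 3) Q / Y ^ 3"
  using jtheta_q_mult[OF Q, of "Y ^ 3"] assms by (simp add: Q_eq power_mult_distrib)

lemma jtheta_cube_Q_shift:
  assumes "Y \<noteq> 0"
  shows "jtheta ((Q * Y) ^ 3) Q = - jtheta (Y ^ 3) Q / (Q ^ 3 * Y ^ 9)"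
proof -
  have "(Q * Y) ^ 3 = Q ^ 3 * Y ^ 3" by (simp add: power_mult_distrib)
  moreover have "3 choose 2 = (3::nat)" by (simp add: eval_nat_numeral)
  ultimately show ?thesis
    using jtheta_q_power_mult[OF Q, of "Y ^ 3" 3] assms by (simp flip: power_mult)
qed

lemma theta_quot_Q_shift:
  assumes "X \<noteq> 0" "Y \<noteq> 0"
  shows "theta_quot X (Q * Y) = M / X ^ 3 * theta_quot X Y"
proof -
  have 1: "jtheta (Q * Y / X) Q = - (X / Y) * jtheta (Y / X) Q"
    using jtheta_q_mult[OF Q, of "Y / X"] assms by simp
  have 2: "jtheta (Q * Y) p = - jtheta Y p / (Q * Y ^ 3)"
  proof -
    have "3 choose 2 = (3::nat)" by (simp add: eval_nat_numeral)
    thus ?thesis using jtheta_q_power_mult[OF p assms(2), of 3] by (simp add: Q_eq)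
  qed
  show ?thesis
    unfolding theta_quot_def 1 2 theta_bracket_Q_shift[OF assms] jtheta_cube_Q_shift[OF assms(2)] using assms nz
    by (simp add: M_eq power_mult_distrib) (simp add: eval_nat_numeral mult_ac)
qed

lemma theta_quot_p_shift:
  assumes "X \<noteq> 0" "Y \<noteq> 0"
  shows "theta_quot (p * X) (p * Y) = p ^ (n + 1) / (p\<^sup>2 * X * Y) * theta_quot X Y"
proof -
  have 1: "jtheta (p * Y / (p * X)) Q = jtheta (Y / X) Q" using nz by simp
  show ?thesis
    unfolding theta_quot_def 1 jtheta_q_mult[OF p assms(1)] jtheta_q_mult[OF p assms(2)] theta_bracket_p_shift[OF assms]
      jtheta_cube_p_shift[OF assms(1)] jtheta_cube_p_shift[OF assms(2)] using assms nz
    by (simp add: power_mult_distrib)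
qed

lemma theta_corr_Q_shift:
  assumes "x \<noteq> 0" "y \<noteq> 0"
  shows "theta_corr x (Q * y) = M / (\<mu> * x) ^ 3 * theta_corr x y"
  using theta_quot_Q_shift[of "\<mu> * x" "\<mu> * y"] assms nz by (simp add: theta_corr_def mult_ac)

lemma theta_corr_p_shift:
  assumes "x \<noteq> 0" "y \<noteq> 0"
  shows "theta_corr x y = x * y * q ^ (n + 3) * theta_corr (p * x) (p * y)"
proof -
  \<comment> \<open>This comparison of exponents makes the multiplier agree with that of
    \<open>G0_p_shift\<close>.\<close>
  have "q ^ (n + 3) * p ^ (n + 1) = p\<^sup>2 * \<mu>\<^sup>2"
    unfolding p_def \<mu>_def power_mult[symmetric] power_add[symmetric]
    by (rule arg_cong[of _ _ "\<lambda>k. q ^ k"]) (simp add: algebra_simps power2_eq_square)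
  hence "x * y * q ^ (n + 3) * (p ^ (n + 1) / (p\<^sup>2 * (\<mu> * x) * (\<mu> * y))) = 1"
    using assms nz by (simp add: field_simps power2_eq_square)
  moreover have "theta_quot (\<mu> * (p * x)) (\<mu> * (p * y)) = p ^ (n + 1) / (p\<^sup>2 * (\<mu> * x) * (\<mu> * y)) * theta_quot (\<mu> * x) (\<mu> * y)"
    using theta_quot_p_shift[of "\<mu> * x" "\<mu> * y"] assms nz by (simp add: mult_ac)
  moreover have "a * (c * (k * r)) = (a * k) * (c * r)" for a c k r :: complex by simp
  ultimately show ?thesis unfolding theta_corr_def by (simp only: mult_1_left)
qed

text \<open>For \<open>w = 1\<close> both sides vanish; for a primitive cube root of unity \<open>w\<close> the bracket factors
  by \<open>theta_quintuple_variant\<close>, and everything depending on \<open>X\<close> cancels.\<close>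

lemma residue_constant:
  assumes X: "X \<noteq> 0" "jtheta (X ^ 3) Q \<noteq> 0" and w: "w ^ 3 = 1"
  shows "theta_const * (X * w ^ n * jtheta (w / X) Q * jtheta X p * jtheta w p * theta_bracket X w / jtheta (X ^ 3) Q) =
    - (qpoch_inf Q Q ^ 3) * jtheta (w / \<mu>) (q ^ n)"
proof -
  have w0: "w \<noteq> 0" using w by auto
  have \<mu>_qn: "\<mu> = (q ^ n) ^ (n + 1)" 
    unfolding \<mu>_def power_mult[symmetric]
    by (rule arg_cong[of _ _ "\<lambda>k. q ^ k"]) (simp add: power2_eq_square)
  \<comment> \<open>As \<mu> = (q^n)^(n+1), the points w/\<mu> and w are n + 1 theta shifts apart;
    in particular the value vanishes for w = 1.\<close>
  have jw: "jtheta (w / \<mu>) (q ^ n) = (-1) ^ (n + 1) * q ^ (n * ((n + 1) choose 2)) * (w / \<mu>) ^ (n + 1) * jtheta w (q ^ n)"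
  proof -
    have "jtheta w (q ^ n) = (-1) ^ (n + 1) * jtheta (w / \<mu>) (q ^ n) / (q ^ (n * ((n + 1) choose 2)) * (w / \<mu>) ^ (n + 1))"
      using jtheta_q_power_mult[OF qn, of "w / \<mu>" "n + 1"] w0 nz by (simp add: \<mu>_qn flip: power_mult)
    moreover have "e * c * d * (e * K / (c * d)) = (e * e) * K" if "c \<noteq> 0" "d \<noteq> 0" for e c d K :: complex
      using that by simp
    moreover have "(-1) ^ (n + 1) * (-1) ^ (n + 1) = (1 :: complex)" by (simp flip: power_mult_distrib)
    moreover have "q ^ (n * ((n + 1) choose 2)) \<noteq> 0" "(w / \<mu>) ^ (n + 1) \<noteq> 0" using q0 w0 nz by simp_all
    ultimately show ?thesis by (simp only: mult_1_left simp_thms)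
  qed
  show ?thesis
  proof (cases "w = 1")
    case True
    thus ?thesis using jw p qn by simp
  next
    case False
    have "(w - 1) * (1 + w + w\<^sup>2) = w ^ 3 - 1" by (simp add: algebra_simps power2_eq_square power3_eq_cube)
    hence cw: "1 + w + w\<^sup>2 = 0" using w False by simp
    have w3: "w * w\<^sup>2 = 1" by (rule cube_root_unity_mult[OF cw])
    \<comment> \<open>With this s one has w^2 s = w X and s^2 = w X^2, which puts
      \<open>theta_bracket X w\<close> into the form of
      \<open>theta_quintuple_variant\<close>.\<close>
    define s where "s = w\<^sup>2 * X"
    have s0: "s \<noteq> 0" using w0 X by (simp add: s_def)
    define JQ Jp where "JQ = qpoch_inf Q Q" and "Jp = qpoch_inf p p"
    have JQ0: "JQ \<noteq> 0" and Jp0: "Jp \<noteq> 0"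
      unfolding JQ_def Jp_def using qpoch_self_nonzero Q p by auto
    have theta_bracket: "theta_bracket X w * JQ = jtheta (w * X) p * jtheta (s * p) Q * jtheta (s * p\<^sup>2) Q"
    proof -
      have "s\<^sup>2 = (w * w\<^sup>2) * w * X\<^sup>2" "w\<^sup>2 * s = (w * w\<^sup>2) * w * X"
        by (simp_all add: s_def power2_eq_square mult_ac)
      hence e: "s\<^sup>2 = w * X\<^sup>2" "w\<^sup>2 * s = w * X" unfolding w3 by simp_all
      have "jtheta (s\<^sup>2 * p) Q * jtheta (s * p) Q - w\<^sup>2 * s * jtheta (s\<^sup>2 * p\<^sup>2) Q * jtheta (s * p\<^sup>2) Q = theta_bracket X w"
        unfolding e theta_bracket_def unfolding s_def by (simp add: mult_ac)
      thus ?thesis using theta_quintuple_variant[OF p cw s0] unfolding e(2) Q_eq[symmetric] JQ_def by simp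
    qed
    have tri: "jtheta s p * JQ ^ 3 = Jp * jtheta s Q * jtheta (s * p) Q * jtheta (s * p\<^sup>2) Q"
      unfolding JQ_def Jp_def Q_eq by (rule jtheta_trisect[OF p])
    have cube: "jtheta (X ^ 3) Q * Jp ^ 3 = jtheta X p * jtheta (w * X) p * jtheta s p * JQ"
      unfolding JQ_def Jp_def Q_eq s_def by (rule jtheta_cube[OF p cw])
    have inv: "jtheta (w / X) Q = - (w / X) * jtheta s Q"
    proof -
      have "1 / s = w / X" using w3 w0 X(1) by (simp add: s_def field_simps)
      thus ?thesis using jtheta_inverse[OF Q s0] by (metis divide_inverse inverse_eq_divide minus_mult_commute mult.commute)
    qed
    \<comment> \<open>Trisection assembles the thetas of modulus Q at s, s p and s p^2 into j(s; p);
      the cube formula then assembles j(X; p), j(w X; p) and j(w^2 X; p) into j(X^3; Q), which the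
      denominator removes.\<close>
    have "jtheta (w / X) Q * jtheta X p * theta_bracket X w * (JQ * Jp) =
        - (w / X) * (jtheta X p * jtheta (w * X) p) * (Jp * jtheta s Q * jtheta (s * p) Q * jtheta (s * p\<^sup>2) Q)"
      using theta_bracket inv by (simp only: mult_ac) (simp add: mult_ac)
    also have "\<dots> = - (w / X) * (jtheta X p * jtheta (w * X) p * jtheta s p * JQ) * JQ\<^sup>2"
      unfolding tri[symmetric] by (simp add: eval_nat_numeral mult_ac)
    also have "\<dots> = - (w / X) * jtheta (X ^ 3) Q * JQ * Jp\<^sup>2 * (JQ * Jp)"
      unfolding cube[symmetric] by (simp add: eval_nat_numeral mult_ac)
    finally have main: "jtheta (w / X) Q * jtheta X p * theta_bracket X w = - (w / X) * jtheta (X ^ 3) Q * JQ * Jp\<^sup>2"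
      using JQ0 Jp0 mult_right_cancel[of "JQ * Jp"] by (metis mult_eq_0_iff)
    have jwp: "jtheta w p = (1 - w) * JQ" unfolding JQ_def Q_eq by (rule jtheta_cube_root_unity[OF p cw])
    have jwq: "jtheta w (q ^ n) = (1 - w) * Jtheta (3 * n) q"
      using jtheta_cube_root_unity[OF qn cw] Jtheta_eq_qpoch[OF q, of "3 * n"] n
      by (simp add: mult.commute flip: power_mult)
    have J: "Jtheta (3 * (2 * n + 3)) q = JQ" "Jtheta (2 * n + 3) q = Jp"
      unfolding JQ_def Jp_def Q_def p_def by (intro Jtheta_eq_qpoch q; simp)+
    have "X * w ^ n * jtheta (w / X) Q * jtheta X p * jtheta w p * theta_bracket X w / jtheta (X ^ 3) Q =
        X * w ^ n * jtheta w p * (jtheta (w / X) Q * jtheta X p * theta_bracket X w) / jtheta (X ^ 3) Q"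
      by (simp add: mult_ac)
    also have "\<dots> = - (w ^ (n + 1)) * (1 - w) * JQ\<^sup>2 * Jp\<^sup>2"
      unfolding main jwp using X by (simp add: power2_eq_square mult_ac)
    finally show ?thesis unfolding jw jwq theta_const_def J JQ_def[symmetric]
      using Jp0 nz by (simp add: power_divide eval_nat_numeral mult_ac)
  qed
qed

section \<open>Vanishing of the defect\<close>

definition T :: "complex \<Rightarrow> complex" where "T x = jtheta ((\<mu> * x) ^ 3) Q"

definition G :: "complex \<Rightarrow> complex \<Rightarrow> complex" where "G x y = G0 x y + theta_corr x y"

lemma lerch_generic:
  assumes "x \<noteq> 0" "T x \<noteq> 0"
  shows "M powi r * (1 / ((\<mu> * x) ^ 3 * Q ^ t)) \<noteq> 1"
proof -
  have "M powi r * (1 / ((\<mu> * x) ^ 3 * Q ^ t)) = Q powi (int n * r - int t) / (\<mu> * x) ^ 3"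
    using nz by (simp add: M_eq power_int_diff power_int_power)
  thus ?thesis using not_Q_power_iff[OF assms(1)] assms(2) unfolding T_def by metis
qed

lemma holomorphic_on_imp_tendsto:
  assumes "f holomorphic_on A" "open A" "x \<in> A"
  shows "(f \<longlongrightarrow> f x) (at x)"
  using holomorphic_on_imp_continuous_on[OF assms(1)] assms(2,3)
  by (simp add: continuous_on_eq_continuous_at isCont_def)

lemma T_holomorphic: "T holomorphic_on - {0}"
  unfolding T_def using nz by (intro jtheta_holomorphic Q holomorphic_intros) auto

lemma open_good: "open {y. y \<noteq> 0 \<and> T y \<noteq> 0}"
proof -
  have "open (- {0} \<inter> T -` (- {0}))"
    using T_holomorphic by (intro continuous_open_preimage holomorphic_on_imp_continuous_on) auto
  moreover have "- {0} \<inter> T -` (- {0}) = {y. y \<noteq> 0 \<and> T y \<noteq> 0}" by auto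
  ultimately show ?thesis by simp
qed

lemma S_holomorphic_right:
  assumes "x \<noteq> 0" "T x \<noteq> 0"
  shows "(\<lambda>y. S x y) holomorphic_on - {0}"
  unfolding S_def using assms nz
  by (intro holomorphic_intros lerch_sum_holomorphic M lerch_generic) auto

lemma S_holomorphic_left:
  assumes "x \<noteq> 0"
  shows "(\<lambda>y. S y x) holomorphic_on {y. y \<noteq> 0 \<and> T y \<noteq> 0}"
  unfolding S_def using assms nz q0
  by (intro holomorphic_intros lerch_sum_holomorphic M lerch_generic jtheta_holomorphic qn open_good) auto

lemma theta_quot_holomorphic:
  assumes "X \<noteq> 0" "jtheta (X ^ 3) Q \<noteq> 0"
    and "f holomorphic_on A" "\<And>y. y \<in> A \<Longrightarrow> f y \<noteq> 0" "\<And>y. y \<in> A \<Longrightarrow> jtheta (f y ^ 3) Q \<noteq> 0"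
  shows "(\<lambda>y. theta_quot X (f y)) holomorphic_on A"
  unfolding theta_quot_def theta_bracket_def using assms nz
  by (intro holomorphic_intros jtheta_holomorphic Q p) auto

lemma G_holomorphic:
  assumes "x \<noteq> 0" "T x \<noteq> 0"
  shows "(\<lambda>y. G x y) holomorphic_on {y. y \<noteq> 0 \<and> T y \<noteq> 0}"
  unfolding G_def G0_def theta_corr_def using assms nz
  by (intro holomorphic_intros jtheta_holomorphic M S_holomorphic_left theta_quot_holomorphic
        holomorphic_on_subset[OF hecke_f_holomorphic[OF q _ n n]]
        holomorphic_on_subset[OF S_holomorphic_right]) (auto simp: T_def)

text \<open>At \<open>y = w / \<mu>\<close> the only singular summand of \<open>S y x\<close> is the one with \<open>t = 0\<close> and index \<open>0\<close> in
  the Lerch sum; its residue cancels against that of \<open>theta_corr\<close>.\<close>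

lemma G_limit_base:
  assumes x: "x \<noteq> 0" "T x \<noteq> 0" and w: "w ^ 3 = 1"
  shows "((\<lambda>y. (y - w / \<mu>) * G x y) \<longlongrightarrow> 0) (at (w / \<mu>))"
proof -
  define y0 where "y0 = w / \<mu>"
  have w0: "w \<noteq> 0" using w by auto
  have y0: "y0 \<noteq> 0" "\<mu> * y0 = w" using w0 nz by (auto simp: y0_def)
  \<comment> \<open>\<open>v\<close> is the Lerch parameter of the summand t = 0. It equals 1 at y0,
    so 1 - v is the denominator that vanishes there.\<close>
  define v where "v = (\<lambda>y. 1 / (\<mu> * y) ^ 3)"
  have id: "((\<lambda>y. y) \<longlongrightarrow> y0) (at y0)" by (rule tendsto_ident_at)
  have v: "(v \<longlongrightarrow> 1) (at y0)"
    unfolding v_def by (rule tendsto_eq_intros id refl | simp add: y0 w w0 nz)+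
  have v0: "((\<lambda>y. 1 - v y) \<longlongrightarrow> 0) (at y0)" using tendsto_diff[OF tendsto_const v, of 1] by simp
  have "((\<lambda>y. y\<^sup>2 + y * y0 + y0\<^sup>2) \<longlongrightarrow> y0\<^sup>2 + y0 * y0 + y0\<^sup>2) (at y0)" by (intro tendsto_intros)
  hence dl: "((\<lambda>y. y\<^sup>2 + y * y0 + y0\<^sup>2) \<longlongrightarrow> 3 * y0\<^sup>2) (at y0)" by (simp add: power2_eq_square)
  have ev0: "\<forall>\<^sub>F y in at y0. y\<^sup>2 + y * y0 + y0\<^sup>2 \<noteq> 0"
    using y0 by (intro tendsto_imp_eventually_ne[OF dl]) auto
  have ev1: "\<forall>\<^sub>F y in at y0. y \<noteq> 0" using y0 by (intro tendsto_imp_eventually_ne[OF id])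
  have ev2: "\<forall>\<^sub>F y in at y0. y \<noteq> y0" by (simp add: eventually_at_filter)
  \<comment> \<open>Since (\<mu> y0)^3 = 1, the difference is (y^3 - y0^3) / y^3, which has a simple
    zero at y0.\<close>
  have v_eq: "1 - v y = (y - y0) * (y\<^sup>2 + y * y0 + y0\<^sup>2) / y ^ 3" if "y \<noteq> 0" for y
  proof -
    have "v y = (\<mu> * y0) ^ 3 / (\<mu> * y) ^ 3" using y0 w by (simp add: v_def)
    hence "v y = y0 ^ 3 / y ^ 3" using nz by (simp add: power_mult_distrib)
    thus ?thesis using that by (simp add: field_simps) (simp add: algebra_simps power2_eq_square power3_eq_cube)
  qed
  have v_ne: "\<forall>\<^sub>F y in at y0. v y \<noteq> 1" using ev0 ev1 ev2
  proof eventually_elim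
    case (elim y)
    hence "1 - v y \<noteq> 0" by (simp add: v_eq)
    thus ?case by auto
  qed
  have zl: "((\<lambda>y. y ^ n / x ^ n) \<longlongrightarrow> y0 ^ n / x ^ n) (at y0)" using x by (intro tendsto_intros) auto
  have z0: "y0 ^ n / x ^ n \<noteq> 0" using x y0 by simp

  have S_left: "((\<lambda>y. (1 - v y) * S y x) \<longlongrightarrow> jtheta y0 (q ^ n)) (at y0)"
  proof -
    have "((\<lambda>y. \<Sum>t<n. (- x) ^ t * q ^ (n * (t choose 2)) * jtheta (q ^ ((n + 3) * t) * y) (q ^ n) *
        ((1 - v y) * lerch_sum M (1 / ((\<mu> * y) ^ 3 * Q ^ t)) (y ^ n / x ^ n))) \<longlongrightarrow>
       (\<Sum>t<n. (- x) ^ t * q ^ (n * (t choose 2)) * jtheta (q ^ ((n + 3) * t) * y0) (q ^ n) * (if t = 0 then 1 else 0))) (at y0)"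
    proof (intro tendsto_sum tendsto_mult[OF tendsto_mult[OF tendsto_const]])
      fix t assume t: "t \<in> {..<n}"
      show "((\<lambda>y. jtheta (q ^ ((n + 3) * t) * y) (q ^ n)) \<longlongrightarrow> jtheta (q ^ ((n + 3) * t) * y0) (q ^ n)) (at y0)"
        using q0 y0 by (intro jtheta_tendsto qn tendsto_intros) auto
      show "((\<lambda>y. (1 - v y) * lerch_sum M (1 / ((\<mu> * y) ^ 3 * Q ^ t)) (y ^ n / x ^ n)) \<longlongrightarrow> (if t = 0 then 1 else 0)) (at y0)"
      proof (cases "t = 0")
        case True
        have "((\<lambda>y. (1 - M powi 0 * v y) * lerch_sum M (v y) (y ^ n / x ^ n)) \<longlongrightarrow> theta_term M (y0 ^ n / x ^ n) 0) (at y0)"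
          by (rule lerch_sum_pole[OF M v zl _ z0 _ v_ne]) auto
        thus ?thesis using True by (simp add: v_def theta_term_def)
      next
        case False
        have e: "1 / ((\<mu> * y) ^ 3 * Q ^ t) = v y / Q ^ t" for y by (simp add: v_def)
        \<comment> \<open>A pole would require n to divide t, which 0 < t < n excludes.\<close>
        have g: "M powi r * (1 / Q ^ t) \<noteq> 1" for r
        proof
          assume "M powi r * (1 / Q ^ t) = 1"
          hence "Q powi (int n * r) = Q powi (int t)" using nz by (simp add: M_eq power_int_power)
          hence "int n * r = int t" by (rule power_int_inject_complex[OF Q])
          hence "int n dvd int t" by (metis dvd_triv_left)
          hence "n dvd t" by simp
          thus False using t False by (auto dest: dvd_imp_le)
        qed
        have "((\<lambda>y. (1 - v y) * lerch_sum M (v y / Q ^ t) (y ^ n / x ^ n)) \<longlongrightarrow> 0 * lerch_sum M (1 / Q ^ t) (y0 ^ n / x ^ n)) (at y0)"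
          using nz by (intro tendsto_mult[OF v0] lerch_sum_tendsto[OF M _ zl _ _ z0 g] tendsto_intros v) auto
        thus ?thesis using False unfolding e by simp
      qed
    qed
    also have "(\<Sum>t<n. (- x) ^ t * q ^ (n * (t choose 2)) * jtheta (q ^ ((n + 3) * t) * y0) (q ^ n) * (if t = 0 then 1 else 0)) = 
        (\<Sum>t\<in>{0}. (- x) ^ t * q ^ (n * (t choose 2)) * jtheta (q ^ ((n + 3) * t) * y0) (q ^ n) * (if t = 0 then 1 else 0))"
      using n by (intro sum.mono_neutral_right) auto
    also have "\<dots> = jtheta y0 (q ^ n)" by (simp add: binomial_eq_0)
    finally show ?thesis unfolding S_def sum_distrib_left by (simp add: mult_ac)
  qed

  define X where "X = \<mu> * x"
  have X: "X \<noteq> 0" "jtheta (X ^ 3) Q \<noteq> 0" using x nz by (auto simp: X_def T_def)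
  \<comment> \<open>\<open>B\<close> collects the factors of \<open>theta_corr\<close> that are
    regular at Y = w; the remaining 1 / j(Y^3; Q) is rewritten through v = 1/Y^3.\<close>
  define B where "B = (\<lambda>Y. theta_const * (X * Y ^ n * jtheta (Y / X) Q * jtheta X p * jtheta Y p * theta_bracket X Y / jtheta (X ^ 3) Q))"
  have theta_corr_eq: "(1 - v y) * theta_corr x y = B (\<mu> * y) * (- v y / (jtheta (v y) Q / (1 - v y)))" if "y \<noteq> 0" for y
  proof -
    have vy: "v y \<noteq> 0" using that nz by (simp add: v_def)
    have "jtheta ((\<mu> * y) ^ 3) Q = - jtheta (v y) Q / v y"
      using jtheta_inverse[OF Q vy] by (simp add: v_def)
    thus ?thesis using vy by (simp add: theta_corr_def theta_quot_def B_def X_def mult_ac)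
  qed
  have theta_corr_lim: "((\<lambda>y. (1 - v y) * theta_corr x y) \<longlongrightarrow> jtheta y0 (q ^ n)) (at y0)"
  proof -
    have "((\<lambda>y. \<mu> * y) \<longlongrightarrow> w) (at y0)" using tendsto_mult_left[OF id, of \<mu>] y0 by simp
    hence "((\<lambda>y. B (\<mu> * y)) \<longlongrightarrow> B w) (at y0)"
      unfolding B_def theta_bracket_def using X w0 nz
      by (intro tendsto_intros jtheta_tendsto Q p) auto
    moreover have "((\<lambda>y. - v y / (jtheta (v y) Q / (1 - v y))) \<longlongrightarrow> - 1 / qpoch_inf Q Q ^ 3) (at y0)"
      using qpoch_self_nonzero[OF Q(2)]
      by (intro tendsto_intros v jtheta_over_one_minus_tendsto Q v_ne) auto
    ultimately have "((\<lambda>y. B (\<mu> * y) * (- v y / (jtheta (v y) Q / (1 - v y)))) \<longlongrightarrow> B w * (- 1 / qpoch_inf Q Q ^ 3)) (at y0)"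
      by (rule tendsto_mult)
    also have "B w * (- 1 / qpoch_inf Q Q ^ 3) = jtheta y0 (q ^ n)"
      unfolding B_def residue_constant[OF X w] y0_def using qpoch_self_nonzero[OF Q(2)] by simp
    finally show ?thesis
    proof (rule Lim_transform_eventually)
      show "\<forall>\<^sub>F y in at y0. B (\<mu> * y) * (- v y / (jtheta (v y) Q / (1 - v y))) = (1 - v y) * theta_corr x y"
        using ev1 by eventually_elim (rule theta_corr_eq[symmetric])
    qed
  qed

  \<comment> \<open>The double sum and \<open>S x y\<close> are regular at y0 and are killed by 1 -
    v y; the two surviving limits are equal and enter with opposite signs.\<close>
  have l: "((\<lambda>y. (1 - v y) * (jtheta (y ^ n / x ^ n) M * hecke_f n (n + 3) n x y q)
       - (- (y ^ n / x ^ n) * ((1 - v y) * S x y) + (1 - v y) * S y x) + (1 - v y) * theta_corr x y) \<longlongrightarrow>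
      0 * (jtheta (y0 ^ n / x ^ n) M * hecke_f n (n + 3) n x y0 q)
       - (- (y0 ^ n / x ^ n) * (0 * S x y0) + jtheta y0 (q ^ n)) + jtheta y0 (q ^ n)) (at y0)"
    by (intro tendsto_add tendsto_diff tendsto_mult tendsto_minus v0 S_left theta_corr_lim zl jtheta_tendsto M z0
         holomorphic_on_imp_tendsto[OF hecke_f_holomorphic[OF q x(1) n n]]
         holomorphic_on_imp_tendsto[OF S_holomorphic_right[OF x]]) (use y0 in auto)
  have e: "a * j - (- z * (a * s) + a * s') + a * t = a * (j - (- z * s + s') + t)"
    for a j z s s' t :: complex by (simp add: algebra_simps)
  have lim: "((\<lambda>y. (1 - v y) * G x y) \<longlongrightarrow> 0) (at y0)"
    using l unfolding e G_def G0_def by simp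
  \<comment> \<open>The quotient of y - y0 by 1 - v y is regular at y0, so the limit passes from one
    to the other.\<close>
  have "((\<lambda>y. y ^ 3 / (y\<^sup>2 + y * y0 + y0\<^sup>2) * ((1 - v y) * G x y)) \<longlongrightarrow> y0 ^ 3 / (3 * y0\<^sup>2) * 0) (at y0)"
    by (intro tendsto_mult[OF _ lim] tendsto_divide[OF _ dl] tendsto_intros) (use y0 in auto)
  moreover have "\<forall>\<^sub>F y in at y0. y ^ 3 / (y\<^sup>2 + y * y0 + y0\<^sup>2) * ((1 - v y) * G x y) = (y - y0) * G x y"
    using ev0 ev1 by eventually_elim (simp add: v_eq)
  ultimately have "((\<lambda>y. (y - y0) * G x y) \<longlongrightarrow> y0 ^ 3 / (3 * y0\<^sup>2) * 0) (at y0)"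
    by (rule Lim_transform_eventually)
  thus ?thesis by (simp add: y0_def)
qed

lemma T_p_shift: "x \<noteq> 0 \<Longrightarrow> T (p * x) = 0 \<longleftrightarrow> T x = 0"
  using jtheta_cube_p_shift[of "\<mu> * x"] nz by (simp add: T_def mult.left_commute)

lemma T_Q_shift: "x \<noteq> 0 \<Longrightarrow> T (Q * x) = 0 \<longleftrightarrow> T x = 0"
  using jtheta_cube_Q_shift[of "\<mu> * x"] nz by (simp add: T_def mult.left_commute)

lemma G_p_shift:
  assumes "x \<noteq> 0" "y \<noteq> 0" "T x \<noteq> 0" "T y \<noteq> 0"
  shows "G x y = x * y * q ^ (n + 3) * G (p * x) (p * y)"
  using G0_p_shift[OF assms(1,2)] theta_corr_p_shift[OF assms(1,2)] assms(3,4)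
  by (simp add: G_def T_def distrib_left)

lemma eventually_T_nonzero:
  assumes "x \<noteq> 0" "T x \<noteq> 0" "y0 \<noteq> 0" "T y0 = 0"
  shows "\<forall>\<^sub>F y in at y0. y \<noteq> 0 \<and> T y \<noteq> 0"
proof -
  have conn: "connected (- {0::complex})"
    using connected_punctured_universe[of "0::complex"] by (simp add: DIM_complex)
  obtain e where e: "e > 0" "ball y0 e \<subseteq> - {0}" "\<And>z. z \<in> ball y0 e - {y0} \<Longrightarrow> T z \<noteq> 0"
    using isolated_zeros[OF T_holomorphic _ conn, of y0 x] assms by auto
  thus ?thesis unfolding eventually_at
    by (intro exI[of _ e]) (auto simp: dist_commute subset_iff)
qed

text \<open>The p-shift multiplies G by a nonvanishing monomial, and y -> y/p carries p y0 to y0.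
  The shift formula holds off the zeros of T, hence in a punctured neighbourhood, which is enough
  for a limit.\<close>

lemma G_limit_shift_up:
  assumes x: "x \<noteq> 0" "T x \<noteq> 0" and y0: "y0 \<noteq> 0" "T y0 = 0"
    and lim: "((\<lambda>y. (y - y0) * G x y) \<longlongrightarrow> 0) (at y0)"
  shows "((\<lambda>y. (y - p * y0) * G (p * x) y) \<longlongrightarrow> 0) (at (p * y0))"
proof -
  have "y / p \<noteq> y0" if "y \<noteq> p * y0" for y using that nz by (auto simp: field_simps)
  hence f: "filterlim (\<lambda>y. y / p) (at y0) (at (p * y0))"
    using nz by (auto simp: filterlim_at eventually_at_filter intro!: tendsto_eq_intros always_eventually)
  have "((\<lambda>y. p / (x * (y / p) * q ^ (n + 3)) * ((y / p - y0) * G x (y / p))) \<longlongrightarrow> p / (x * (p * y0 / p) * q ^ (n + 3)) * 0) (at (p * y0))"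
    using nz x y0 q0 by (intro tendsto_mult[OF _ filterlim_compose[OF lim f]] tendsto_intros) auto
  moreover have "\<forall>\<^sub>F y in at (p * y0). p / (x * (y / p) * q ^ (n + 3)) * ((y / p - y0) * G x (y / p)) = (y - p * y0) * G (p * x) y"
    using eventually_compose_filterlim[OF eventually_T_nonzero[OF x y0] f]
  proof eventually_elim
    case (elim y)
    hence "G x (y / p) = x * (y / p) * q ^ (n + 3) * G (p * x) y"
      using G_p_shift[OF x(1) _ x(2), of "y / p"] nz by simp
    moreover have "y - p * y0 = p * (y / p - y0)" using nz by (simp add: right_diff_distrib)
    ultimately show ?case using elim x nz q0 by simp
  qed
  ultimately show ?thesis by (simp add: Lim_transform_eventually)
qed

lemma G_limit_shift_down:
  assumes x: "x \<noteq> 0" "T x \<noteq> 0" and y0: "y0 \<noteq> 0" "T y0 = 0"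
    and lim: "((\<lambda>y. (y - p * y0) * G (p * x) y) \<longlongrightarrow> 0) (at (p * y0))"
  shows "((\<lambda>y. (y - y0) * G x y) \<longlongrightarrow> 0) (at y0)"
proof -
  have f: "filterlim (\<lambda>y. p * y) (at (p * y0)) (at y0)"
    using nz by (auto simp: filterlim_at eventually_at_filter intro!: tendsto_eq_intros)
  have "((\<lambda>y. x * y * q ^ (n + 3) / p * ((p * y - p * y0) * G (p * x) (p * y))) \<longlongrightarrow> x * y0 * q ^ (n + 3) / p * 0) (at y0)"
    using nz by (intro tendsto_mult[OF _ filterlim_compose[OF lim f]] tendsto_intros) auto
  moreover have "\<forall>\<^sub>F y in at y0. x * y * q ^ (n + 3) / p * ((p * y - p * y0) * G (p * x) (p * y)) = (y - y0) * G x y"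
    using eventually_T_nonzero[OF x y0]
  proof eventually_elim
    case (elim y)
    hence "G x y = x * y * q ^ (n + 3) * G (p * x) (p * y)" using x by (intro G_p_shift) auto
    moreover have "p * y - p * y0 = p * (y - y0)" by (simp add: right_diff_distrib)
    ultimately show ?case using nz by simp
  qed
  ultimately show ?thesis by (simp add: Lim_transform_eventually)
qed

text \<open>The zeros of \<open>T\<close> are \<open>p powi k * w / \<mu>\<close> with \<open>w ^ 3 = 1\<close>; shifting \<open>x\<close> and \<open>y\<close> simultaneously
  by \<open>p\<close> reduces to \<open>k = 0\<close>.\<close>

lemma G_limit:
  assumes x: "x \<noteq> 0" "T x \<noteq> 0" and y0: "y0 \<noteq> 0" "T y0 = 0"
  shows "((\<lambda>y. (y - y0) * G x y) \<longlongrightarrow> 0) (at y0)"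
proof -
  obtain k :: int where k: "(\<mu> * y0) ^ 3 = Q powi k"
    using jtheta_eq_0_iff[OF Q, of "(\<mu> * y0) ^ 3"] y0 nz by (auto simp: T_def)
  define w where "w = \<mu> * y0 / p powi k"
  have "(p powi k) ^ 3 = Q powi k" by (simp add: Q_eq power_int_power power_int_power' mult.commute)
  hence w: "w ^ 3 = 1" using k nz by (simp add: w_def power_divide)
  have wn: "w / \<mu> \<noteq> 0" "T (w / \<mu>) = 0" using w nz Q by (auto simp: T_def)
  have T_powi: "T (p powi i * (w / \<mu>)) = 0" for i
  proof -
    have *: "T (p powi (i + 1) * (w / \<mu>)) = 0 \<longleftrightarrow> T (p powi i * (w / \<mu>)) = 0" for i
      using T_p_shift[of "p powi i * (w / \<mu>)"] nz wn by (simp add: power_int_add mult_ac)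
    show ?thesis
    proof (induction i rule: int_induct[where k = 0])
      case (step2 i) thus ?case using *[of "i - 1"] by simp
    qed (use wn * in simp_all)
  qed
  \<comment> \<open>The induction is over all admissible x, because the p-shift moves x together
    with the pole; \<open>T_p_shift\<close> keeps x admissible.\<close>
  have "((\<lambda>y. (y - p powi i * (w / \<mu>)) * G x y) \<longlongrightarrow> 0) (at (p powi i * (w / \<mu>)))"
    if "x \<noteq> 0" "T x \<noteq> 0" for i x
    using that
  proof (induction i arbitrary: x rule: int_induct[where k = 0])
    case base
    thus ?case using G_limit_base[OF _ _ w] by simp
  next
    case (step1 i)
    have x': "x / p \<noteq> 0" "T (x / p) \<noteq> 0" using step1.prems T_p_shift[of "x / p"] nz by auto
    from G_limit_shift_up[OF x' _ T_powi step1.IH[OF x']] show ?case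
      using nz wn by (simp add: power_int_add mult_ac)
  next
    case (step2 i)
    have x': "p * x \<noteq> 0" "T (p * x) \<noteq> 0" using step2.prems T_p_shift[of x] nz by auto
    have e: "p * (p powi (i - 1) * (w / \<mu>)) = p powi i * (w / \<mu>)" using nz by (simp add: power_int_diff)
    show ?case
    proof (rule G_limit_shift_down[OF step2.prems _ T_powi])
      show "((\<lambda>y. (y - p * (p powi (i - 1) * (w / \<mu>))) * G (p * x) y) \<longlongrightarrow> 0) (at (p * (p powi (i - 1) * (w / \<mu>))))"
        unfolding e by (rule step2.IH[OF x'])
    qed (use nz wn in simp)
  qed
  from this[OF x, of k] show ?thesis using nz by (simp add: w_def)
qed

lemma G_Q_shift:
  assumes "x \<noteq> 0" "y \<noteq> 0" "T x \<noteq> 0" "T y \<noteq> 0"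
  shows "G x (Q * y) = M / (\<mu> * x) ^ 3 * G x y"
  using G0_Q_shift[OF assms(1,2)] theta_corr_Q_shift[OF assms(1,2)] assms(3,4)
  by (simp add: G_def T_def distrib_left)

theorem G_eq_0:
  assumes x: "x \<noteq> 0" "T x \<noteq> 0" and y: "y \<noteq> 0" "T y \<noteq> 0"
  shows "G x y = 0"
proof -
  have "\<exists>K. K holomorphic_on - {0} \<and> (\<forall>z. z \<noteq> 0 \<and> T z \<noteq> 0 \<longrightarrow> K z = G x z) \<and>
            (\<forall>z. z \<noteq> 0 \<longrightarrow> K (Q * z) = M / (\<mu> * x) ^ 3 * K z)"
    by (rule quasi_periodic_extension[OF nz(2) T_holomorphic x G_holomorphic[OF x] G_limit[OF x]])
       (use T_Q_shift G_Q_shift x in auto)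
  then obtain K where K: "K holomorphic_on - {0}" "\<And>z. z \<noteq> 0 \<Longrightarrow> T z \<noteq> 0 \<Longrightarrow> K z = G x z"
      "\<And>z. z \<noteq> 0 \<Longrightarrow> K (Q * z) = M / (\<mu> * x) ^ 3 * K z" by blast
  \<comment> \<open>As M is a power of Q, equality would make (\<mu> x)^3 a power of Q, that is, a
    zero of the theta function defining T.\<close>
  have "M / (\<mu> * x) ^ 3 \<noteq> Q powi k" for k
  proof
    assume "M / (\<mu> * x) ^ 3 = Q powi k"
    hence "Q powi (int n - k) / (\<mu> * x) ^ 3 = 1"
      using nz x by (simp add: M_eq power_int_diff field_simps)
    thus False using not_Q_power_iff[OF x(1)] x(2) by (auto simp: T_def)
  qed
  hence "K y = 0" using quasi_periodic_imp_zero[OF Q K(1) K(3) _ y(1)] by blast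
  thus ?thesis using K(2)[OF y] by simp
qed

section \<open>Translation to the Appell--Lerch form of g\<close>

lemma hecke_g_arg_eq:
  "hecke_g_arg n (n + 3) n x y q t = M / (\<mu> ^ 3 * Q ^ t) * (y ^ n / x ^ (n + 3))"
proof -
  have c: "int ((n + 3 + 1) choose 2) = int ((n + 1) choose 2) + (3 * int n + 6)"
    using binom2_add[of "int (n + 1)" 3] unfolding binom2_int[symmetric]
    by (simp add: binom2_def[of 3] algebra_simps)
  have "int n * int ((n + 3 + 1) choose 2) - int n * int ((n + 1) choose 2) - int t * ((int (n + 3))\<^sup>2 - int n * int n) =
      int (3 * n * (2 * n + 3)) - (int ((n\<^sup>2 + n) * 3) + int (3 * (2 * n + 3) * t))"
    unfolding c by (simp add: algebra_simps power2_eq_square)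
  hence "q powi (int n * int ((n + 3 + 1) choose 2) - int n * int ((n + 1) choose 2) - int t * ((int (n + 3))\<^sup>2 - int n * int n)) =
      M / (\<mu> ^ 3 * Q ^ t)"
    unfolding M_def \<mu>_def Q_def power_mult[symmetric] power_add[symmetric] using q0
    by (simp only: power_int_diff of_nat_add[symmetric] power_int_of_nat simp_thms)
  \<comment> \<open>The signs (-1)^n and (-1)^(n+3) have quotient -1, which cancels the sign in
    \<open>hecke_g_arg\<close>.\<close>
  moreover have "(- y) ^ n / (- x) ^ (n + 3) = - (y ^ n / x ^ (n + 3))"
    by (simp add: power_minus[of y n] power_minus[of x "n + 3"]) (simp add: power_add)
  ultimately show ?thesis unfolding hecke_g_arg_def by simp
qed

lemma hecke_g_modulus: "q powi (int n * ((int (n + 3))\<^sup>2 - int n * int n)) = M"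
proof -
  have "int n * ((int (n + 3))\<^sup>2 - int n * int n) = int (3 * n * (2 * n + 3))"
    by (simp add: algebra_simps power2_eq_square)
  thus ?thesis unfolding M_def by (simp only: power_int_of_nat)
qed

lemma hecke_g_half:
  assumes "x \<noteq> 0" "y \<noteq> 0"
  shows "(\<Sum>t<n. (- y) ^ t * q ^ (n * (t choose 2)) * jtheta (q ^ ((n + 3) * t) * x) (q ^ n) *
        appell_lerch (hecke_g_arg n (n + 3) n x y q t) M (x ^ n / y ^ n)) = S x y / jtheta (x ^ n / y ^ n) M"
proof -
  have "hecke_g_arg n (n + 3) n x y q t * (x ^ n / y ^ n) / M = 1 / ((\<mu> * x) ^ 3 * Q ^ t)" for t
    unfolding hecke_g_arg_eq using assms nz by (simp add: power_add power_mult_distrib)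
  hence "appell_lerch (hecke_g_arg n (n + 3) n x y q t) M (x ^ n / y ^ n) =
      lerch_sum M (1 / ((\<mu> * x) ^ 3 * Q ^ t)) (x ^ n / y ^ n) / jtheta (x ^ n / y ^ n) M" for t
    by (simp only: appell_lerch_eq_lerch_sum[OF nz(3)])
  thus ?thesis unfolding S_def sum_divide_distrib by simp
qed

end

theorem theorem0p13:
  fixes q x y :: complex and n :: nat
  assumes "0 < norm q" and "norm q < 1"
    and "n > 0" and "gcd n 3 = 1"
    and "x \<noteq> 0" and "y \<noteq> 0"
    and "hecke_g_generic n (n + 3) n x y q (y ^ n / x ^ n) (x ^ n / y ^ n)"
    and "Theta3_denom n x y q \<noteq> 0"
  shows "hecke_f n (n + 3) n x y q =
    hecke_g n (n + 3) n x y q (y ^ n / x ^ n) (x ^ n / y ^ n) - Theta3 n x y q"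
proof -
  interpret hecke_3 q n by unfold_locales (use assms in auto)
  define z where "z = y ^ n / x ^ n"
  have z: "z \<noteq> 0" "1 / z = x ^ n / y ^ n" using assms(5,6) by (simp_all add: z_def)
  have e: "q ^ (3 * n\<^sup>2 + 3 * n) = \<mu> ^ 3" by (simp add: \<mu>_def algebra_simps flip: power_mult)
  \<comment> \<open>The denominator of \<Theta> contains j(z; M) and the theta functions behind
    \<open>T x\<close> and \<open>T y\<close>; its nonvanishing permits both \<open>G_eq_0\<close>
    and the final division by j(z; M).\<close>
  have jz: "jtheta z M \<noteq> 0" and T: "T x \<noteq> 0" "T y \<noteq> 0"
    using assms(8) by (simp_all add: Theta3_denom_def Let_def e z_def M_def T_def Q_def power_mult_distrib)
  have "hecke_g n (n + 3) n x y q z (1 / z) = S x y / jtheta (1 / z) M + S y x / jtheta z M"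
    unfolding hecke_g_def hecke_g_modulus z(2) z_def
    using hecke_g_half[OF assms(5,6)] hecke_g_half[OF assms(6,5)] by simp
  also have "\<dots> = (- z * S x y + S y x) / jtheta z M"
    unfolding jtheta_inverse[OF M z(1)] using jz z by (simp add: field_simps)
  finally have g: "jtheta z M * hecke_g n (n + 3) n x y q z (1 / z) = - z * S x y + S y x"
    using jz by simp
  have "G x y = 0" using G_eq_0 assms(5,6) T by blast
  hence "jtheta z M * hecke_f n (n + 3) n x y q - jtheta z M * hecke_g n (n + 3) n x y q z (1 / z)
      + Theta3 n x y q * jtheta z M = 0"
    using Theta3_eq[OF assms(5), of y] jz unfolding G_def G0_def z_def[symmetric] g by simp
  hence "jtheta z M * (hecke_f n (n + 3) n x y q - hecke_g n (n + 3) n x y q z (1 / z) + Theta3 n x y q) = 0"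
    by (simp add: algebra_simps)
  hence "hecke_f n (n + 3) n x y q - hecke_g n (n + 3) n x y q z (1 / z) + Theta3 n x y q = 0"
    using jz mult_eq_0_iff by blast
  hence "hecke_f n (n + 3) n x y q = hecke_g n (n + 3) n x y q z (1 / z) - Theta3 n x y q"
    by (simp add: algebra_simps)
  thus ?thesis unfolding z(2) unfolding z_def .
qed

end
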